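(* Let $u\in H^1(Q_R;\mathbb{R}^d)$ be a weak solution of $\mathcal L_\infty(u)=0$ in $Q_R$ for some $R\ge32$. Then for any $\ell\ge1$, $$\int_{Q_{R/2}}|\nabla u|^2\,dx\le\frac{C}{R^2}\int_{Q_R}|u|^2\,dx+\frac{C}{R^{2\ell}}\int_{Q_R}|\nabla u|^2\,dx,$$ where $C$ depends only on $d,\kappa_1,\kappa_2,\ell$ and $\omega$.
   Context: Let $d\ge2$. $\omega\subset\mathbb{R}^d$ is a connected, unbounded open set that is 1-periodic, with $\mathbb{R}^d\setminus\omega=\bigcup_k\overline F_k$, each $F_k$ a bounded Lipschitz domain with connected boundary, the $\overline F_k$ mutually disjoint, and $\min_{k\ne\ell}\operatorname{dist}(F_k,F_\ell)>0$; $F=\bigcup_kF_k$. $A=(a_{ij}^{\alpha\beta})$ is real, bounded measurable, 1-periodic, with $a_{ij}^{\alpha\beta}=a_{ji}^{\beta\alpha}=a_{\alpha j}^{i\beta}$ and $\kappa_1|\xi|^2\le a_{ij}^{\alpha\beta}\xi_i^\alpha\xi_j^\beta\le\kappa_2|\xi|^2$ for symmetric $\xi\in\mathbb{R}^{d\times d}$. $Du=(\nabla u+(\nabla u)^T)/2$. A function $u\in H^1(\Omega;\mathbb{R}^d)$ is a weak solution of $\mathcal L_\infty(u)=0$ in $\Omega$ if $Du=0$ in $\Omega\cap F$ and $\int_{\Omega\cap\omega}A\nabla u\cdot\nabla v\,dx=0$ for all $v\in H^1_0(\Omega;\mathbb{R}^d)$ with $Dv=0$ in $\Omega\cap F$.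 $Q_R=(-R/2,R/2)^d$. *)

theory Defs
  imports "HOL-Analysis.Analysis"
begin

(* Points of R^d are vectors real^'n, with d = CARD('n).
   Vector fields u : R^d -> R^d are maps real^'n => real^'n.
   A gradient matrix G has entries  G $ alpha $ i = d_i u^alpha. *)

definition cube :: "real \<Rightarrow> (real^'n::finite) set" where
  "cube R = {x. \<forall>i. \<bar>x $ i\<bar> < R / 2}"

definition int_periodic_set :: "(real^'n::finite) set \<Rightarrow> bool" where
  "int_periodic_set S \<longleftrightarrow> (\<forall>x z. (\<forall>i. z $ i \<in> \<int>) \<longrightarrow> (x \<in> S \<longleftrightarrow> x + z \<in> S))"

definition pd :: "'n::finite \<Rightarrow> (real^'n \<Rightarrow> real) \<Rightarrow> real^'n \<Rightarrow> real" where
  "pd i f x = frechet_derivative f (at x) (axis i 1)"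

fun iter_pd :: "'n::finite list \<Rightarrow> (real^'n \<Rightarrow> real) \<Rightarrow> real^'n \<Rightarrow> real" where
  "iter_pd [] f = f"
| "iter_pd (i # is) f = pd i (iter_pd is f)"

definition smooth_fun :: "(real^'n::finite \<Rightarrow> real) \<Rightarrow> bool" where
  "smooth_fun f \<longleftrightarrow> (\<forall>is x. iter_pd is f differentiable (at x))"

definition tsupport :: "(real^'n::finite \<Rightarrow> real) \<Rightarrow> (real^'n) set" where
  "tsupport f = closure {x. f x \<noteq> 0}"

definition test_fun :: "(real^'n::finite) set \<Rightarrow> (real^'n \<Rightarrow> real) \<Rightarrow> bool" where
  "test_fun \<Omega> \<phi> \<longleftrightarrow> smooth_fun \<phi> \<and> compact (tsupport \<phi>) \<and> tsupport \<phi> \<subseteq> \<Omega>"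

definition L2_on :: "(real^'n::finite) set \<Rightarrow> (real^'n \<Rightarrow> 'b::euclidean_space) \<Rightarrow> bool" where
  "L2_on \<Omega> f \<longleftrightarrow> set_borel_measurable lebesgue \<Omega> f
      \<and> set_integrable lebesgue \<Omega> (\<lambda>x. (norm (f x))\<^sup>2)"

definition weak_grad :: "(real^'n::finite) set \<Rightarrow> (real^'n \<Rightarrow> real^'n) \<Rightarrow> (real^'n \<Rightarrow> real^'n^'n) \<Rightarrow> bool" where
  "weak_grad \<Omega> u G \<longleftrightarrow> (\<forall>\<phi>. test_fun \<Omega> \<phi> \<longrightarrow> (\<forall>\<alpha> i.
      (LINT x:\<Omega>|lebesgue. u x $ \<alpha> * pd i \<phi> x) = - (LINT x:\<Omega>|lebesgue. G x $ \<alpha> $ i * \<phi> x)))"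

definition H1 :: "(real^'n::finite) set \<Rightarrow> (real^'n \<Rightarrow> real^'n) \<Rightarrow> (real^'n \<Rightarrow> real^'n^'n) \<Rightarrow> bool" where
  "H1 \<Omega> u G \<longleftrightarrow> L2_on \<Omega> u \<and> L2_on \<Omega> G \<and> weak_grad \<Omega> u G"

definition cgrad :: "(real^'n::finite \<Rightarrow> real^'n) \<Rightarrow> real^'n \<Rightarrow> real^'n^'n" where
  "cgrad \<psi> x = (\<chi> \<alpha> i. pd i (\<lambda>y. \<psi> y $ \<alpha>) x)"

definition H1_0 :: "(real^'n::finite) set \<Rightarrow> (real^'n \<Rightarrow> real^'n) \<Rightarrow> (real^'n \<Rightarrow> real^'n^'n) \<Rightarrow> bool" where
  "H1_0 \<Omega> v G \<longleftrightarrow> H1 \<Omega> v G \<and>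
     (\<exists>\<psi> :: nat \<Rightarrow> real^'n \<Rightarrow> real^'n.
        (\<forall>n \<alpha>. test_fun \<Omega> (\<lambda>x. \<psi> n x $ \<alpha>)) \<and>
        (\<lambda>n. LINT x:\<Omega>|lebesgue. (norm (\<psi> n x - v x))\<^sup>2) \<longlonglongrightarrow> 0 \<and>
        (\<lambda>n. LINT x:\<Omega>|lebesgue. (norm (cgrad (\<psi> n) x - G x))\<^sup>2) \<longlonglongrightarrow> 0)"

definition lipschitz_domain :: "(real^'n::finite) set \<Rightarrow> bool" where
  "lipschitz_domain D \<longleftrightarrow> bounded D \<and> open D \<and> connected D \<and> D \<noteq> {} \<and>
     (\<forall>p\<in>frontier D. \<exists>(e::real^'n) r h L (g::real^'n \<Rightarrow> real).
        norm e = 1 \<and> r > 0 \<and> h > 0 \<and>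
        L-lipschitz_on {y. y \<bullet> e = 0} g \<and>
        (\<forall>y. y \<bullet> e = 0 \<and> norm y < r \<longrightarrow> \<bar>g y\<bar> < h) \<and>
        (\<forall>x. norm ((x - p) - ((x - p) \<bullet> e) *\<^sub>R e) < r \<and> \<bar>(x - p) \<bullet> e\<bar> < h \<longrightarrow>
              (x \<in> D \<longleftrightarrow> (x - p) \<bullet> e > g ((x - p) - ((x - p) \<bullet> e) *\<^sub>R e))))"

(* coefficients a x i j alpha beta = a_{ij}^{alpha beta}(x) *)
type_synonym 'n coeff = "real^'n \<Rightarrow> 'n \<Rightarrow> 'n \<Rightarrow> 'n \<Rightarrow> 'n \<Rightarrow> real"

definition admissible_coeff :: "real \<Rightarrow> real \<Rightarrow> ('n::finite) coeff \<Rightarrow> bool" where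
  "admissible_coeff \<kappa>1 \<kappa>2 a \<longleftrightarrow>
     (\<forall>i j \<alpha> \<beta>. (\<lambda>x. a x i j \<alpha> \<beta>) \<in> borel_measurable lebesgue) \<and>
     (\<exists>M. \<forall>x i j \<alpha> \<beta>. \<bar>a x i j \<alpha> \<beta>\<bar> \<le> M) \<and>
     (\<forall>x z. (\<forall>k. z $ k \<in> \<int>) \<longrightarrow> a (x + z) = a x) \<and>
     (\<forall>x i j \<alpha> \<beta>. a x i j \<alpha> \<beta> = a x j i \<beta> \<alpha> \<and> a x i j \<alpha> \<beta> = a x \<alpha> j i \<beta>) \<and>
     (\<forall>x (\<xi>::real^'n^'n). transpose \<xi> = \<xi> \<longrightarrow>
        \<kappa>1 * (norm \<xi>)\<^sup>2 \<le> (\<Sum>i\<in>UNIV. \<Sum>j\<in>UNIV. \<Sum>\<alpha>\<in>UNIV. \<Sum>\<beta>\<in>UNIV. a x i j \<alpha> \<beta> * \<xi> $ \<alpha> $ i * \<xi> $ \<beta> $ j) \<and>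
        (\<Sum>i\<in>UNIV. \<Sum>j\<in>UNIV. \<Sum>\<alpha>\<in>UNIV. \<Sum>\<beta>\<in>UNIV. a x i j \<alpha> \<beta> * \<xi> $ \<alpha> $ i * \<xi> $ \<beta> $ j) \<le> \<kappa>2 * (norm \<xi>)\<^sup>2)"

definition Aform :: "('n::finite) coeff \<Rightarrow> real^'n \<Rightarrow> real^'n^'n \<Rightarrow> real^'n^'n \<Rightarrow> real" where
  "Aform a x P Q = (\<Sum>i\<in>UNIV. \<Sum>j\<in>UNIV. \<Sum>\<alpha>\<in>UNIV. \<Sum>\<beta>\<in>UNIV. a x i j \<alpha> \<beta> * P $ \<beta> $ j * Q $ \<alpha> $ i)"

definition sym_grad_zero_on :: "(real^'n::finite) set \<Rightarrow> (real^'n \<Rightarrow> real^'n^'n) \<Rightarrow> bool" where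
  "sym_grad_zero_on S G \<longleftrightarrow> (AE x in lebesgue. x \<in> S \<longrightarrow> G x + transpose (G x) = 0)"

(* u (with weak gradient G) is a weak solution of L_infty(u) = 0 in Omega;
   omega is the connected (soft) part, F the union of the rigid inclusions *)
definition weak_sol_Linf :: "('n::finite) coeff \<Rightarrow> (real^'n) set \<Rightarrow> (real^'n) set \<Rightarrow> (real^'n) set
     \<Rightarrow> (real^'n \<Rightarrow> real^'n) \<Rightarrow> (real^'n \<Rightarrow> real^'n^'n) \<Rightarrow> bool" where
  "weak_sol_Linf a \<omega> F \<Omega> u G \<longleftrightarrow> H1 \<Omega> u G \<and> sym_grad_zero_on (\<Omega> \<inter> F) G \<and>
     (\<forall>v Gv. H1_0 \<Omega> v Gv \<and> sym_grad_zero_on (\<Omega> \<inter> F) Gv \<longrightarrow>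
        (LINT x:(\<Omega> \<inter> \<omega>)|lebesgue. Aform a x (G x) (Gv x)) = 0)"

end

theory Submission
  imports Defs
begin

text \<open>
  If a cutoff function \<open>\<phi>\<close> is constant on every inclusion, then \<open>\<phi>\<^sup>2 u\<close> is rigid on the inclusions
  whenever \<open>u\<close> is, so it is an admissible test function.  With \<open>E\<close> and \<open>B\<close> the symmetric parts of
  \<open>\<nabla>(\<phi> u)\<close> and \<open>u \<otimes> \<nabla>\<phi>\<close>, completing the square gives
  \<open>A \<nabla>u \<cdot> \<nabla>(\<phi>\<^sup>2 u) = A E \<cdot> E - A B \<cdot> B\<close>; since \<open>E\<close> vanishes on the inclusions, Korn's inequality
  for \<open>\<phi> u\<close> on the whole cube yields the Caccioppoli inequality
  \<open>\<integral> \<bar>\<nabla>(\<phi> u)\<bar>\<^sup>2 \<le> C \<integral> \<bar>\<nabla>\<phi>\<bar>\<^sup>2 \<bar>u\<bar>\<^sup>2\<close>, without the second term.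
  By periodicity and separation the inclusions have uniformly bounded diameters, so such a \<open>\<phi>\<close> with
  \<open>\<bar>\<nabla>\<phi>\<bar> \<le> C / R\<close> exists once \<open>R\<close> exceeds some \<open>R\<^sub>0\<close>: replace the value of an ordinary cutoff near
  each inclusion by its value at one point of that inclusion, and mollify.  For \<open>R < R\<^sub>0\<close> the second
  term alone dominates the left-hand side.
\<close>

subsection \<open>Smooth functions\<close>

text \<open>Membership in \<open>H1_0\<close> is defined through smooth approximants, while
  \<open>u\<close> is known only through distributional identities. Most of the analysis below
  bridges this gap: a product with a cutoff has compact support in the cube, so it can be mollified,
  and the mollified functions converge in L2 together with their gradients because translations are
  continuous in L2. The same approximants yield Korn's inequality with constant 2: for compactly
  supported fields the L2 product of two first derivatives is unchanged when the two directions are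
  exchanged, which turns the mixed term of the symmetric gradient into the square of the divergence.

  The energy argument covers only points of the soft part and of the open inclusions, so the
  boundaries of the inclusions must be null sets; this is where the Lipschitz charts enter. The
  threshold \<open>R0\<close> arises because the displacement caused by collapsing inclusions to
  points has to fit into a margin of the cutoff proportional to \<open>R\<close>. It depends on the
  separation and a diameter bound alone, so it may enter \<open>C\<close>.\<close>

lemma pd_eqI:
  assumes "(f has_derivative D) (at x)"
  shows "pd i f x = D (axis i 1)"
  using assms frechet_derivative_at by (metis pd_def)

lemma iter_pd_append: "iter_pd (is @ js) f = iter_pd is (iter_pd js f)"
  by (induction "is") auto

lemma smooth_fun_pd: "smooth_fun f \<Longrightarrow> smooth_fun (pd i f)"
  unfolding smooth_fun_def by (metis iter_pd.simps iter_pd_append)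

lemma smooth_fun_differentiable: "smooth_fun f \<Longrightarrow> f differentiable (at x)"
  unfolding smooth_fun_def by (metis iter_pd.simps(1))

text \<open>\<open>smooth_fun\<close> is the largest class of everywhere differentiable functions
  closed under all partial derivatives, so any such class containing \<open>f\<close> witnesses
  smoothness. Later proofs exhibit a class instead of inducting over lists of indices.\<close>

lemma smooth_fun_coinduct:
  assumes "f \<in> X" and "\<And>g x. g \<in> X \<Longrightarrow> g differentiable (at x)"
    and "\<And>g i. g \<in> X \<Longrightarrow> pd i g \<in> X"
  shows "smooth_fun f"
proof -
  have "iter_pd is f \<in> X" for "is" by (induction "is") (use assms in auto)
  then show ?thesis using assms(2) by (auto simp: smooth_fun_def)
qed

lemma has_derivative_pd:
  fixes f :: "real^'n::finite \<Rightarrow> real"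
  assumes "f differentiable (at x)"
  shows "(f has_derivative (\<lambda>h. \<Sum>i\<in>UNIV. h $ i * pd i f x)) (at x)"
proof -
  let ?D = "frechet_derivative f (at x)"
  have D: "(f has_derivative ?D) (at x)"
    using assms frechet_derivative_works by blast
  then have lin: "linear ?D" by (rule has_derivative_linear)
  have "?D h = (\<Sum>i\<in>UNIV. h $ i * pd i f x)" for h
  proof -
    have "?D h = ?D (\<Sum>i\<in>UNIV. h $ i *\<^sub>R axis i 1)"
      by (simp add: basis_expansion scalar_mult_eq_scaleR[symmetric])
    also have "\<dots> = (\<Sum>i\<in>UNIV. h $ i * pd i f x)"
      by (simp add: linear_sum[OF lin] linear_cmul[OF lin] pd_def)
    finally show ?thesis .
  qed
  then have "?D = (\<lambda>h. \<Sum>i\<in>UNIV. h $ i * pd i f x)" by (intro ext)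
  with D show ?thesis by simp
qed

lemma smooth_fun_has_derivative:
  fixes f :: "real^'n::finite \<Rightarrow> real"
  assumes "smooth_fun f"
  shows "(f has_derivative (\<lambda>h. \<Sum>i\<in>UNIV. h $ i * pd i f x)) (at x)"
  using assms by (intro has_derivative_pd smooth_fun_differentiable)

lemma smooth_fun_continuous: "smooth_fun f \<Longrightarrow> continuous_on S f"
  by (meson continuous_at_imp_continuous_on differentiable_imp_continuous_within smooth_fun_differentiable)

lemma smooth_fun_borel [measurable_dest]: "smooth_fun f \<Longrightarrow> f \<in> borel_measurable borel"
  by (intro borel_measurable_continuous_onI smooth_fun_continuous)

text \<open>The product rule leads out of a family of generators but not out of the polynomials in
  them. Smoothness thus reduces to generators whose partial derivatives are again such
  polynomials.\<close>

inductive_set pd_algebra :: "(real^'n::finite \<Rightarrow> real) set \<Rightarrow> (real^'n \<Rightarrow> real) set"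
  for B where
  base: "b \<in> B \<Longrightarrow> b \<in> pd_algebra B"
| const: "(\<lambda>x. c) \<in> pd_algebra B"
| add: "f \<in> pd_algebra B \<Longrightarrow> g \<in> pd_algebra B \<Longrightarrow> (\<lambda>x. f x + g x) \<in> pd_algebra B"
| mult: "f \<in> pd_algebra B \<Longrightarrow> g \<in> pd_algebra B \<Longrightarrow> (\<lambda>x. f x * g x) \<in> pd_algebra B"

lemma pd_const: "pd i (\<lambda>x. c) = (\<lambda>x. 0)"
  by (rule ext, rule pd_eqI[THEN trans], rule has_derivative_const) simp

lemma pd_add:
  assumes "f differentiable (at x)" "g differentiable (at x)"
  shows "pd i (\<lambda>x. f x + g x) x = pd i f x + pd i g x"
proof -
  have "((\<lambda>x. f x + g x) has_derivative
     (\<lambda>h. frechet_derivative f (at x) h + frechet_derivative g (at x) h)) (at x)"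
    using assms by (intro has_derivative_add) (auto simp: frechet_derivative_works)
  from pd_eqI[OF this] show ?thesis by (simp add: pd_def)
qed

lemma pd_mult:
  assumes "f differentiable (at x)" "g differentiable (at x)"
  shows "pd i (\<lambda>x. f x * g x) x = f x * pd i g x + pd i f x * g x"
proof -
  have "((\<lambda>x. f x * g x) has_derivative
     (\<lambda>h. f x * frechet_derivative g (at x) h + frechet_derivative f (at x) h * g x)) (at x)"
    using assms by (intro has_derivative_mult) (auto simp: frechet_derivative_works)
  from pd_eqI[OF this] show ?thesis by (simp add: pd_def)
qed

lemma smooth_fun_pd_algebra:
  assumes f: "f \<in> pd_algebra B"
    and d: "\<And>b x. b \<in> B \<Longrightarrow> b differentiable (at x)"
    and p: "\<And>b i. b \<in> B \<Longrightarrow> pd i b \<in> pd_algebra B"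
  shows "smooth_fun f"
proof (rule smooth_fun_coinduct[OF f])
  show dd: "g differentiable (at x)" if "g \<in> pd_algebra B" for g x
    using that by induction (auto intro: d)
  show "pd i g \<in> pd_algebra B" if "g \<in> pd_algebra B" for g i
    using that
  proof induction
    case (base b)
    then show ?case by (rule p)
  next
    case (const c)
    then show ?case by (simp add: pd_const pd_algebra.const)
  next
    case (add f g)
    then have "pd i (\<lambda>x. f x + g x) = (\<lambda>x. pd i f x + pd i g x)"
      by (intro ext pd_add dd)
    then show ?case using add by (simp add: pd_algebra.add)
  next
    case (mult f g)
    then have "pd i (\<lambda>x. f x * g x) = (\<lambda>x. f x * pd i g x + pd i f x * g x)"
      by (intro ext pd_mult dd)
    then show ?case using mult by (simp add: pd_algebra.add pd_algebra.mult)
  qed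
qed

lemma smooth_fun_algebra:
  assumes "f \<in> pd_algebra (Collect smooth_fun)"
  shows "smooth_fun f"
  using assms
  by (rule smooth_fun_pd_algebra)
    (auto intro: smooth_fun_differentiable pd_algebra.base simp: smooth_fun_pd)

lemma smooth_fun_const: "smooth_fun (\<lambda>x. c)"
  by (intro smooth_fun_algebra pd_algebra.const)

lemma smooth_fun_add: "smooth_fun f \<Longrightarrow> smooth_fun g \<Longrightarrow> smooth_fun (\<lambda>x. f x + g x)"
  by (intro smooth_fun_algebra pd_algebra.add pd_algebra.base) auto

lemma smooth_fun_mult: "smooth_fun f \<Longrightarrow> smooth_fun g \<Longrightarrow> smooth_fun (\<lambda>x. f x * g x)"
  by (intro smooth_fun_algebra pd_algebra.mult pd_algebra.base) auto

lemma smooth_fun_prod: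
  assumes "\<And>k. k \<in> K \<Longrightarrow> smooth_fun (f k)"
  shows "smooth_fun (\<lambda>x. \<Prod>k\<in>K. f k x)"
  using assms by (induction K rule: infinite_finite_induct) (auto intro: smooth_fun_const smooth_fun_mult)

lemma pd_affine:
  fixes f :: "real^'n::finite \<Rightarrow> real"
  assumes "smooth_fun f"
  shows "pd i (\<lambda>x. f (c + s *\<^sub>R x)) x = s * pd i f (c + s *\<^sub>R x)"
    and "(\<lambda>x. f (c + s *\<^sub>R x)) differentiable (at x)"
proof -
  have 1: "((\<lambda>x. c + s *\<^sub>R x) has_derivative (\<lambda>h. s *\<^sub>R h)) (at x)"
    by (auto intro!: derivative_eq_intros)
  have *: "((\<lambda>x. f (c + s *\<^sub>R x)) has_derivative
      (\<lambda>h. \<Sum>i\<in>UNIV. (s *\<^sub>R h) $ i * pd i f (c + s *\<^sub>R x))) (at x)"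
    by (rule has_derivative_compose[OF 1 smooth_fun_has_derivative[OF assms]])
  show "pd i (\<lambda>x. f (c + s *\<^sub>R x)) x = s * pd i f (c + s *\<^sub>R x)"
    using pd_eqI[OF *, of i] by (simp add: axis_def if_distrib if_distribR cong: if_cong)
  show "(\<lambda>x. f (c + s *\<^sub>R x)) differentiable (at x)"
    using * by (rule differentiableI)
qed

lemma smooth_fun_affine:
  fixes f :: "real^'n::finite \<Rightarrow> real"
  assumes "smooth_fun f"
  shows "smooth_fun (\<lambda>x. f (c + s *\<^sub>R x))"
proof (rule smooth_fun_pd_algebra)
  let ?B = "{\<lambda>x. g (c + s *\<^sub>R x) | g. smooth_fun g}"
  show "(\<lambda>x. f (c + s *\<^sub>R x)) \<in> pd_algebra ?B"
    using assms by (intro pd_algebra.base) auto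
  show "b differentiable (at x)" if "b \<in> ?B" for b x
    using that by (auto intro: pd_affine)
  show "pd i b \<in> pd_algebra ?B" if bB: "b \<in> ?B" for b i
  proof -
    obtain g where g: "b = (\<lambda>x. g (c + s *\<^sub>R x))" "smooth_fun g" using bB by auto
    have "pd i b = (\<lambda>x. s * pd i g (c + s *\<^sub>R x))"
      using g by (auto simp: pd_affine)
    moreover have "(\<lambda>x. pd i g (c + s *\<^sub>R x)) \<in> pd_algebra ?B"
      using smooth_fun_pd[OF g(2), of i] by (intro pd_algebra.base) auto
    ultimately show ?thesis by (simp add: pd_algebra.mult pd_algebra.const)
  qed
qed

subsection \<open>Bump functions\<close>

text \<open>The index makes the family closed under differentiation: every derivative of the
  classical flat function exp (-1/t) is a combination of the functions t^(-k) exp (-1/t).\<close>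

definition flat_exp :: "nat \<Rightarrow> real \<Rightarrow> real" where
  "flat_exp k t = (if t > 0 then inverse t ^ k * exp (- inverse t) else 0)"

lemma flat_exp_tendsto: "(flat_exp k \<longlongrightarrow> 0) (at_right 0)"
proof -
  have "((\<lambda>x::real. x ^ k / exp x) \<longlongrightarrow> 0) at_top" by (rule tendsto_power_div_exp_0)
  then have "((\<lambda>t::real. inverse t ^ k / exp (inverse t)) \<longlongrightarrow> 0) (at_right 0)"
    by (rule filterlim_compose) (rule filterlim_inverse_at_top_right)
  then show ?thesis
    by (rule Lim_transform_eventually)
      (auto simp: flat_exp_def exp_minus field_simps eventually_at_right_less intro!: eventually_at_rightI[of 0 1])
qed

lemma flat_exp_deriv:
  "(flat_exp k has_real_derivative (- real k * flat_exp (k + 1) t + flat_exp (k + 2) t)) (at t)"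
proof -
  consider "t > 0" | "t < 0" | "t = 0" by linarith
  then show ?thesis
  proof cases
    case 1
    have "((\<lambda>t. inverse t ^ k * exp (- inverse t)) has_real_derivative
        (- real k * flat_exp (k + 1) t + flat_exp (k + 2) t)) (at t)"
    proof -
      have a: "((\<lambda>t. inverse t ^ k) has_real_derivative (- real k * inverse t ^ (k + 1))) (at t)"
      proof (cases k)
        case (Suc n)
        then show ?thesis
          using DERIV_power[OF DERIV_inverse[of t], of k] 1
          by (simp add: algebra_simps numeral_2_eq_2 del: inverse_eq_divide power_inverse)
      qed simp
      have b: "((\<lambda>t. exp (- inverse t)) has_real_derivative (exp (- inverse t) * inverse t ^ 2)) (at t)"
        using 1 by (auto intro!: derivative_eq_intros simp: power2_eq_square)
      show ?thesis
        using DERIV_mult[OF a b] 1 by (simp add: flat_exp_def algebra_simps power2_eq_square)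
    qed
    then show ?thesis
      by (rule DERIV_cong_ev[THEN iffD1, rotated 3])
        (use 1 in \<open>auto simp: flat_exp_def intro: eventually_mono[OF order_tendstoD(1)[OF tendsto_ident_at]]
           eventually_nhds_in_open[of "{0<..}", THEN eventually_mono]\<close>)
  next
    case 2
    have "((\<lambda>t. 0) has_real_derivative 0) (at t)" by simp
    then have "(flat_exp k has_real_derivative 0) (at t)"
      by (rule DERIV_cong_ev[THEN iffD1, rotated 3])
        (use 2 in \<open>auto simp: flat_exp_def intro!: eventually_nhds_in_open[of "{..<0}", THEN eventually_mono]\<close>)
    then show ?thesis using 2 by (simp add: flat_exp_def)
  next
    case 3
    \<comment> \<open>For h > 0 the difference quotient at 0 of member k is member k + 1, which
      tends to 0; for h < 0 it is identically 0.\<close>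
    have r: "((\<lambda>h. flat_exp k h / h) \<longlongrightarrow> 0) (at_right 0)"
      by (rule Lim_transform_eventually[OF flat_exp_tendsto[of "k+1"]])
        (auto simp: flat_exp_def divide_inverse intro!: eventually_at_rightI[of 0 1])
    have l: "((\<lambda>h. flat_exp k h / h) \<longlongrightarrow> 0) (at_left 0)"
      by (rule Lim_transform_eventually[OF tendsto_const])
        (auto simp: flat_exp_def intro!: eventually_at_leftI[of "-1" 0])
    from r l have "((\<lambda>h. flat_exp k h / h) \<longlongrightarrow> 0) (at 0)"
      by (simp add: filterlim_split_at)
    then show ?thesis using 3 by (simp add: DERIV_def flat_exp_def)
  qed
qed

lemma smooth_fun_flat_exp: "smooth_fun (\<lambda>x::real^'n::finite. flat_exp 0 (c + s * x $ i))"
proof (rule smooth_fun_pd_algebra)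
  let ?B = "{\<lambda>x::real^'n. flat_exp k (c + s * x $ i) | k. True}"
  have *: "((\<lambda>x::real^'n. flat_exp k (c + s * x $ i)) has_derivative
     (\<lambda>h. (s * h $ i) * (- real k * flat_exp (k + 1) (c + s * x $ i) + flat_exp (k + 2) (c + s * x $ i)))) (at x)"
    for k x
  proof -
    have "((\<lambda>x::real^'n. c + s * x $ i) has_derivative (\<lambda>h. s * h $ i)) (at x)"
      by (auto intro!: derivative_eq_intros bounded_linear_imp_has_derivative bounded_linear_vec_nth)
    from has_derivative_compose[OF this flat_exp_deriv[THEN has_field_derivative_imp_has_derivative]]
    show ?thesis by (simp add: mult.commute)
  qed
  show "(\<lambda>x::real^'n. flat_exp 0 (c + s * x $ i)) \<in> pd_algebra ?B"
    by (intro pd_algebra.base) auto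
  show "b differentiable (at x)" if "b \<in> ?B" for b x
    using that * by (auto intro: differentiableI)
  show "pd j b \<in> pd_algebra ?B" if bB: "b \<in> ?B" for b j
  proof -
    obtain k where b: "b = (\<lambda>x. flat_exp k (c + s * x $ i))" using bB by auto
    have "pd j b = (\<lambda>x. (s * axis j 1 $ i) * (- real k * flat_exp (k + 1) (c + s * x $ i) + flat_exp (k + 2) (c + s * x $ i)))"
      unfolding b by (rule ext, rule pd_eqI[OF *])
    moreover have "(\<lambda>x. flat_exp m (c + s * x $ i)) \<in> pd_algebra ?B" for m
      by (intro pd_algebra.base) auto
    ultimately show ?thesis
      by (simp only:) (intro pd_algebra.mult pd_algebra.add pd_algebra.const)
  qed
qed

subsection \<open>Test functions\<close>

lemma test_fun_UNIV: "test_fun \<Omega> f \<Longrightarrow> test_fun UNIV f"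
  by (simp add: test_fun_def)

lemma tsupport_outside: "x \<notin> tsupport f \<Longrightarrow> f x = 0"
  using closure_subset[of "{x. f x \<noteq> 0}"] by (auto simp: tsupport_def)

lemma pd_outside_tsupport:
  fixes f :: "real^'n::finite \<Rightarrow> real"
  assumes "x \<notin> tsupport f"
  shows "pd i f x = 0"
proof -
  have o: "open (- tsupport f)" unfolding tsupport_def by (intro open_Compl closed_closure)
  have "((\<lambda>x. 0) has_derivative (\<lambda>h. 0)) (at x)" by simp
  then have "(f has_derivative (\<lambda>h. 0)) (at x)"
    by (rule has_derivative_transform_within_open[OF _ o]) (use assms in \<open>auto simp: tsupport_outside\<close>)
  from pd_eqI[OF this] show ?thesis .
qed

lemma compact_tsupport_subset:
  assumes "compact K" "\<And>x. x \<notin> K \<Longrightarrow> f x = 0"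
  shows "compact (tsupport f)" "tsupport f \<subseteq> K"
proof -
  show *: "tsupport f \<subseteq> K"
    unfolding tsupport_def using assms by (intro closure_minimal) (auto intro: compact_imp_closed)
  have "closed (tsupport f)" by (simp add: tsupport_def)
  with assms(1) have "compact (K \<inter> tsupport f)" by (rule compact_Int_closed)
  then show "compact (tsupport f)" using * by (simp add: inf.absorb2)
qed

lemma test_funI:
  assumes "smooth_fun f" "compact K" "K \<subseteq> \<Omega>" "\<And>x. x \<notin> K \<Longrightarrow> f x = 0"
  shows "test_fun \<Omega> f"
  using assms compact_tsupport_subset[of K f] by (auto simp: test_fun_def)

lemma test_fun_pd: "test_fun \<Omega> f \<Longrightarrow> test_fun \<Omega> (pd i f)"
  by (rule test_funI[where K = "tsupport f"]) (auto simp: test_fun_def smooth_fun_pd pd_outside_tsupport)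

lemma test_fun_mult_smooth: "test_fun \<Omega> f \<Longrightarrow> smooth_fun g \<Longrightarrow> test_fun \<Omega> (\<lambda>x. f x * g x)"
  by (rule test_funI[where K = "tsupport f"]) (auto simp: test_fun_def smooth_fun_mult tsupport_outside)

lemma test_fun_translate:
  assumes "test_fun UNIV f"
  shows "test_fun UNIV (\<lambda>x. f (c + x))"
proof (rule test_funI)
  show "smooth_fun (\<lambda>x. f (c + x))"
    using smooth_fun_affine[of f c 1] assms by (simp add: test_fun_def)
  show "compact ((\<lambda>x. - c + x) ` tsupport f)"
    using assms by (intro compact_translation) (simp add: test_fun_def)
  show "f (c + x) = 0" if "x \<notin> (\<lambda>x. - c + x) ` tsupport f" for x
  proof -
    have "c + x \<notin> tsupport f"
      using that by (auto simp: image_iff dest: bspec[of _ _ "c + x"])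
    then show ?thesis by (rule tsupport_outside)
  qed
qed auto

lemma test_fun_bounded:
  assumes "test_fun \<Omega> f"
  obtains B where "B \<ge> 0" "\<And>x. \<bar>f x\<bar> \<le> B"
proof -
  have "continuous_on (tsupport f) f" "compact (tsupport f)"
    using assms by (auto simp: test_fun_def smooth_fun_continuous)
  then obtain B where B: "B > 0" "\<And>x. x \<in> tsupport f \<Longrightarrow> norm (f x) \<le> B"
    by (metis compact_continuous_image compact_imp_bounded bounded_pos image_eqI)
  then have "\<bar>f x\<bar> \<le> B" for x
    by (cases "x \<in> tsupport f") (auto simp: tsupport_outside)
  with B that[of B] show ?thesis by auto
qed

lemma test_fun_Lipschitz:
  fixes f :: "real^'n::finite \<Rightarrow> real"
  assumes "test_fun \<Omega> f"
  obtains L where "L \<ge> 0" "\<And>x y. \<bar>f x - f y\<bar> \<le> L * norm (x - y)"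
proof -
  have "\<exists>B. \<forall>x. \<bar>pd i f x\<bar> \<le> B" for i
    using test_fun_bounded[OF test_fun_pd[OF assms, of i]] by metis
  then obtain B where B: "\<And>i x. \<bar>pd i f x\<bar> \<le> B i" by metis
  have s: "smooth_fun f" using assms by (simp add: test_fun_def)
  have "norm (f x - f y) \<le> (\<Sum>i\<in>UNIV. B i) * norm (x - y)" for x y
  proof (rule differentiable_bound[OF convex_UNIV])
    show "(f has_derivative (\<lambda>h. \<Sum>i\<in>UNIV. h $ i * pd i f x)) (at x within UNIV)" for x
      using smooth_fun_has_derivative[OF s] by simp
    show "onorm (\<lambda>h. \<Sum>i\<in>UNIV. h $ i * pd i f x) \<le> (\<Sum>i\<in>UNIV. B i)" for x
    proof (rule onorm_le)
      fix h :: "real^'n"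
      have "norm (\<Sum>i\<in>UNIV. h $ i * pd i f x) \<le> (\<Sum>i\<in>UNIV. norm h * B i)"
        by (rule sum_norm_le)
          (auto simp: abs_mult intro!: mult_mono B component_le_norm_cart)
      then show "norm (\<Sum>i\<in>UNIV. h $ i * pd i f x) \<le> (\<Sum>i\<in>UNIV. B i) * norm h"
        by (simp add: sum_distrib_left mult.commute)
    qed
  qed auto
  moreover have "0 \<le> (\<Sum>i\<in>UNIV. B i)"
    by (intro sum_nonneg) (meson B abs_ge_zero order_trans)
  ultimately show ?thesis using that by auto
qed

text \<open>The partial derivatives are test functions again, hence Lipschitz. The bound is uniform
  in \<open>x\<close>, so the remainder can be integrated against any integrable function; this
  replaces every differentiation under the integral sign.\<close>

lemma test_fun_Taylor:
  fixes f :: "real^'n::finite \<Rightarrow> real"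
  assumes "test_fun \<Omega> f"
  obtains C where "C \<ge> 0"
    "\<And>x h. \<bar>f (x + h) - f x - (\<Sum>i\<in>UNIV. h $ i * pd i f x)\<bar> \<le> C * (norm h)\<^sup>2"
proof -
  have "\<exists>L\<ge>0. \<forall>x y. \<bar>pd i f x - pd i f y\<bar> \<le> L * norm (x - y)" for i
    using test_fun_Lipschitz[OF test_fun_pd[OF assms, of i]] by metis
  then obtain L where L: "\<And>i. L i \<ge> 0" "\<And>i x y. \<bar>pd i f x - pd i f y\<bar> \<le> L i * norm (x - y)"
    by metis
  let ?C = "\<Sum>i\<in>UNIV. L i"
  have s: "smooth_fun f" using assms by (simp add: test_fun_def)
  have "\<bar>f (x + h) - f x - (\<Sum>i\<in>UNIV. h $ i * pd i f x)\<bar> \<le> ?C * (norm h)\<^sup>2" for x h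
  proof -
    have "norm (f (x + h) - f x - (\<Sum>i\<in>UNIV. ((x + h) - x) $ i * pd i f x))
       \<le> norm ((x + h) - x) * (?C * norm h)"
    proof (rule differentiable_bound_linearization[where S = "cball x (norm h)"
          and f' = "\<lambda>x h. \<Sum>i\<in>UNIV. h $ i * pd i f x"])
      show "x + t *\<^sub>R (x + h - x) \<in> cball x (norm h)" if "t \<in> {0..1}" for t
        using that by (auto simp: dist_norm intro!: mult_left_le_one_le)
      show "(f has_derivative (\<lambda>h. \<Sum>i\<in>UNIV. h $ i * pd i f z)) (at z within cball x (norm h))" for z
        by (rule has_derivative_at_withinI[OF smooth_fun_has_derivative[OF s]])
      show "onorm ((\<lambda>h. \<Sum>i\<in>UNIV. h $ i * pd i f z) - (\<lambda>h. \<Sum>i\<in>UNIV. h $ i * pd i f x))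
          \<le> ?C * norm h" if z: "z \<in> cball x (norm h)" for z
      proof (rule onorm_le)
        fix k :: "real^'n"
        have "norm (\<Sum>i\<in>UNIV. k $ i * (pd i f z - pd i f x)) \<le> (\<Sum>i\<in>UNIV. norm k * (L i * norm h))"
        proof (rule sum_norm_le)
          fix i
          have "\<bar>pd i f z - pd i f x\<bar> \<le> L i * norm (z - x)" by (rule L)
          also have "\<dots> \<le> L i * norm h"
            using z L(1) by (intro mult_left_mono) (auto simp: dist_norm norm_minus_commute)
          finally show "norm (k $ i * (pd i f z - pd i f x)) \<le> norm k * (L i * norm h)"
            by (auto simp: abs_mult intro!: mult_mono component_le_norm_cart)
        qed
        then show "norm (((\<lambda>h. \<Sum>i\<in>UNIV. h $ i * pd i f z) - (\<lambda>h. \<Sum>i\<in>UNIV. h $ i * pd i f x)) k)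
             \<le> ?C * norm h * norm k"
          by (simp add: sum_subtractf[symmetric] right_diff_distrib sum_distrib_left sum_distrib_right mult_ac)
      qed
    qed auto
    then show ?thesis by (simp add: power2_eq_square mult_ac)
  qed
  moreover have "0 \<le> ?C" by (intro sum_nonneg L)
  ultimately show ?thesis using that by blast
qed

lemma test_fun_integrable:
  assumes "test_fun \<Omega> f"
  shows "integrable lborel f"
proof -
  have "continuous_on (tsupport f) f" "compact (tsupport f)"
    using assms by (auto simp: test_fun_def smooth_fun_continuous)
  then have "integrable lborel (\<lambda>x. indicator (tsupport f) x *\<^sub>R f x)"
    by (intro borel_integrable_compact)
  also have "(\<lambda>x. indicator (tsupport f) x *\<^sub>R f x) = f"
    by (rule ext) (auto simp: indicator_def tsupport_outside)
  finally show ?thesis .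
qed

section \<open>Invariance of Lebesgue measure under translation and reflection; normalized
  bumps\<close>

lemma lborel_reflect_translate:
  fixes x :: "'a::euclidean_space"
  shows "distr lborel borel (\<lambda>y. x - y) = lborel"
  using lborel_affine[of "-1" x] by (simp add: density_1)

lemma lborel_translate:
  fixes x :: "'a::euclidean_space"
  shows "distr lborel borel (\<lambda>y. x + y) = lborel"
  using lborel_affine[of "1" x] by (simp add: density_1)

lemma lborel_integral_reflect:
  fixes f :: "'a::euclidean_space \<Rightarrow> real"
  assumes [measurable]: "f \<in> borel_measurable borel"
  shows "(LINT y|lborel. f (x - y)) = (LINT y|lborel. f y)"
    and "integrable lborel (\<lambda>y. f (x - y)) \<longleftrightarrow> integrable lborel f"
  using integral_distr[of "\<lambda>y. x - y" lborel borel f] integrable_distr_eq[of "\<lambda>y. x - y" lborel borel f]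
  by (simp_all add: lborel_reflect_translate)

lemma lborel_integral_translate:
  fixes f :: "'a::euclidean_space \<Rightarrow> real"
  assumes [measurable]: "f \<in> borel_measurable borel"
  shows "(LINT y|lborel. f (x + y)) = (LINT y|lborel. f y)"
    and "integrable lborel (\<lambda>y. f (x + y)) \<longleftrightarrow> integrable lborel f"
  using integral_distr[of "\<lambda>y. x + y" lborel borel f] integrable_distr_eq[of "\<lambda>y. x + y" lborel borel f]
  by (simp_all add: lborel_translate)

lemma lborel_nn_integral_translate:
  fixes x :: "'a::euclidean_space"
  assumes [measurable]: "f \<in> borel_measurable borel"
  shows "(\<integral>\<^sup>+y. f (x + y) \<partial>lborel) = (\<integral>\<^sup>+y. f y \<partial>lborel)"
  using nn_integral_distr[of "\<lambda>y. x + y" lborel borel f] by (simp add: lborel_translate)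

lemma bump_exists:
  assumes "\<epsilon> > 0"
  obtains \<rho> :: "real^'n::finite \<Rightarrow> real" where
    "test_fun UNIV \<rho>" "\<And>x. \<rho> x \<ge> 0" "\<And>x. norm x \<ge> \<epsilon> \<Longrightarrow> \<rho> x = 0" "(LINT x|lborel. \<rho> x) = 1"
proof -
  \<comment> \<open>Each coordinate will be confined to (-d, d); the l1 norm, and with it the
    Euclidean norm, then stays below \<epsilon>.\<close>
  define d where "d = \<epsilon> / real CARD('n)"
  have d: "d > 0" "real CARD('n) * d = \<epsilon>" using assms by (auto simp: d_def)
  define b :: "real^'n \<Rightarrow> real" where
    "b x = (\<Prod>i\<in>UNIV. flat_exp 0 (d + (-1) * x $ i) * flat_exp 0 (d + 1 * x $ i))" for x
  have sb: "smooth_fun b"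
    unfolding b_def by (intro smooth_fun_prod smooth_fun_mult smooth_fun_flat_exp)
  have nn: "b x \<ge> 0" for x
    unfolding b_def by (intro prod_nonneg) (auto simp: flat_exp_def)
  have out: "b x = 0" if "norm x \<ge> \<epsilon>" for x
  proof (rule ccontr)
    assume nz: "b x \<noteq> 0"
    have lt: "\<bar>x $ i\<bar> < d" for i
    proof -
      have "flat_exp 0 (d + (-1) * x $ i) * flat_exp 0 (d + 1 * x $ i) \<noteq> 0"
        using nz unfolding b_def by auto
      then show ?thesis by (auto simp: flat_exp_def split: if_splits)
    qed
    have "norm x \<le> (\<Sum>i\<in>UNIV. \<bar>x $ i\<bar>)" by (rule norm_le_l1_cart)
    also have "\<dots> < (\<Sum>i\<in>(UNIV::'n set). d)" by (rule sum_strict_mono) (auto intro: lt)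
    finally show False using that d by simp
  qed
  have tb: "test_fun UNIV b"
    by (rule test_funI[OF sb compact_cball[of 0 \<epsilon>]]) (auto intro: out)
  note int = test_fun_integrable[OF tb]
  \<comment> \<open>A vanishing integral would give the closed set of zeros of \<open>b\<close> full
    measure, so it would be the whole space, although \<open>b\<close> is positive at the
    origin.\<close>
  have pos: "(LINT x|lborel. b x) > 0"
  proof (rule ccontr)
    assume "\<not> (LINT x|lborel. b x) > 0"
    moreover have "(LINT x|lborel. b x) \<ge> 0" by (simp add: nn)
    ultimately have "(LINT x|lborel. b x) = 0" by linarith
    then have "AE x in lborel. b x = 0"
      using integral_nonneg_eq_0_iff_AE[OF int] nn by simp
    then have "AE x in lebesgue. x \<in> {x. b x = 0}" by (simp add: AE_completion)
    moreover have "closed {x. b x = 0}"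
      using sb by (intro closed_Collect_eq smooth_fun_continuous continuous_on_const) auto
    ultimately have "0 \<in> {x. b x = 0}" by (rule mem_closed_if_AE_lebesgue[rotated])
    then show False
      using d by (auto simp: b_def flat_exp_def)
  qed
  show ?thesis
  proof
    let ?r = "\<lambda>x. b x * (1 / (LINT x|lborel. b x))"
    show "test_fun UNIV ?r"
      by (intro test_fun_mult_smooth tb smooth_fun_const)
    show "?r x \<ge> 0" for x using nn pos by (auto intro: mult_nonneg_nonneg)
    show "?r x = 0" if "norm x \<ge> \<epsilon>" for x using out[OF that] by simp
    show "(LINT x|lborel. ?r x) = 1" using pos by simp
  qed
qed

subsection \<open>Convolution\<close>

definition conv :: "(real^'n::finite \<Rightarrow> real) \<Rightarrow> (real^'n \<Rightarrow> real) \<Rightarrow> real^'n \<Rightarrow> real" where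
  "conv \<rho> f x = (LINT y|lborel. \<rho> (x - y) * f y)"

lemma conv_integrable:
  assumes "test_fun UNIV \<rho>" "integrable lborel f"
  shows "integrable lborel (\<lambda>y. \<rho> (x - y) * f y)"
proof -
  obtain B where B: "\<And>x. \<bar>\<rho> x\<bar> \<le> B" using test_fun_bounded[OF assms(1)] by metis
  have [measurable]: "\<rho> \<in> borel_measurable borel" "f \<in> borel_measurable borel"
    using assms smooth_fun_borel[of \<rho>] borel_measurable_integrable[of lborel f]
    by (auto simp: test_fun_def)
  show ?thesis
  proof (rule Bochner_Integration.integrable_bound)
    show "integrable lborel (\<lambda>y. B * \<bar>f y\<bar>)" using assms(2) by simp
    show "AE y in lborel. norm (\<rho> (x - y) * f y) \<le> norm (B * \<bar>f y\<bar>)"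
      using B by (intro AE_I2) (auto simp: abs_mult intro!: mult_right_mono intro: order_trans[OF _ abs_ge_self])
  qed measurable
qed

text \<open>The uniform Taylor remainder of \<rho> is quadratic in the increment, and integrating it
  against \<open>f\<close> keeps it quadratic, with constant \<open>K\<close>.\<close>

lemma conv_has_derivative:
  fixes \<rho> f :: "real^'n::finite \<Rightarrow> real"
  assumes r: "test_fun UNIV \<rho>" and f: "integrable lborel f"
  shows "(conv \<rho> f has_derivative (\<lambda>h. \<Sum>i\<in>UNIV. h $ i * conv (pd i \<rho>) f x)) (at x)"
proof -
  obtain C where C: "C \<ge> 0"
    "\<And>x h. \<bar>\<rho> (x + h) - \<rho> x - (\<Sum>i\<in>UNIV. h $ i * pd i \<rho> x)\<bar> \<le> C * (norm h)\<^sup>2"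
    by (rule test_fun_Taylor[OF r]) (rule that)
  define K where "K = C * (LINT y|lborel. \<bar>f y\<bar>)"
  have est: "\<bar>conv \<rho> f (x + h) - conv \<rho> f x - (\<Sum>i\<in>UNIV. h $ i * conv (pd i \<rho>) f x)\<bar> \<le> K * (norm h)\<^sup>2" for h
  proof -
    note I = conv_integrable[OF r f] conv_integrable[OF test_fun_pd[OF r] f]
    have "conv \<rho> f (x + h) - conv \<rho> f x - (\<Sum>i\<in>UNIV. h $ i * conv (pd i \<rho>) f x)
      = (LINT y|lborel. (\<rho> (x + h - y) * f y - \<rho> (x - y) * f y) - (\<Sum>i\<in>UNIV. h $ i * (pd i \<rho> (x - y) * f y)))"
      unfolding conv_def using I by simp
    also have "\<bar>\<dots>\<bar> \<le> (LINT y|lborel. (C * (norm h)\<^sup>2) * \<bar>f y\<bar>)"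
    proof (rule integral_abs_bound_integral)
      show "integrable lborel (\<lambda>y. (\<rho> (x + h - y) * f y - \<rho> (x - y) * f y) - (\<Sum>i\<in>UNIV. h $ i * (pd i \<rho> (x - y) * f y)))"
        using I by auto
      show "integrable lborel (\<lambda>y. (C * (norm h)\<^sup>2) * \<bar>f y\<bar>)" using f by auto
      fix y
      have "\<rho> (x + h - y) * f y - \<rho> (x - y) * f y - (\<Sum>i\<in>UNIV. h $ i * (pd i \<rho> (x - y) * f y))
        = (\<rho> ((x - y) + h) - \<rho> (x - y) - (\<Sum>i\<in>UNIV. h $ i * pd i \<rho> (x - y))) * f y"
        by (simp add: left_diff_distrib sum_distrib_left mult_ac algebra_simps)
      then show "\<bar>\<rho> (x + h - y) * f y - \<rho> (x - y) * f y - (\<Sum>i\<in>UNIV. h $ i * (pd i \<rho> (x - y) * f y))\<bar>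
          \<le> (C * (norm h)\<^sup>2) * \<bar>f y\<bar>"
        using C(2)[of "x - y" h] by (simp add: abs_mult mult_right_mono)
    qed
    also have "\<dots> = K * (norm h)\<^sup>2" by (simp add: K_def)
    finally show ?thesis .
  qed
  show ?thesis
  proof (rule has_derivativeI)
    show "bounded_linear (\<lambda>h. \<Sum>i\<in>UNIV. h $ i * conv (pd i \<rho>) f x)"
      by (intro bounded_linear_sum bounded_linear_mult_const bounded_linear_vec_nth)
    show "((\<lambda>y. (conv \<rho> f y - conv \<rho> f x - (\<Sum>i\<in>UNIV. (y - x) $ i * conv (pd i \<rho>) f x)) /\<^sub>R norm (y - x)) \<longlongrightarrow> 0) (at x)"
    proof (rule Lim_null_comparison)
      have "((\<lambda>y. K * norm (y - x)) \<longlongrightarrow> K * norm (x - x)) (at x)"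
        by (intro tendsto_intros)
      then show "((\<lambda>y. K * norm (y - x)) \<longlongrightarrow> 0) (at x)" by simp
      show "\<forall>\<^sub>F y in at x. norm ((conv \<rho> f y - conv \<rho> f x - (\<Sum>i\<in>UNIV. (y - x) $ i * conv (pd i \<rho>) f x)) /\<^sub>R norm (y - x)) \<le> K * norm (y - x)"
      proof (rule eventually_at_filter[THEN iffD2], rule always_eventually, intro allI impI)
        fix y assume "y \<noteq> x"
        then show "norm ((conv \<rho> f y - conv \<rho> f x - (\<Sum>i\<in>UNIV. (y - x) $ i * conv (pd i \<rho>) f x)) /\<^sub>R norm (y - x)) \<le> K * norm (y - x)"
          using est[of "y - x"] by (simp add: divide_simps power2_eq_square mult_ac)
      qed
    qed
  qed
qed

lemma pd_conv:
  assumes "test_fun UNIV \<rho>" "integrable lborel f"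
  shows "pd i (conv \<rho> f) = conv (pd i \<rho>) f"
  by (rule ext, rule trans[OF pd_eqI[OF conv_has_derivative[OF assms]]])
    (simp add: axis_def if_distrib if_distribR cong: if_cong)

text \<open>With \<open>f\<close> fixed, the class of all \<open>conv \<rho> f\<close> is closed
  under partial derivatives, since each of them falls on the test function.\<close>

lemma smooth_fun_conv:
  assumes "test_fun UNIV \<rho>" "integrable lborel f"
  shows "smooth_fun (conv \<rho> f)"
proof (rule smooth_fun_coinduct)
  let ?X = "{conv \<rho> f | \<rho>. test_fun UNIV \<rho>}"
  show "conv \<rho> f \<in> ?X" using assms by auto
  show "g differentiable (at x)" if "g \<in> ?X" for g x
    using that conv_has_derivative[OF _ assms(2)] by (auto intro: differentiableI)
  show "pd i g \<in> ?X" if "g \<in> ?X" for g i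
    using that by (auto simp: pd_conv[OF _ assms(2)] dest: test_fun_pd)
qed

subsection \<open>Continuity of translations in the mean\<close>

lemma numeral_mult_ennreal: "0 \<le> x \<Longrightarrow> numeral k * ennreal x = ennreal (numeral k * x)"
  by (simp add: ennreal_mult')

lemma nn_integral_square_add_le:
  fixes f g :: "'a \<Rightarrow> real"
  assumes [measurable]: "f \<in> borel_measurable M" "g \<in> borel_measurable M"
  shows "(\<integral>\<^sup>+x. ennreal ((f x + g x)\<^sup>2) \<partial>M)
    \<le> 2 * (\<integral>\<^sup>+x. ennreal ((f x)\<^sup>2) \<partial>M) + 2 * (\<integral>\<^sup>+x. ennreal ((g x)\<^sup>2) \<partial>M)"
proof -
  have "(\<integral>\<^sup>+x. ennreal ((f x + g x)\<^sup>2) \<partial>M) \<le> (\<integral>\<^sup>+x. 2 * ennreal ((f x)\<^sup>2) + 2 * ennreal ((g x)\<^sup>2) \<partial>M)"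
  proof (rule nn_integral_mono)
    fix x
    have "(f x + g x)\<^sup>2 \<le> 2 * (f x)\<^sup>2 + 2 * (g x)\<^sup>2"
      using zero_le_power2[of "f x - g x"] by (simp add: power2_eq_square algebra_simps)
    then have "ennreal ((f x + g x)\<^sup>2) \<le> ennreal (2 * (f x)\<^sup>2 + 2 * (g x)\<^sup>2)"
      by (rule ennreal_leI)
    then show "ennreal ((f x + g x)\<^sup>2) \<le> 2 * ennreal ((f x)\<^sup>2) + 2 * ennreal ((g x)\<^sup>2)"
      by (simp add: ennreal_mult')
  qed
  also have "\<dots> = 2 * (\<integral>\<^sup>+x. ennreal ((f x)\<^sup>2) \<partial>M) + 2 * (\<integral>\<^sup>+x. ennreal ((g x)\<^sup>2) \<partial>M)"
    by (simp add: nn_integral_add nn_integral_cmult)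
  finally show ?thesis .
qed

text \<open>Nonnegative integrals are used so that the error can be estimated before the difference
  is known to be integrable.\<close>

definition L2_transl_cont :: "('a::euclidean_space \<Rightarrow> real) \<Rightarrow> bool" where
  "L2_transl_cont f \<longleftrightarrow> (\<forall>e>0. \<exists>d>0. \<forall>h. norm h < d \<longrightarrow>
     (\<integral>\<^sup>+x. ennreal ((f (h + x) - f x)\<^sup>2) \<partial>lborel) \<le> ennreal e)"

lemma L2_transl_contD:
  assumes "L2_transl_cont f" "e > 0"
  obtains d where "d > 0"
    "\<And>h. norm h < d \<Longrightarrow> (\<integral>\<^sup>+x. ennreal ((f (h + x) - f x)\<^sup>2) \<partial>lborel) \<le> ennreal e"
  using assms unfolding L2_transl_cont_def by metis

lemma L2_transl_cont_add:
  assumes [measurable]: "f \<in> borel_measurable borel" "g \<in> borel_measurable borel"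
    and f: "L2_transl_cont f" and g: "L2_transl_cont g"
  shows "L2_transl_cont (\<lambda>x. f x + g x)"
  unfolding L2_transl_cont_def
proof (intro allI impI)
  fix e :: real assume e: "e > 0"
  obtain d1 where d1: "d1 > 0"
    "\<And>h. norm h < d1 \<Longrightarrow> (\<integral>\<^sup>+x. ennreal ((f (h + x) - f x)\<^sup>2) \<partial>lborel) \<le> ennreal (e / 4)"
    using L2_transl_contD[OF f, of "e / 4"] e by auto
  obtain d2 where d2: "d2 > 0"
    "\<And>h. norm h < d2 \<Longrightarrow> (\<integral>\<^sup>+x. ennreal ((g (h + x) - g x)\<^sup>2) \<partial>lborel) \<le> ennreal (e / 4)"
    using L2_transl_contD[OF g, of "e / 4"] e by auto
  have "(\<integral>\<^sup>+x. ennreal ((f (h + x) + g (h + x) - (f x + g x))\<^sup>2) \<partial>lborel) \<le> ennreal e"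
    if h: "norm h < min d1 d2" for h
  proof -
    have "(\<integral>\<^sup>+x. ennreal ((f (h + x) + g (h + x) - (f x + g x))\<^sup>2) \<partial>lborel)
      = (\<integral>\<^sup>+x. ennreal (((f (h + x) - f x) + (g (h + x) - g x))\<^sup>2) \<partial>lborel)"
      by (simp add: algebra_simps)
    also have "\<dots> \<le> 2 * (\<integral>\<^sup>+x. ennreal ((f (h + x) - f x)\<^sup>2) \<partial>lborel) + 2 * (\<integral>\<^sup>+x. ennreal ((g (h + x) - g x)\<^sup>2) \<partial>lborel)"
      by (rule nn_integral_square_add_le) measurable
    also have "\<dots> \<le> 2 * ennreal (e / 4) + 2 * ennreal (e / 4)"
      using h by (intro add_mono mult_left_mono d1(2) d2(2)) auto
    also have "\<dots> = ennreal (2 * (e / 4) + 2 * (e / 4))"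
      using e by (simp add: numeral_mult_ennreal flip: ennreal_plus)
    also have "\<dots> = ennreal e" by simp
    finally show ?thesis .
  qed
  then show "\<exists>d>0. \<forall>h. norm h < d \<longrightarrow>
      (\<integral>\<^sup>+x. ennreal ((f (h + x) + g (h + x) - (f x + g x))\<^sup>2) \<partial>lborel) \<le> ennreal e"
    using d1(1) d2(1) by (intro exI[of _ "min d1 d2"]) auto
qed

lemma L2_transl_cont_const: "L2_transl_cont (\<lambda>x. c)"
  by (auto simp: L2_transl_cont_def intro: exI[of _ 1])

lemma L2_transl_cont_sum:
  fixes f :: "'k \<Rightarrow> 'a::euclidean_space \<Rightarrow> real"
  assumes "\<And>k. k \<in> K \<Longrightarrow> f k \<in> borel_measurable borel" "\<And>k. k \<in> K \<Longrightarrow> L2_transl_cont (f k)"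
  shows "L2_transl_cont (\<lambda>x. \<Sum>k\<in>K. f k x)"
  using assms
proof (induction K rule: infinite_finite_induct)
  case (insert k K)
  then show ?case by (simp, intro L2_transl_cont_add borel_measurable_sum) auto
qed (auto intro: L2_transl_cont_const)

text \<open>Inner and outer regularity squeeze \<open>A\<close> between a compact \<open>K\<close>
  and an open \<open>U\<close> with \<open>U - K\<close> of small measure. A sufficiently short
  shift cannot move a point of \<open>K\<close> out of \<open>U\<close>, so the indicator changes
  only where \<open>x\<close> or \<open>h + x\<close> lies in \<open>U - K\<close>.\<close>

lemma L2_transl_cont_indicator:
  fixes A :: "'a::euclidean_space set" and c :: real
  assumes A: "A \<in> sets borel" and b: "bounded A"
  shows "L2_transl_cont (\<lambda>x. indicator A x * c)"
  unfolding L2_transl_cont_def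
proof (intro allI impI)
  fix e :: real assume e: "e > 0"
  \<comment> \<open>\<open>U - K\<close> has measure at most 2 e' and is counted twice, each time
    with weight \<open>c\<^sup>2\<close>. The added 1 keeps the quotient meaningful for c =
    0.\<close>
  define e' where "e' = e / (4 * (c\<^sup>2 + 1))"
  have e': "e' > 0" using e by (simp add: e'_def add_nonneg_pos)
  have AL: "A \<in> sets lebesgue" using A by simp
  obtain U where U: "open U" "A \<subseteq> U" "emeasure lebesgue (U - A) < ennreal e'"
    using sets_lebesgue_outer_open[OF AL e'] by metis
  obtain K where K: "closed K" "K \<subseteq> A" "emeasure lebesgue (A - K) < ennreal e'"
    using sets_lebesgue_inner_closed[OF AL e'] by metis
  have "compact K" using K b bounded_subset compact_eq_bounded_closed by blast
  then obtain d where d: "d > 0" "(\<Union>x\<in>K. ball x d) \<subseteq> U"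
    using compact_subset_open_imp_ball_epsilon_subset[of K U] U K by (metis subset_trans)
  have [measurable]: "U \<in> sets borel" "K \<in> sets borel" "A \<in> sets borel"
    using U K A by auto
  have mUK: "emeasure lborel (U - K) \<le> ennreal (2 * e')"
  proof -
    have "emeasure lborel (U - K) \<le> emeasure lborel ((U - A) \<union> (A - K))"
      by (intro emeasure_mono) auto
    also have "\<dots> \<le> emeasure lborel (U - A) + emeasure lborel (A - K)"
      by (intro emeasure_subadditive) auto
    also have "\<dots> \<le> ennreal e' + ennreal e'"
      using U(3) K(3) by (intro add_mono) (auto simp: emeasure_completion)
    also have "\<dots> = ennreal (2 * e')" using e' by (simp flip: ennreal_plus)
    finally show ?thesis .
  qed
  have "(\<integral>\<^sup>+x. ennreal ((indicator A (h + x) * c - indicator A x * c)\<^sup>2) \<partial>lborel) \<le> ennreal e"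
    if h: "norm h < d" for h
  proof -
    have "(\<integral>\<^sup>+x. ennreal ((indicator A (h + x) * c - indicator A x * c)\<^sup>2) \<partial>lborel)
      \<le> (\<integral>\<^sup>+x. ennreal (c\<^sup>2) * indicator (U - K) x + ennreal (c\<^sup>2) * indicator (U - K) (h + x) \<partial>lborel)"
    proof (rule nn_integral_mono)
      fix x
      have 1: "h + x \<in> U" if "x \<in> K"
      proof -
        have "h + x \<in> ball x d" using h by (simp add: dist_norm)
        then show ?thesis using d(2) that by blast
      qed
      have 2: "x \<in> U" if "h + x \<in> K"
      proof -
        have "x \<in> ball (h + x) d" using h by (simp add: dist_norm)
        then show ?thesis using d(2) that by blast
      qed
      show "ennreal ((indicator A (h + x) * c - indicator A x * c)\<^sup>2)
         \<le> ennreal (c\<^sup>2) * indicator (U - K) x + ennreal (c\<^sup>2) * indicator (U - K) (h + x)"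
        using 1 2 U(2) K(2) by (auto simp: indicator_def split: if_splits)
    qed
    also have "\<dots> = ennreal (c\<^sup>2) * emeasure lborel (U - K) + ennreal (c\<^sup>2) * (\<integral>\<^sup>+x. indicator (U - K) (h + x) \<partial>lborel)"
      by (simp add: nn_integral_add nn_integral_cmult)
    also have "(\<integral>\<^sup>+x. indicator (U - K) (h + x) \<partial>lborel) = emeasure lborel (U - K)"
      by (subst lborel_nn_integral_translate) auto
    also have "ennreal (c\<^sup>2) * emeasure lborel (U - K) + ennreal (c\<^sup>2) * emeasure lborel (U - K)
      \<le> ennreal (c\<^sup>2) * ennreal (2 * e') + ennreal (c\<^sup>2) * ennreal (2 * e')"
      by (intro add_mono mult_left_mono mUK) auto
    also have "\<dots> = ennreal (c\<^sup>2 * (2 * e') + c\<^sup>2 * (2 * e'))"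
      using e' by (simp flip: ennreal_mult' ennreal_plus)
    also have "\<dots> \<le> ennreal e"
    proof (rule ennreal_leI)
      have "c\<^sup>2 * (2 * e') + c\<^sup>2 * (2 * e') \<le> 4 * (c\<^sup>2 + 1) * e'" using e' by (simp add: algebra_simps)
      also have "\<dots> = e"
        unfolding e'_def by (simp add: add_nonneg_eq_0_iff)
      finally show "c\<^sup>2 * (2 * e') + c\<^sup>2 * (2 * e') \<le> e" .
    qed
    finally show ?thesis .
  qed
  then show "\<exists>d>0. \<forall>h. norm h < d \<longrightarrow>
      (\<integral>\<^sup>+x. ennreal ((indicator A (h + x) * c - indicator A x * c)\<^sup>2) \<partial>lborel) \<le> ennreal e"
    using d(1) by blast
qed

text \<open>The difference is split in three through one approximant, and the shifted error equals
  the unshifted one by translation invariance. The factor 2 lost in each of the two squared triangle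
  inequalities gives 10/16 of \<open>e\<close> in total.\<close>

lemma L2_transl_cont_limit:
  fixes f :: "'a::euclidean_space \<Rightarrow> real"
  assumes f[measurable]: "f \<in> borel_measurable borel"
    and s[measurable]: "\<And>i::nat. s i \<in> borel_measurable borel" and t: "\<And>i. L2_transl_cont (s i)"
    and lim: "(\<lambda>i. \<integral>\<^sup>+x. ennreal ((s i x - f x)\<^sup>2) \<partial>lborel) \<longlonglongrightarrow> 0"
  shows "L2_transl_cont f"
  unfolding L2_transl_cont_def
proof (intro allI impI)
  fix e :: real assume e: "e > 0"
  have "\<forall>\<^sub>F i in sequentially. (\<integral>\<^sup>+x. ennreal ((s i x - f x)\<^sup>2) \<partial>lborel) < ennreal (e / 16)"
    using lim e by (intro order_tendstoD) auto
  then obtain i where i: "(\<integral>\<^sup>+x. ennreal ((s i x - f x)\<^sup>2) \<partial>lborel) < ennreal (e / 16)"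
    by (auto dest: eventually_happens)
  then have i': "(\<integral>\<^sup>+x. ennreal ((f x - s i x)\<^sup>2) \<partial>lborel) < ennreal (e / 16)"
    by (simp add: power2_commute)
  obtain d where d: "d > 0"
    "\<And>h. norm h < d \<Longrightarrow> (\<integral>\<^sup>+x. ennreal ((s i (h + x) - s i x)\<^sup>2) \<partial>lborel) \<le> ennreal (e / 16)"
    using L2_transl_contD[OF t[of i], of "e / 16"] e by auto
  have "(\<integral>\<^sup>+x. ennreal ((f (h + x) - f x)\<^sup>2) \<partial>lborel) \<le> ennreal e" if h: "norm h < d" for h
  proof -
    let ?g = "\<lambda>x. (f (h + x) - s i (h + x))"
    let ?k = "\<lambda>x. (s i (h + x) - s i x) + (s i x - f x)"
    have "(\<integral>\<^sup>+x. ennreal ((f (h + x) - f x)\<^sup>2) \<partial>lborel) = (\<integral>\<^sup>+x. ennreal ((?g x + ?k x)\<^sup>2) \<partial>lborel)"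
      by simp
    also have "\<dots> \<le> 2 * (\<integral>\<^sup>+x. ennreal ((?g x)\<^sup>2) \<partial>lborel) + 2 * (\<integral>\<^sup>+x. ennreal ((?k x)\<^sup>2) \<partial>lborel)"
      by (rule nn_integral_square_add_le) measurable
    also have "(\<integral>\<^sup>+x. ennreal ((?g x)\<^sup>2) \<partial>lborel) = (\<integral>\<^sup>+x. ennreal ((f x - s i x)\<^sup>2) \<partial>lborel)"
      by (rule lborel_nn_integral_translate[of "\<lambda>x. ennreal ((f x - s i x)\<^sup>2)"]) measurable
    also have "(\<integral>\<^sup>+x. ennreal ((?k x)\<^sup>2) \<partial>lborel)
        \<le> 2 * (\<integral>\<^sup>+x. ennreal ((s i (h + x) - s i x)\<^sup>2) \<partial>lborel) + 2 * (\<integral>\<^sup>+x. ennreal ((s i x - f x)\<^sup>2) \<partial>lborel)"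
      by (rule nn_integral_square_add_le) measurable
    also have "2 * (\<integral>\<^sup>+x. ennreal ((f x - s i x)\<^sup>2) \<partial>lborel) + 2 * (2 * (\<integral>\<^sup>+x. ennreal ((s i (h + x) - s i x)\<^sup>2) \<partial>lborel) + 2 * (\<integral>\<^sup>+x. ennreal ((s i x - f x)\<^sup>2) \<partial>lborel))
      \<le> 2 * ennreal (e / 16) + 2 * (2 * ennreal (e / 16) + 2 * ennreal (e / 16))"
      using h by (intro add_mono mult_left_mono d(2) less_imp_le[OF i] less_imp_le[OF i']) auto
    also have "\<dots> = ennreal (2 * (e / 16) + 2 * (2 * (e / 16) + 2 * (e / 16)))"
      using e by (simp add: numeral_mult_ennreal flip: ennreal_plus)
    also have "\<dots> \<le> ennreal e" using e by (intro ennreal_leI) simp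
    finally show ?thesis by (simp add: add_mono mult_left_mono)
  qed
  then show "\<exists>d>0. \<forall>h. norm h < d \<longrightarrow> (\<integral>\<^sup>+x. ennreal ((f (h + x) - f x)\<^sup>2) \<partial>lborel) \<le> ennreal e"
    using d(1) by blast
qed

text \<open>Indicators give simple functions, and these approximate \<open>f\<close> in L2 by
  dominated convergence. The bound |s| \<le> 2 |f| does double duty: it supplies the dominating
  function, and it forces the nonzero level sets into the bounded set \<open>B\<close>.\<close>

lemma L2_transl_cont_L2:
  fixes f :: "'a::euclidean_space \<Rightarrow> real"
  assumes f[measurable]: "f \<in> borel_measurable borel" and i: "integrable lborel (\<lambda>x. (f x)\<^sup>2)"
    and b: "bounded B" "\<And>x. x \<notin> B \<Longrightarrow> f x = 0"
  shows "L2_transl_cont f"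
proof -
  have "f \<in> borel_measurable lborel" by simp
  from borel_measurable_implies_sequence_metric[OF this, of 0]
  obtain s where s: "\<And>i. simple_function lborel (s i)" "\<And>x. (\<lambda>i. s i x) \<longlonglongrightarrow> f x"
    "\<And>i x. \<bar>s i x\<bar> \<le> 2 * \<bar>f x\<bar>"
    by (auto simp: dist_norm)
  have sm[measurable]: "s i \<in> borel_measurable borel" for i
    using borel_measurable_simple_function[OF s(1)[of i]] by simp
  have tc: "L2_transl_cont (s i)" for i
  proof -
    have "L2_transl_cont (\<lambda>x. \<Sum>y\<in>s i ` space lborel. indicator (s i -` {y} \<inter> space lborel) x * y)"
    proof (rule L2_transl_cont_sum)
      fix y assume "y \<in> s i ` space lborel"
      have m: "s i -` {y} \<inter> space lborel \<in> sets borel"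
        using measurable_sets_borel[OF sm[of i], of "{y}"] by simp
      then show "(\<lambda>x. indicator (s i -` {y} \<inter> space lborel) x * y) \<in> borel_measurable borel"
        by measurable
      show "L2_transl_cont (\<lambda>x. indicator (s i -` {y} \<inter> space lborel) x * y)"
      proof (cases "y = 0")
        case True
        then show ?thesis by (simp add: L2_transl_cont_const)
      next
        case False
        have "s i -` {y} \<inter> space lborel \<subseteq> B"
        proof
          fix x assume "x \<in> s i -` {y} \<inter> space lborel"
          then have "f x \<noteq> 0" using False s(3)[of i x] by auto
          then show "x \<in> B" using b by blast
        qed
        then show ?thesis using m b(1) by (intro L2_transl_cont_indicator) (auto intro: bounded_subset)
      qed
    qed
    moreover have "s i x = (\<Sum>y\<in>s i ` space lborel. indicator (s i -` {y} \<inter> space lborel) x * y)" for x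
      by (rule simple_function_indicator_representation_banach[OF s(1)[of i], unfolded real_scaleR_def]) simp
    then have "(\<lambda>x. \<Sum>y\<in>s i ` space lborel. indicator (s i -` {y} \<inter> space lborel) x * y) = s i"
      by (intro ext) (rule sym)
    ultimately show ?thesis by (rule back_subst[where P = L2_transl_cont])
  qed
  have "(\<lambda>i. \<integral>\<^sup>+x. ennreal ((s i x - f x)\<^sup>2) \<partial>lborel) \<longlonglongrightarrow> (\<integral>\<^sup>+x. 0 \<partial>(lborel::'a measure))"
  proof (rule nn_integral_dominated_convergence[where w = "\<lambda>x. ennreal (9 * (f x)\<^sup>2)"])
    show "AE x in lborel. ennreal ((s j x - f x)\<^sup>2) \<le> ennreal (9 * (f x)\<^sup>2)" for j
    proof (intro AE_I2 ennreal_leI)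
      fix x
      have "\<bar>s j x - f x\<bar> \<le> 3 * \<bar>f x\<bar>" using s(3)[of j x] by linarith
      then have "\<bar>s j x - f x\<bar>\<^sup>2 \<le> (3 * \<bar>f x\<bar>)\<^sup>2" by (intro power_mono) auto
      then show "(s j x - f x)\<^sup>2 \<le> 9 * (f x)\<^sup>2" by (simp add: power_mult_distrib)
    qed
    have "integrable lborel (\<lambda>x. 9 * (f x)\<^sup>2)" using i by simp
    then show "(\<integral>\<^sup>+x. ennreal (9 * (f x)\<^sup>2) \<partial>lborel) < \<infinity>"
      by (subst nn_integral_eq_integral) auto
    show "AE x in lborel. (\<lambda>i. ennreal ((s i x - f x)\<^sup>2)) \<longlonglongrightarrow> 0"
    proof (intro AE_I2)
      fix x
      have "(\<lambda>i. ennreal ((s i x - f x)\<^sup>2)) \<longlonglongrightarrow> ennreal ((f x - f x)\<^sup>2)"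
        by (intro tendsto_ennrealI tendsto_intros s(2))
      then show "(\<lambda>i. ennreal ((s i x - f x)\<^sup>2)) \<longlonglongrightarrow> 0" by simp
    qed
  qed measurable
  then show ?thesis
    by (intro L2_transl_cont_limit[OF f sm tc]) simp
qed

subsection \<open>Mollification\<close>

lemma integrable_test_fun_mult:
  fixes g :: "real^'n::finite \<Rightarrow> real"
  assumes r: "test_fun \<Omega> \<rho>" and g: "integrable lborel g"
  shows "integrable lborel (\<lambda>y. \<rho> y * g y)"
proof -
  obtain B where B: "\<And>x. \<bar>\<rho> x\<bar> \<le> B" using test_fun_bounded[OF r] by metis
  have [measurable]: "\<rho> \<in> borel_measurable borel" "g \<in> borel_measurable borel"
    using r g smooth_fun_borel[of \<rho>] borel_measurable_integrable[of lborel g]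
    by (auto simp: test_fun_def)
  show ?thesis
  proof (rule Bochner_Integration.integrable_bound)
    show "integrable lborel (\<lambda>y. B * \<bar>g y\<bar>)" using g by simp
    show "AE y in lborel. norm (\<rho> y * g y) \<le> norm (B * \<bar>g y\<bar>)"
      using B by (intro AE_I2) (auto simp: abs_mult intro!: mult_right_mono intro: order_trans[OF _ abs_ge_self])
  qed measurable
qed

lemma conv_flip:
  assumes "test_fun UNIV \<rho>" "f \<in> borel_measurable borel"
  shows "conv \<rho> f x = (LINT y|lborel. \<rho> y * f (x - y))"
proof -
  have [measurable]: "\<rho> \<in> borel_measurable borel" "f \<in> borel_measurable borel"
    using assms smooth_fun_borel[of \<rho>] by (auto simp: test_fun_def)
  show ?thesis
    using lborel_integral_reflect(1)[of "\<lambda>y. \<rho> (x - y) * f y" x] by (simp add: conv_def)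
qed

text \<open>Jensen's inequality and Tonelli's theorem bound the mollification error by the averaged
  translation error.\<close>

lemma conv_L2_error:
  fixes f :: "real^'n::finite \<Rightarrow> real"
  assumes r: "test_fun UNIV \<rho>" "\<And>x. \<rho> x \<ge> 0" "(LINT x|lborel. \<rho> x) = 1"
    and f[measurable]: "f \<in> borel_measurable borel" and i1: "integrable lborel f"
    and i2: "integrable lborel (\<lambda>x. (f x)\<^sup>2)"
    and e: "\<And>y. \<rho> y \<noteq> 0 \<Longrightarrow> (\<integral>\<^sup>+x. ennreal ((f (- y + x) - f x)\<^sup>2) \<partial>lborel) \<le> ennreal e"
  shows "(\<integral>\<^sup>+x. ennreal ((conv \<rho> f x - f x)\<^sup>2) \<partial>lborel) \<le> ennreal e"
proof -
  have [measurable]: "\<rho> \<in> borel_measurable borel"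
    using r smooth_fun_borel[of \<rho>] by (auto simp: test_fun_def)
  note ir = test_fun_integrable[OF r(1)]
  have jensen: "ennreal ((conv \<rho> f x - f x)\<^sup>2) \<le> (\<integral>\<^sup>+y. ennreal (\<rho> y * (f (x - y) - f x)\<^sup>2) \<partial>lborel)" for x
  proof -
    have I1: "integrable lborel (\<lambda>y. \<rho> y * f (x - y))"
      by (intro integrable_test_fun_mult[OF r(1)]) (use lborel_integral_reflect(2)[OF f, of x] i1 in auto)
    have I2: "integrable lborel (\<lambda>y. \<rho> y * (f (x - y))\<^sup>2)"
      by (intro integrable_test_fun_mult[OF r(1)])
        (use lborel_integral_reflect(2)[of "\<lambda>y. (f y)\<^sup>2" x] i2 in auto)
    let ?w = "\<lambda>y. f (x - y) - f x"
    let ?c = "conv \<rho> f x - f x"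
    have J2: "integrable lborel (\<lambda>y. \<rho> y * (?w y)\<^sup>2)"
    proof -
      have "integrable lborel (\<lambda>y. \<rho> y * (f (x - y))\<^sup>2 - 2 * f x * (\<rho> y * f (x - y)) + (f x)\<^sup>2 * \<rho> y)"
        using I1 I2 ir by auto
      then show ?thesis by (simp add: power2_diff algebra_simps)
    qed
    have J1: "integrable lborel (\<lambda>y. \<rho> y * ?w y)"
      using I1 ir by (simp add: right_diff_distrib)
    have c: "(LINT y|lborel. \<rho> y * ?w y) = ?c"
      using I1 ir r(3) by (simp add: right_diff_distrib conv_flip[OF r(1) f])
    \<comment> \<open>\<open>?c\<close> is the mean of \<open>?w\<close> for the probability density
      \<rho>; nonnegativity of the variance is Jensen's inequality for the square.\<close>
    have "0 \<le> (LINT y|lborel. \<rho> y * (?w y - ?c)\<^sup>2)"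
      using r(2) by (intro integral_nonneg_AE) auto
    also have "\<dots> = (LINT y|lborel. \<rho> y * (?w y)\<^sup>2 - 2 * ?c * (\<rho> y * ?w y) + ?c\<^sup>2 * \<rho> y)"
      by (intro Bochner_Integration.integral_cong) (auto simp: power2_eq_square algebra_simps)
    also have "\<dots> = (LINT y|lborel. \<rho> y * (?w y)\<^sup>2) - 2 * ?c * ?c + ?c\<^sup>2"
      using J1 J2 ir r(3) c by simp
    finally have "0 \<le> (LINT y|lborel. \<rho> y * (?w y)\<^sup>2) - 2 * ?c * ?c + ?c\<^sup>2" .
    moreover have "c\<^sup>2 \<le> I" if "0 \<le> I - 2 * c * c + c\<^sup>2" for c I :: real
      using that by (simp add: power2_eq_square)
    ultimately have "?c\<^sup>2 \<le> (LINT y|lborel. \<rho> y * (?w y)\<^sup>2)" by blast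
    then show ?thesis
      using J2 r(2) by (subst nn_integral_eq_integral) (auto intro: ennreal_leI)
  qed
  have "(\<integral>\<^sup>+x. ennreal ((conv \<rho> f x - f x)\<^sup>2) \<partial>lborel)
      \<le> (\<integral>\<^sup>+x. (\<integral>\<^sup>+y. ennreal (\<rho> y * (f (x - y) - f x)\<^sup>2) \<partial>lborel) \<partial>lborel)"
    by (rule nn_integral_mono) (rule jensen)
  also have "\<dots> = (\<integral>\<^sup>+y. (\<integral>\<^sup>+x. ennreal (\<rho> y * (f (x - y) - f x)\<^sup>2) \<partial>lborel) \<partial>lborel)"
    by (rule lborel_pair.Fubini'[of "\<lambda>x y. ennreal (\<rho> y * (f (x - y) - f x)\<^sup>2)", symmetric]) measurable
  also have "\<dots> \<le> (\<integral>\<^sup>+y. ennreal (\<rho> y) * ennreal e \<partial>lborel)"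
  proof (rule nn_integral_mono)
    fix y
    have "(\<integral>\<^sup>+x. ennreal (\<rho> y * (f (x - y) - f x)\<^sup>2) \<partial>lborel)
       = ennreal (\<rho> y) * (\<integral>\<^sup>+x. ennreal ((f (- y + x) - f x)\<^sup>2) \<partial>lborel)"
      using r(2) by (simp add: ennreal_mult' nn_integral_cmult)
    also have "\<dots> \<le> ennreal (\<rho> y) * ennreal e"
      using e[of y] by (cases "\<rho> y = 0") (auto intro: mult_left_mono)
    finally show "(\<integral>\<^sup>+x. ennreal (\<rho> y * (f (x - y) - f x)\<^sup>2) \<partial>lborel) \<le> ennreal (\<rho> y) * ennreal e" .
  qed
  also have "\<dots> = (\<integral>\<^sup>+y. ennreal (\<rho> y) \<partial>lborel) * ennreal e"
    by (rule nn_integral_multc) measurable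
  also have "(\<integral>\<^sup>+y. ennreal (\<rho> y) \<partial>lborel) = ennreal 1"
    using ir r by (subst nn_integral_eq_integral) auto
  finally show ?thesis by simp
qed

text \<open>Fixing one kernel for each n ensures that a function and its weak derivatives are
  smoothed by the same kernel.\<close>

definition mollifier :: "nat \<Rightarrow> real^'n::finite \<Rightarrow> real" where
  "mollifier n = (SOME \<rho>. test_fun UNIV \<rho> \<and> (\<forall>x. \<rho> x \<ge> 0) \<and>
     (\<forall>x. norm x \<ge> inverse (real (Suc n)) \<longrightarrow> \<rho> x = 0) \<and> (LINT x|lborel. \<rho> x) = 1)"

lemma mollifier:
  fixes x :: "real^'n::finite"
  shows "test_fun UNIV (mollifier n :: real^'n \<Rightarrow> real)" "mollifier n x \<ge> 0"
    "norm x \<ge> inverse (real (Suc n)) \<Longrightarrow> mollifier n x = 0"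
    "(LINT x|lborel. mollifier n (x :: real^'n)) = 1"
proof -
  have "\<exists>\<rho>::real^'n \<Rightarrow> real. test_fun UNIV \<rho> \<and> (\<forall>x. \<rho> x \<ge> 0) \<and>
     (\<forall>x. norm x \<ge> inverse (real (Suc n)) \<longrightarrow> \<rho> x = 0) \<and> (LINT x|lborel. \<rho> x) = 1"
    using bump_exists[of "inverse (real (Suc n))"] by (metis inverse_positive_iff_positive of_nat_0_less_iff zero_less_Suc)
  from someI_ex[OF this, folded mollifier_def]
  show "test_fun UNIV (mollifier n :: real^'n \<Rightarrow> real)" "mollifier n x \<ge> 0"
    "norm x \<ge> inverse (real (Suc n)) \<Longrightarrow> mollifier n x = 0"
    "(LINT x|lborel. mollifier n (x :: real^'n)) = 1" by auto
qed

lemma square_integrable_bounded_support: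
  fixes f :: "'a::euclidean_space \<Rightarrow> real"
  assumes f[measurable]: "f \<in> borel_measurable borel" and i: "integrable lborel (\<lambda>x. (f x)\<^sup>2)"
    and K: "compact K" "\<And>x. x \<notin> K \<Longrightarrow> f x = 0"
  shows "integrable lborel f"
proof (rule Bochner_Integration.integrable_bound)
  have "integrable lborel (\<lambda>x. indicator K x *\<^sub>R (1::real))"
    by (rule borel_integrable_compact[OF K(1)]) simp
  then show "integrable lborel (\<lambda>x. indicator K x + (f x)\<^sup>2)" using i by simp
  have "\<bar>f x\<bar> \<le> indicator K x + (f x)\<^sup>2" for x
  proof (cases "x \<in> K")
    case True
    have "2 * \<bar>f x\<bar> \<le> 1 + (f x)\<^sup>2"
      using zero_le_power2[of "\<bar>f x\<bar> - 1"] by (simp add: power2_diff)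
    then show ?thesis using True by simp
  qed (simp add: K)
  then show "AE x in lborel. norm (f x) \<le> norm (indicator K x + (f x)\<^sup>2)"
    by (intro AE_I2) (auto intro: order_trans[OF _ abs_ge_self])
qed measurable

lemma conv_mollifier_tendsto:
  fixes f :: "real^'n::finite \<Rightarrow> real"
  assumes f[measurable]: "f \<in> borel_measurable borel" and i: "integrable lborel (\<lambda>x. (f x)\<^sup>2)"
    and K: "compact K" "\<And>x. x \<notin> K \<Longrightarrow> f x = 0"
  shows "(\<lambda>n. LINT x|lborel. (conv (mollifier n) f x - f x)\<^sup>2) \<longlonglongrightarrow> 0"
proof -
  note i1 = square_integrable_bounded_support[OF f i K]
  have tc: "L2_transl_cont f"
    by (rule L2_transl_cont_L2[OF f i compact_imp_bounded[OF K(1)] K(2)])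
  have m[measurable]: "conv (mollifier n) f \<in> borel_measurable borel" for n
    by (intro smooth_fun_borel smooth_fun_conv mollifier i1)
  show ?thesis
  proof (rule LIMSEQ_I)
    fix r :: real assume r: "r > 0"
    then obtain d where d: "d > 0"
      "\<And>h. norm h < d \<Longrightarrow> (\<integral>\<^sup>+x. ennreal ((f (h + x) - f x)\<^sup>2) \<partial>lborel) \<le> ennreal (r / 2)"
      using L2_transl_contD[OF tc, of "r / 2"] by auto
    obtain N where N: "inverse (real (Suc N)) < d" using reals_Archimedean[OF d(1)] by auto
    have "norm ((LINT x|lborel. (conv (mollifier n) f x - f x)\<^sup>2) - 0) < r" if n: "n \<ge> N" for n
    proof -
      have "inverse (real (Suc n)) \<le> inverse (real (Suc N))"
        using n by (intro le_imp_inverse_le) auto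
      then have nd: "inverse (real (Suc n)) < d" using N by linarith
      have "(\<integral>\<^sup>+x. ennreal ((conv (mollifier n) f x - f x)\<^sup>2) \<partial>lborel) \<le> ennreal (r / 2)"
      proof (rule conv_L2_error[OF mollifier(1,2,4) f i1 i])
        fix y :: "real^'n" assume "mollifier n y \<noteq> 0"
        then have "norm y < inverse (real (Suc n))" using mollifier(3) by (metis not_le)
        then show "(\<integral>\<^sup>+x. ennreal ((f (- y + x) - f x)\<^sup>2) \<partial>lborel) \<le> ennreal (r / 2)"
          using nd by (intro d(2)) simp
      qed
      then have le: "enn2real (\<integral>\<^sup>+x. ennreal ((conv (mollifier n) f x - f x)\<^sup>2) \<partial>lborel) \<le> r / 2"
        by (rule enn2real_leI[rotated]) (use r in simp)
      have "(LINT x|lborel. (conv (mollifier n) f x - f x)\<^sup>2) \<le> r / 2"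
        by (subst integral_eq_nn_integral) (use le in simp_all)
      moreover have "(LINT x|lborel. (conv (mollifier n) f x - f x)\<^sup>2) \<ge> 0" by simp
      ultimately show ?thesis using r by simp
    qed
    then show "\<exists>no. \<forall>n\<ge>no. norm ((LINT x|lborel. (conv (mollifier n) f x - f x)\<^sup>2) - 0) < r" by blast
  qed
qed

lemma conv_outside:
  assumes "\<And>x. norm x \<ge> \<epsilon> \<Longrightarrow> \<rho> x = 0" "\<And>x. x \<notin> K \<Longrightarrow> f x = 0"
    and "\<And>y. y \<in> K \<Longrightarrow> norm (x - y) \<ge> \<epsilon>"
  shows "conv \<rho> f x = 0"
proof -
  have "(\<lambda>y. \<rho> (x - y) * f y) = (\<lambda>y. 0)" using assms by (metis mult_eq_0_iff)
  then show ?thesis by (simp add: conv_def)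
qed

text \<open>The derivative falls on the kernel, and the reflected kernel centred at \<open>x\<close>
  is itself a test function for the weak derivative. In the applications \<open>f\<close> and
  \<open>g\<close> have compact support, which is why \<open>w\<close> can be asked for every smooth
  \<eta>; hence the identity holds at every \<open>x\<close>, not only well inside a domain.\<close>

lemma conv_weak_derivative:
  fixes f g :: "real^'n::finite \<Rightarrow> real"
  assumes r: "test_fun UNIV \<rho>" and f: "integrable lborel f"
    and w: "\<And>\<eta>. smooth_fun \<eta> \<Longrightarrow> (LINT x|lborel. f x * pd i \<eta> x) = - (LINT x|lborel. g x * \<eta> x)"
  shows "pd i (conv \<rho> f) = conv \<rho> g"
proof
  fix x
  have s: "smooth_fun \<rho>" using r by (simp add: test_fun_def)
  have s': "smooth_fun (\<lambda>y. \<rho> (x - y))"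
    using smooth_fun_affine[OF s, of x "-1"] by simp
  have p: "pd i (\<lambda>y. \<rho> (x - y)) y = - pd i \<rho> (x - y)" for y
    using pd_affine(1)[OF s, of i x "-1" y] by simp
  have "pd i (conv \<rho> f) x = (LINT y|lborel. pd i \<rho> (x - y) * f y)"
    by (simp add: pd_conv[OF r f] conv_def)
  also have "\<dots> = - (LINT y|lborel. f y * pd i (\<lambda>y. \<rho> (x - y)) y)"
    by (simp add: p mult.commute)
  also have "\<dots> = conv \<rho> g x"
    using w[OF s'] by (simp add: conv_def mult.commute)
  finally show "pd i (conv \<rho> f) x = conv \<rho> g x" .
qed

text \<open>A compact subset of \<Omega> keeps a positive distance from the complement, so
  mollification at small scale stays inside \<Omega>. Gradients converge because the derivative of
  the mollification is the mollification of the weak derivative.\<close>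

lemma weak_derivative_approximation:
  fixes f :: "real^'n::finite \<Rightarrow> real" and g :: "'n \<Rightarrow> real^'n \<Rightarrow> real"
  assumes \<Omega>: "open \<Omega>" "compact K" "K \<subseteq> \<Omega>"
    and f: "f \<in> borel_measurable borel" "integrable lborel (\<lambda>x. (f x)\<^sup>2)" "\<And>x. x \<notin> K \<Longrightarrow> f x = 0"
    and g: "\<And>i. g i \<in> borel_measurable borel" "\<And>i. integrable lborel (\<lambda>x. (g i x)\<^sup>2)"
      "\<And>i x. x \<notin> K \<Longrightarrow> g i x = 0"
    and w: "\<And>i \<eta>. smooth_fun \<eta> \<Longrightarrow> (LINT x|lborel. f x * pd i \<eta> x) = - (LINT x|lborel. g i x * \<eta> x)"
  obtains \<psi> :: "nat \<Rightarrow> real^'n \<Rightarrow> real" where "\<And>n. test_fun \<Omega> (\<psi> n)"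
    "(\<lambda>n. LINT x|lborel. (\<psi> n x - f x)\<^sup>2) \<longlonglongrightarrow> 0"
    "\<And>i. (\<lambda>n. LINT x|lborel. (pd i (\<psi> n) x - g i x)\<^sup>2) \<longlonglongrightarrow> 0"
proof -
  note fi = square_integrable_bounded_support[OF f(1,2) \<Omega>(2) f(3)]
  obtain d where d: "d > 0" "(\<Union>x\<in>K. ball x d) \<subseteq> \<Omega>"
    by (rule compact_subset_open_imp_ball_epsilon_subset[OF \<Omega>(2,1,3)]) (rule that)
  obtain N where N: "inverse (real (Suc N)) < d" using reals_Archimedean[OF d(1)] by auto
  \<comment> \<open>Skipping the first N mollifiers keeps the smoothed support inside \<Omega> from
    the first term on.\<close>
  define \<psi> where "\<psi> n = conv (mollifier (n + N)) f" for n
  show ?thesis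
  proof
    show "test_fun \<Omega> (\<psi> n)" for n
    proof (rule test_funI)
      let ?e = "inverse (real (Suc (n + N)))"
      have e: "?e < d"
        by (rule order.strict_trans1[OF _ N], intro le_imp_inverse_le) auto
      show "smooth_fun (\<psi> n)" unfolding \<psi>_def by (intro smooth_fun_conv mollifier fi)
      show "compact {x + y | x y. x \<in> K \<and> y \<in> cball (0 :: real^'n) ?e}"
        by (intro compact_sums \<Omega> compact_cball)
      show "{x + y | x y. x \<in> K \<and> y \<in> cball (0 :: real^'n) ?e} \<subseteq> \<Omega>"
      proof clarify
        fix x y assume "x \<in> K" "y \<in> cball (0 :: real^'n) ?e"
        then have "x + y \<in> ball x d" using e by (simp add: dist_norm)
        then show "x + y \<in> \<Omega>" using d(2) \<open>x \<in> K\<close> by blast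
      qed
      fix x assume x: "x \<notin> {x + y | x y. x \<in> K \<and> y \<in> cball (0 :: real^'n) ?e}"
      show "\<psi> n x = 0" unfolding \<psi>_def
      proof (rule conv_outside[where K = K and \<epsilon> = ?e])
        fix y assume y: "y \<in> K"
        show "norm (x - y) \<ge> ?e"
        proof (rule ccontr)
          assume "\<not> norm (x - y) \<ge> ?e"
          then have "x - y \<in> cball 0 ?e" by simp
          then have "y + (x - y) \<in> {x + y | x y. x \<in> K \<and> y \<in> cball (0 :: real^'n) ?e}" using y by blast
          then show False using x by simp
        qed
      qed (auto simp: f(3) intro: mollifier)
    qed
    show "(\<lambda>n. LINT x|lborel. (\<psi> n x - f x)\<^sup>2) \<longlonglongrightarrow> 0"
      unfolding \<psi>_def by (rule LIMSEQ_ignore_initial_segment[OF conv_mollifier_tendsto[OF f(1,2) \<Omega>(2) f(3)]])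
    show "(\<lambda>n. LINT x|lborel. (pd i (\<psi> n) x - g i x)\<^sup>2) \<longlonglongrightarrow> 0" for i
    proof -
      have "pd i (conv (mollifier m) f) = conv (mollifier m) (g i)" for m
        by (rule conv_weak_derivative[OF mollifier(1) fi w])
      then show ?thesis
        unfolding \<psi>_def by (simp only:) (rule LIMSEQ_ignore_initial_segment[OF conv_mollifier_tendsto[OF g(1,2) \<Omega>(2) g(3)]])
    qed
  qed
qed

subsection \<open>Korn's inequality\<close>

text \<open>First-order expansion in t of a shift tested against an integrable function. Two
  expansions of the same quantity must have equal linear coefficients, which is how the next
  identities between integrals of derivatives arise.\<close>

lemma test_fun_diff_quotient:
  fixes w \<eta> :: "real^'n::finite \<Rightarrow> real"
  assumes e: "test_fun \<Omega> \<eta>" and w: "integrable lborel w"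
  obtains C where
    "\<And>t. \<bar>(LINT x|lborel. w x * (\<eta> (x + t *\<^sub>R axis j 1) - \<eta> x)) - t * (LINT x|lborel. w x * pd j \<eta> x)\<bar> \<le> C * t\<^sup>2"
proof -
  obtain K where K: "K \<ge> 0"
    "\<And>x h. \<bar>\<eta> (x + h) - \<eta> x - (\<Sum>i\<in>UNIV. h $ i * pd i \<eta> x)\<bar> \<le> K * (norm h)\<^sup>2"
    by (rule test_fun_Taylor[OF e]) (rule that)
  have e': "test_fun UNIV \<eta>" using e by (rule test_fun_UNIV)
  have I1: "integrable lborel (\<lambda>x. w x * \<eta> x)"
    using integrable_test_fun_mult[OF e w] by (simp add: mult.commute)
  have I2: "integrable lborel (\<lambda>x. w x * pd j \<eta> x)"
    using integrable_test_fun_mult[OF test_fun_pd[OF e] w] by (simp add: mult.commute)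
  have "\<bar>(LINT x|lborel. w x * (\<eta> (x + t *\<^sub>R axis j 1) - \<eta> x)) - t * (LINT x|lborel. w x * pd j \<eta> x)\<bar>
     \<le> (K * (LINT x|lborel. \<bar>w x\<bar>)) * t\<^sup>2" for t
  proof -
    have I3: "integrable lborel (\<lambda>x. w x * \<eta> (x + t *\<^sub>R axis j 1))"
      using integrable_test_fun_mult[OF test_fun_translate[OF e', of "t *\<^sub>R axis j 1"] w]
      by (simp add: mult.commute add.commute)
    have "(LINT x|lborel. w x * (\<eta> (x + t *\<^sub>R axis j 1) - \<eta> x)) - t * (LINT x|lborel. w x * pd j \<eta> x)
      = (LINT x|lborel. w x * (\<eta> (x + t *\<^sub>R axis j 1) - \<eta> x) - t * (w x * pd j \<eta> x))"
      using I1 I2 I3 by (simp add: right_diff_distrib)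
    also have "\<bar>\<dots>\<bar> \<le> (LINT x|lborel. (K * t\<^sup>2) * \<bar>w x\<bar>)"
    proof (rule integral_abs_bound_integral)
      show "integrable lborel (\<lambda>x. w x * (\<eta> (x + t *\<^sub>R axis j 1) - \<eta> x) - t * (w x * pd j \<eta> x))"
        using I1 I2 I3 by (simp add: right_diff_distrib)
      show "integrable lborel (\<lambda>x. (K * t\<^sup>2) * \<bar>w x\<bar>)" using w by auto
      fix x
      have s: "(\<Sum>i\<in>UNIV. (t *\<^sub>R axis j 1) $ i * pd i \<eta> x) = t * pd j \<eta> x"
        by (simp add: axis_def if_distrib if_distribR cong: if_cong)
      have "\<bar>\<eta> (x + t *\<^sub>R axis j 1) - \<eta> x - t * pd j \<eta> x\<bar> \<le> K * t\<^sup>2"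
        using K(2)[of x "t *\<^sub>R axis j 1"] unfolding s by (simp add: norm_axis_1)
      then have "\<bar>w x\<bar> * \<bar>\<eta> (x + t *\<^sub>R axis j 1) - \<eta> x - t * pd j \<eta> x\<bar> \<le> \<bar>w x\<bar> * (K * t\<^sup>2)"
        by (intro mult_left_mono) auto
      then show "\<bar>w x * (\<eta> (x + t *\<^sub>R axis j 1) - \<eta> x) - t * (w x * pd j \<eta> x)\<bar> \<le> (K * t\<^sup>2) * \<bar>w x\<bar>"
        by (simp add: abs_mult[symmetric] algebra_simps)
    qed
    also have "\<dots> = (K * (LINT x|lborel. \<bar>w x\<bar>)) * t\<^sup>2" by simp
    finally show ?thesis .
  qed
  then show ?thesis by (rule that)
qed

lemma linear_le_square_imp_zero:
  fixes c K :: real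
  assumes "\<And>t. \<bar>t * c\<bar> \<le> K * t\<^sup>2"
  shows "c = 0"
proof (rule ccontr)
  assume c: "c \<noteq> 0"
  define t where "t = \<bar>c\<bar> / (\<bar>K\<bar> + 1)"
  have t: "t > 0" using c by (simp add: t_def add_nonneg_pos)
  have "t * \<bar>c\<bar> \<le> K * t * t" using assms[of t] t by (simp add: abs_mult power2_eq_square)
  then have "\<bar>c\<bar> \<le> K * t" using t by (simp add: mult.commute)
  also have "\<dots> \<le> \<bar>K\<bar> * t" using t by (intro mult_right_mono) auto
  also have "\<dots> < (\<bar>K\<bar> + 1) * t" using t by simp
  also have "\<dots> = \<bar>c\<bar>" by (simp add: t_def add_nonneg_eq_0_iff)
  finally show False by simp
qed

lemma test_fun_borel: "test_fun \<Omega> f \<Longrightarrow> f \<in> borel_measurable borel"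
  by (simp add: test_fun_def smooth_fun_borel)

lemma integral_translate_mult:
  fixes f g :: "'a::euclidean_space \<Rightarrow> real"
  assumes [measurable]: "f \<in> borel_measurable borel" "g \<in> borel_measurable borel"
  shows "(LINT x|lborel. f x * g (x + h)) = (LINT x|lborel. f (x - h) * g x)"
  using lborel_integral_translate(1)[of "\<lambda>x. f (x - h) * g x" h] by (simp add: add.commute)

text \<open>Translation invariance trades a shift of \<eta> by t for a shift of \<open>f\<close> by
  -t. Comparing the coefficients of t gives the identity with no reduction to one-dimensional
  integrals.\<close>

lemma test_fun_integral_by_parts:
  fixes f \<eta> :: "real^'n::finite \<Rightarrow> real"
  assumes f: "test_fun UNIV f" and e: "test_fun UNIV \<eta>"
  shows "(LINT x|lborel. f x * pd i \<eta> x) = - (LINT x|lborel. pd i f x * \<eta> x)"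
proof -
  let ?e = "\<lambda>t. t *\<^sub>R axis i (1::real)"
  have [measurable]: "f \<in> borel_measurable borel" "\<eta> \<in> borel_measurable borel"
    using f e by (auto intro: test_fun_borel)
  obtain C where C: "\<And>t. \<bar>(LINT x|lborel. f x * (\<eta> (x + ?e t) - \<eta> x)) - t * (LINT x|lborel. f x * pd i \<eta> x)\<bar> \<le> C * t\<^sup>2"
    by (rule test_fun_diff_quotient[OF e test_fun_integrable[OF f], of i]) (rule that)
  obtain D where D: "\<And>t. \<bar>(LINT x|lborel. \<eta> x * (f (x + ?e t) - f x)) - t * (LINT x|lborel. \<eta> x * pd i f x)\<bar> \<le> D * t\<^sup>2"
    by (rule test_fun_diff_quotient[OF f test_fun_integrable[OF e], of i]) (rule that)
  let ?a = "LINT x|lborel. f x * pd i \<eta> x" and ?b = "LINT x|lborel. \<eta> x * pd i f x"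
  have "\<bar>t * (?a + ?b)\<bar> \<le> (C + D) * t\<^sup>2" for t
  proof -
    have I: "integrable lborel (\<lambda>x. f x * \<eta> (c + x))" "integrable lborel (\<lambda>x. f x * \<eta> x)"
       "integrable lborel (\<lambda>x. \<eta> x * f (c + x))" for c
      using integrable_test_fun_mult[OF f test_fun_integrable[OF test_fun_translate[OF e, of c]]]
        integrable_test_fun_mult[OF e test_fun_integrable[OF test_fun_translate[OF f, of c]]]
        integrable_test_fun_mult[OF f test_fun_integrable[OF e]] by auto
    have "(LINT x|lborel. f x * (\<eta> (x + ?e t) - \<eta> x)) = (LINT x|lborel. f x * \<eta> (x + ?e t)) - (LINT x|lborel. f x * \<eta> x)"
      using I(1)[of "?e t"] I(2) by (simp add: right_diff_distrib add.commute)
    also have "(LINT x|lborel. f x * \<eta> (x + ?e t)) = (LINT x|lborel. \<eta> x * f (x + ?e (- t)))"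
      by (subst integral_translate_mult) (simp_all add: mult.commute)
    also have "\<dots> - (LINT x|lborel. f x * \<eta> x) = (LINT x|lborel. \<eta> x * (f (x + ?e (- t)) - f x))"
      using I(3)[of "?e (- t)"] I(2) by (simp add: right_diff_distrib add.commute mult.commute)
    finally have eq: "(LINT x|lborel. f x * (\<eta> (x + ?e t) - \<eta> x)) = (LINT x|lborel. \<eta> x * (f (x + ?e (- t)) - f x))" .
    have "t * (?a + ?b) = t * ?a - (- t) * ?b" by (simp add: algebra_simps)
    then show ?thesis
      using C[of t] D[of "- t"] unfolding eq by (simp add: distrib_right)
  qed
  then have "?a + ?b = 0" by (rule linear_le_square_imp_zero)
  then show ?thesis by (simp add: mult.commute)
qed

lemma test_fun_diff: "test_fun UNIV f \<Longrightarrow> test_fun UNIV g \<Longrightarrow> test_fun UNIV (\<lambda>x. f x - g x)"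
proof (rule test_funI[where K = "tsupport f \<union> tsupport g"])
  assume "test_fun UNIV f" "test_fun UNIV g"
  then show "smooth_fun (\<lambda>x. f x - g x)"
    using smooth_fun_add[of f "\<lambda>x. - 1 * g x"] smooth_fun_mult[OF smooth_fun_const, of g "- 1"]
    by (simp add: test_fun_def)
qed (auto simp: test_fun_def tsupport_outside)

text \<open>Both sides are limits of the same difference quotient, so no symmetry of second derivatives
  is needed.\<close>

lemma test_fun_pd_swap:
  fixes f \<eta> :: "real^'n::finite \<Rightarrow> real"
  assumes f: "test_fun UNIV f" and e: "test_fun UNIV \<eta>"
  shows "(LINT x|lborel. pd i f x * pd j \<eta> x) = (LINT x|lborel. pd j f x * pd i \<eta> x)"
proof -
  let ?e = "\<lambda>t. t *\<^sub>R axis j (1::real)"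
  note f' = test_fun_pd[OF f, of i] and e' = test_fun_pd[OF e, of i]
  have [measurable]: "f \<in> borel_measurable borel" "\<eta> \<in> borel_measurable borel"
    "pd i f \<in> borel_measurable borel" "pd i \<eta> \<in> borel_measurable borel"
    using f e f' e' by (auto intro: test_fun_borel)
  obtain C where C: "\<And>t. \<bar>(LINT x|lborel. pd i f x * (\<eta> (x + ?e t) - \<eta> x)) - t * (LINT x|lborel. pd i f x * pd j \<eta> x)\<bar> \<le> C * t\<^sup>2"
    by (rule test_fun_diff_quotient[OF e test_fun_integrable[OF f'], of j]) (rule that)
  obtain D where D: "\<And>t. \<bar>(LINT x|lborel. pd i \<eta> x * (f (x + ?e t) - f x)) - t * (LINT x|lborel. pd i \<eta> x * pd j f x)\<bar> \<le> D * t\<^sup>2"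
    by (rule test_fun_diff_quotient[OF f test_fun_integrable[OF e'], of j]) (rule that)
  let ?a = "LINT x|lborel. pd i f x * pd j \<eta> x" and ?b = "LINT x|lborel. pd i \<eta> x * pd j f x"
  have "\<bar>t * (?a - ?b)\<bar> \<le> (C + D) * t\<^sup>2" for t
  proof -
    have I: "integrable lborel (\<lambda>x. pd i f x * \<eta> (c + x))" "integrable lborel (\<lambda>x. pd i f x * \<eta> x)"
       "integrable lborel (\<lambda>x. \<eta> x * pd i f (c + x))" for c
      using integrable_test_fun_mult[OF f' test_fun_integrable[OF test_fun_translate[OF e, of c]]]
        integrable_test_fun_mult[OF e test_fun_integrable[OF test_fun_translate[OF f', of c]]]
        integrable_test_fun_mult[OF f' test_fun_integrable[OF e]] by auto
    \<comment> \<open>The shifted difference of \<open>pd i f\<close> is \<open>pd i\<close> of the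
      shifted difference of \<open>f\<close>. Integration by parts can therefore throw direction i
      onto \<eta> while the shift in direction j stays on \<open>f\<close>.\<close>
    let ?g = "\<lambda>x. f (?e (- t) + x)"
    have g: "test_fun UNIV ?g" by (rule test_fun_translate[OF f])
    have sf: "smooth_fun f" "smooth_fun ?g" using f g by (auto simp: test_fun_def)
    have pg: "pd i ?g x = pd i f (?e (- t) + x)" for x
      using pd_affine(1)[OF sf(1), of i "?e (- t)" 1 x] by simp
    have sm: "smooth_fun (\<lambda>x. - 1 * f x)"
      using smooth_fun_mult[OF smooth_fun_const sf(1)] .
    have pn: "pd i (\<lambda>x. - 1 * f x) x = - pd i f x" for x
      using pd_mult[of "\<lambda>x. - 1" x f i] smooth_fun_differentiable[OF sf(1)] by (simp add: pd_const)
    have pgf: "pd i (\<lambda>x. ?g x - f x) x = pd i f (x + ?e (- t)) - pd i f x" for x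
      using pd_add[OF smooth_fun_differentiable[OF sf(2)] smooth_fun_differentiable[OF sm], where i = i and x = x]
      by (simp add: pg[simplified] pn[simplified])
    have "(LINT x|lborel. pd i f x * (\<eta> (x + ?e t) - \<eta> x)) = (LINT x|lborel. pd i f x * \<eta> (x + ?e t)) - (LINT x|lborel. pd i f x * \<eta> x)"
      using I(1)[of "?e t"] I(2) by (simp add: right_diff_distrib add.commute)
    also have "(LINT x|lborel. pd i f x * \<eta> (x + ?e t)) = (LINT x|lborel. \<eta> x * pd i f (x + ?e (- t)))"
      by (subst integral_translate_mult) (simp_all add: mult.commute)
    also have "\<dots> - (LINT x|lborel. pd i f x * \<eta> x) = (LINT x|lborel. \<eta> x * (pd i f (x + ?e (- t)) - pd i f x))"
      using I(3)[of "?e (- t)"] I(2) by (simp add: right_diff_distrib add.commute mult.commute)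
    also have "\<dots> = (LINT x|lborel. \<eta> x * pd i (\<lambda>x. ?g x - f x) x)"
      by (simp only: pgf)
    also have "\<dots> = - (LINT x|lborel. pd i \<eta> x * (?g x - f x))"
      by (rule test_fun_integral_by_parts[OF e test_fun_diff[OF g f]])
    also have "\<dots> = - (LINT x|lborel. pd i \<eta> x * (f (x + ?e (- t)) - f x))"
      by (simp add: add.commute)
    finally have eq: "(LINT x|lborel. pd i f x * (\<eta> (x + ?e t) - \<eta> x)) = - (LINT x|lborel. pd i \<eta> x * (f (x + ?e (- t)) - f x))" .
    have "t * (?a - ?b) = t * ?a + (- t) * ?b" by (simp add: algebra_simps)
    then show ?thesis
      using C[of t] D[of "- t"] unfolding eq by (simp add: distrib_right)
  qed
  then have "?a - ?b = 0" by (rule linear_le_square_imp_zero)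
  then show ?thesis by (simp add: mult.commute)
qed

section \<open>Limits of products in L2 and the algebra of Korn's inequality\<close>

lemma abs_mult_le_sum_squares: "\<bar>a * b\<bar> \<le> a\<^sup>2 + (b::real)\<^sup>2"
proof -
  have "2 * (\<bar>a\<bar> * \<bar>b\<bar>) \<le> a\<^sup>2 + b\<^sup>2"
    using zero_le_power2[of "\<bar>a\<bar> - \<bar>b\<bar>"] by (simp add: power2_diff)
  moreover have "0 \<le> \<bar>a\<bar> * \<bar>b\<bar>" by simp
  ultimately show ?thesis unfolding abs_mult by linarith
qed

lemma integrable_mult_L2:
  fixes f g :: "'a \<Rightarrow> real"
  assumes [measurable]: "f \<in> borel_measurable M" "g \<in> borel_measurable M"
    and "integrable M (\<lambda>x. (f x)\<^sup>2)" "integrable M (\<lambda>x. (g x)\<^sup>2)"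
  shows "integrable M (\<lambda>x. f x * g x)"
proof (rule Bochner_Integration.integrable_bound)
  show "integrable M (\<lambda>x. (f x)\<^sup>2 + (g x)\<^sup>2)" using assms by auto
  have "\<bar>f x * g x\<bar> \<le> (f x)\<^sup>2 + (g x)\<^sup>2" for x
    by (rule abs_mult_le_sum_squares)
  then show "AE x in M. norm (f x * g x) \<le> norm ((f x)\<^sup>2 + (g x)\<^sup>2)"
    by (intro AE_I2) (auto intro: order_trans[OF _ abs_ge_self])
qed measurable

lemma integrable_add_square:
  fixes f g :: "'a \<Rightarrow> real"
  assumes [measurable]: "f \<in> borel_measurable M" "g \<in> borel_measurable M"
    and "integrable M (\<lambda>x. (f x)\<^sup>2)" "integrable M (\<lambda>x. (g x)\<^sup>2)"
  shows "integrable M (\<lambda>x. (f x + g x)\<^sup>2)" "integrable M (\<lambda>x. (f x - g x)\<^sup>2)"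
  using assms integrable_mult_L2[OF assms] by (simp_all add: power2_sum power2_diff mult.assoc)

text \<open>A weighted Young inequality does the work of Cauchy-Schwarz: for every s > 0 the error
  is at most a multiple of \<open>D n\<close>, which tends to 0, plus s times the fixed number
  \<open>S\<close>. First s is chosen, then n.\<close>

lemma L2_mult_tendsto:
  fixes p q :: "'a::euclidean_space \<Rightarrow> real"
  assumes m[measurable]: "p \<in> borel_measurable M" "q \<in> borel_measurable M"
    "\<And>n::nat. P n \<in> borel_measurable M" "\<And>n. Q n \<in> borel_measurable M"
    and i: "integrable M (\<lambda>x. (p x)\<^sup>2)" "integrable M (\<lambda>x. (q x)\<^sup>2)"
      "\<And>n. integrable M (\<lambda>x. (P n x)\<^sup>2)" "\<And>n. integrable M (\<lambda>x. (Q n x)\<^sup>2)"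
    and lim: "(\<lambda>n. LINT x|M. (P n x - p x)\<^sup>2) \<longlonglongrightarrow> 0" "(\<lambda>n. LINT x|M. (Q n x - q x)\<^sup>2) \<longlonglongrightarrow> 0"
  shows "(\<lambda>n. LINT x|M. P n x * Q n x) \<longlonglongrightarrow> (LINT x|M. p x * q x)"
proof -
  define D where "D n = (LINT x|M. (P n x - p x)\<^sup>2) + (LINT x|M. (Q n x - q x)\<^sup>2)" for n
  define S where "S = (LINT x|M. (p x)\<^sup>2) + (LINT x|M. (q x)\<^sup>2)"
  have D: "D \<longlonglongrightarrow> 0" using tendsto_add[OF lim] by (simp add: D_def[abs_def])
  have S: "S \<ge> 0" by (simp add: S_def)
  have est: "\<bar>(LINT x|M. P n x * Q n x) - (LINT x|M. p x * q x)\<bar> \<le> (1 + 1 / s) * D n + s * S" if s: "s > 0" for s n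
  proof -
    note j = integrable_add_square(2)[OF m(3)[of n] m(1) i(3)[of n] i(1)]
      integrable_add_square(2)[OF m(4)[of n] m(2) i(4)[of n] i(2)]
    have k: "integrable M (\<lambda>x. P n x * Q n x)" "integrable M (\<lambda>x. p x * q x)"
      by (rule integrable_mult_L2; intro m i)+
    have "(LINT x|M. P n x * Q n x) - (LINT x|M. p x * q x) = (LINT x|M. P n x * Q n x - p x * q x)"
      using k by simp
    also have "\<bar>\<dots>\<bar> \<le> (LINT x|M. (1 + 1 / s) * ((P n x - p x)\<^sup>2 + (Q n x - q x)\<^sup>2) + s * ((p x)\<^sup>2 + (q x)\<^sup>2))"
    proof (rule integral_abs_bound_integral)
      show "integrable M (\<lambda>x. P n x * Q n x - p x * q x)" using k by simp
      show "integrable M (\<lambda>x. (1 + 1 / s) * ((P n x - p x)\<^sup>2 + (Q n x - q x)\<^sup>2) + s * ((p x)\<^sup>2 + (q x)\<^sup>2))"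
        using j i(1,2) by auto
      fix x
      have abs: "\<bar>a * b\<bar> \<le> s * a\<^sup>2 + 1 / s * b\<^sup>2" for a b :: real
        using abs_mult_le_sum_squares[of "sqrt s * a" "b / sqrt s"] s by (simp add: power_mult_distrib power_divide)
      let ?A = "P n x - p x" and ?B = "Q n x - q x"
      have "P n x * Q n x - p x * q x = ?A * ?B + p x * ?B + q x * ?A" by (simp add: algebra_simps)
      also have "\<bar>\<dots>\<bar> \<le> \<bar>?A * ?B\<bar> + \<bar>p x * ?B\<bar> + \<bar>q x * ?A\<bar>" by linarith
      also have "\<dots> \<le> (?A\<^sup>2 + ?B\<^sup>2) + (s * (p x)\<^sup>2 + 1 / s * ?B\<^sup>2) + (s * (q x)\<^sup>2 + 1 / s * ?A\<^sup>2)"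
        by (intro add_mono abs_mult_le_sum_squares abs)
      finally show "\<bar>P n x * Q n x - p x * q x\<bar> \<le> (1 + 1 / s) * (?A\<^sup>2 + ?B\<^sup>2) + s * ((p x)\<^sup>2 + (q x)\<^sup>2)"
        by (simp add: distrib_left distrib_right add_divide_distrib)
    qed
    also have "\<dots> = (1 + 1 / s) * D n + s * S"
      using j i(1,2) by (simp add: D_def S_def)
    finally show ?thesis .
  qed
  show ?thesis
  proof (rule LIMSEQ_I)
    fix r :: real assume r: "r > 0"
    define s where "s = r / (2 * (S + 1))"
    have s: "s > 0" using r S by (simp add: s_def)
    have sS: "s * S < r / 2"
    proof -
      have "s * S < s * (S + 1)" using s by simp
      also have "\<dots> = r / 2" using S by (simp add: s_def field_simps add_nonneg_eq_0_iff)
      finally show ?thesis .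
    qed
    have "(\<lambda>n. (1 + 1 / s) * D n) \<longlonglongrightarrow> (1 + 1 / s) * 0" by (intro tendsto_intros D)
    then have "\<forall>\<^sub>F n in sequentially. (1 + 1 / s) * D n < r / 2"
      using r by (intro order_tendstoD(2)) auto
    then obtain N where N: "\<And>n. n \<ge> N \<Longrightarrow> (1 + 1 / s) * D n < r / 2"
      by (auto simp: eventually_sequentially)
    have "norm ((LINT x|M. P n x * Q n x) - (LINT x|M. p x * q x)) < r" if "n \<ge> N" for n
      using est[OF s, of n] N[OF that] sS unfolding real_norm_def by linarith
    then show "\<exists>N. \<forall>n\<ge>N. norm ((LINT x|M. P n x * Q n x) - (LINT x|M. p x * q x)) < r" by blast
  qed
qed

lemma test_fun_square_integrable:
  assumes "test_fun \<Omega> f"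
  shows "integrable lborel (\<lambda>x. (f x)\<^sup>2)"
  using integrable_test_fun_mult[OF assms test_fun_integrable[OF assms]] by (simp add: power2_eq_square)

text \<open>The exchange of directions holds for the approximating test functions, and both sides
  pass to the limit as L2 products of convergent sequences.\<close>

lemma weak_derivative_swap:
  fixes g g' :: "'n::finite \<Rightarrow> real^'n \<Rightarrow> real"
  assumes \<psi>: "\<And>n. test_fun UNIV (\<psi> n)" "\<And>n. test_fun UNIV (\<psi>' n)"
    and g: "\<And>i. g i \<in> borel_measurable borel" "\<And>i. integrable lborel (\<lambda>x. (g i x)\<^sup>2)"
      "\<And>i. (\<lambda>n. LINT x|lborel. (pd i (\<psi> n) x - g i x)\<^sup>2) \<longlonglongrightarrow> 0"
    and g': "\<And>i. g' i \<in> borel_measurable borel" "\<And>i. integrable lborel (\<lambda>x. (g' i x)\<^sup>2)"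
      "\<And>i. (\<lambda>n. LINT x|lborel. (pd i (\<psi>' n) x - g' i x)\<^sup>2) \<longlonglongrightarrow> 0"
  shows "(LINT x|lborel. g i x * g' j x) = (LINT x|lborel. g j x * g' i x)"
proof -
  have L: "(\<lambda>n. LINT x|lborel. pd i (\<psi> n) x * pd j (\<psi>' n) x) \<longlonglongrightarrow> (LINT x|lborel. g i x * g' j x)" for i j
    by (rule L2_mult_tendsto[OF _ _ _ _ g(2) g'(2) _ _ g(3) g'(3)])
      (use g(1) g'(1) test_fun_borel[OF test_fun_pd[OF \<psi>(1)]] test_fun_borel[OF test_fun_pd[OF \<psi>(2)]]
         test_fun_square_integrable[OF test_fun_pd[OF \<psi>(1)]] test_fun_square_integrable[OF test_fun_pd[OF \<psi>(2)]] in auto)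
  from L[of j i] have "(\<lambda>n. LINT x|lborel. pd i (\<psi> n) x * pd j (\<psi>' n) x) \<longlonglongrightarrow> (LINT x|lborel. g j x * g' i x)"
    using test_fun_pd_swap[OF \<psi>] by simp
  with L[of i j] show ?thesis by (rule LIMSEQ_unique)
qed

text \<open>Twice the squared norm of the symmetric part is the squared norm of \<open>H\<close>
  plus the products of \<open>H\<close> with its transpose. Exchanging directions turns the integral
  of these products into that of the squared trace, the divergence when \<open>H\<close> is a
  gradient, which is nonnegative.\<close>

lemma Korn_from_swap:
  fixes H :: "'n::finite \<Rightarrow> 'n \<Rightarrow> 'a \<Rightarrow> real"
  assumes m[measurable]: "\<And>\<alpha> i. H \<alpha> i \<in> borel_measurable M"
    and i: "\<And>\<alpha> i. integrable M (\<lambda>x. (H \<alpha> i x)\<^sup>2)"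
    and sw: "\<And>\<alpha> \<beta> i j. (LINT x|M. H \<alpha> i x * H \<beta> j x) = (LINT x|M. H \<alpha> j x * H \<beta> i x)"
  shows "(LINT x|M. (\<Sum>\<alpha>\<in>UNIV. \<Sum>i\<in>UNIV. (H \<alpha> i x)\<^sup>2))
     \<le> 2 * (LINT x|M. (\<Sum>\<alpha>\<in>UNIV. \<Sum>i\<in>UNIV. ((H \<alpha> i x + H i \<alpha> x) / 2)\<^sup>2))"
proof -
  have k: "integrable M (\<lambda>x. H \<alpha> i x * H \<beta> j x)" for \<alpha> i \<beta> j
    by (rule integrable_mult_L2; intro m i)
  let ?N = "LINT x|M. (\<Sum>\<alpha>\<in>UNIV. \<Sum>i\<in>UNIV. (H \<alpha> i x)\<^sup>2)"
  have "2 * (LINT x|M. (\<Sum>\<alpha>\<in>UNIV. \<Sum>i\<in>UNIV. ((H \<alpha> i x + H i \<alpha> x) / 2)\<^sup>2))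
    = (LINT x|M. 2 * (\<Sum>\<alpha>\<in>UNIV. \<Sum>i\<in>UNIV. ((H \<alpha> i x + H i \<alpha> x) / 2)\<^sup>2))" by simp
  also have "\<dots> = (LINT x|M. (\<Sum>\<alpha>\<in>UNIV. \<Sum>i\<in>UNIV. (H \<alpha> i x)\<^sup>2) + (\<Sum>\<alpha>\<in>UNIV. \<Sum>i\<in>UNIV. H \<alpha> i x * H i \<alpha> x))"
  proof (intro Bochner_Integration.integral_cong refl)
    fix x
    have "2 * (\<Sum>\<alpha>\<in>UNIV. \<Sum>i\<in>UNIV. ((H \<alpha> i x + H i \<alpha> x) / 2)\<^sup>2)
      = (\<Sum>\<alpha>\<in>UNIV. \<Sum>i\<in>UNIV. (H \<alpha> i x)\<^sup>2 / 2 + (H i \<alpha> x)\<^sup>2 / 2 + H \<alpha> i x * H i \<alpha> x)"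
      unfolding sum_distrib_left
      by (intro sum.cong refl) (simp add: power2_eq_square field_simps)
    also have "\<dots> = (\<Sum>\<alpha>\<in>UNIV. \<Sum>i\<in>UNIV. (H \<alpha> i x)\<^sup>2 / 2) + (\<Sum>\<alpha>\<in>UNIV. \<Sum>i\<in>UNIV. (H i \<alpha> x)\<^sup>2 / 2)
       + (\<Sum>\<alpha>\<in>UNIV. \<Sum>i\<in>UNIV. H \<alpha> i x * H i \<alpha> x)"
      by (simp add: sum.distrib)
    also have "(\<Sum>\<alpha>\<in>UNIV. \<Sum>i\<in>UNIV. (H i \<alpha> x)\<^sup>2 / 2) = (\<Sum>\<alpha>\<in>UNIV. \<Sum>i\<in>UNIV. (H \<alpha> i x)\<^sup>2 / 2)"
      by (rule sum.swap)
    finally show "2 * (\<Sum>\<alpha>\<in>UNIV. \<Sum>i\<in>UNIV. ((H \<alpha> i x + H i \<alpha> x) / 2)\<^sup>2)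
      = (\<Sum>\<alpha>\<in>UNIV. \<Sum>i\<in>UNIV. (H \<alpha> i x)\<^sup>2) + (\<Sum>\<alpha>\<in>UNIV. \<Sum>i\<in>UNIV. H \<alpha> i x * H i \<alpha> x)"
      by (simp add: sum.distrib[symmetric])
  qed
  also have "\<dots> = ?N + (\<Sum>\<alpha>\<in>UNIV. \<Sum>i\<in>UNIV. LINT x|M. H \<alpha> i x * H i \<alpha> x)"
    using i k by simp
  also have "(\<Sum>\<alpha>\<in>UNIV. \<Sum>i\<in>UNIV. LINT x|M. H \<alpha> i x * H i \<alpha> x) = (\<Sum>\<alpha>\<in>UNIV. \<Sum>i\<in>UNIV. LINT x|M. H \<alpha> \<alpha> x * H i i x)"
    by (intro sum.cong refl sw)
  also have "\<dots> = (LINT x|M. (\<Sum>\<alpha>\<in>UNIV. H \<alpha> \<alpha> x)\<^sup>2)"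
    using k by (simp add: power2_eq_square sum_product)
  finally have "2 * (LINT x|M. (\<Sum>\<alpha>\<in>UNIV. \<Sum>i\<in>UNIV. ((H \<alpha> i x + H i \<alpha> x) / 2)\<^sup>2))
     = ?N + (LINT x|M. (\<Sum>\<alpha>\<in>UNIV. H \<alpha> \<alpha> x)\<^sup>2)" .
  moreover have "(LINT x|M. (\<Sum>\<alpha>\<in>UNIV. H \<alpha> \<alpha> x)\<^sup>2) \<ge> 0" by simp
  ultimately show ?thesis by linarith
qed

subsection \<open>Geometry of the inclusions\<close>

text \<open>Periodicity is a hypothesis on \<omega>, not on the family, so a translated inclusion is
  not known to be an inclusion. Connectedness steps in: the translate lies in the complement of
  \<omega>, which is covered by disjoint open neighbourhoods of inclusions, hence it lies in a
  single one of them. After a shift into the unit cube only finitely many inclusions come into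
  question.\<close>

lemma separated_inclusions_diameter:
  fixes \<omega> :: "(real^'n::finite) set"
  assumes per: "int_periodic_set \<omega>" and cover: "- \<omega> = \<Union> (closure ` Fs)"
    and bdd: "\<And>D. D \<in> Fs \<Longrightarrow> bounded D" and conn: "\<And>D. D \<in> Fs \<Longrightarrow> connected D"
    and \<delta>: "\<delta> > 0" "\<And>D1 D2 x y. D1 \<in> Fs \<Longrightarrow> D2 \<in> Fs \<Longrightarrow> D1 \<noteq> D2 \<Longrightarrow> x \<in> D1 \<Longrightarrow> y \<in> D2 \<Longrightarrow> dist x y \<ge> \<delta>"
  obtains M where "\<And>D x y. D \<in> Fs \<Longrightarrow> x \<in> D \<Longrightarrow> y \<in> D \<Longrightarrow> dist x y \<le> M"
proof -
  define nb where "nb D = (\<Union>y\<in>D. ball y (\<delta> / 2))" for D :: "(real^'n) set"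
  have nb_open: "open (nb D)" for D by (auto simp: nb_def)
  have nb_closure: "closure D \<subseteq> nb D" for D
  proof
    fix x assume "x \<in> closure D"
    moreover have "\<delta> / 2 > 0" using \<delta>(1) by simp
    ultimately obtain y where "y \<in> D" "dist y x < \<delta> / 2"
      unfolding closure_approachable by blast
    then show "x \<in> nb D" by (auto simp: nb_def)
  qed
  have nb_disj: "nb D1 \<inter> nb D2 = {}" if D: "D1 \<in> Fs" "D2 \<in> Fs" "D1 \<noteq> D2" for D1 D2
  proof (rule ccontr)
    assume "nb D1 \<inter> nb D2 \<noteq> {}"
    then obtain x y1 y2 where "y1 \<in> D1" "y2 \<in> D2" "dist y1 x < \<delta> / 2" "dist y2 x < \<delta> / 2"
      by (auto simp: nb_def)
    then show False using \<delta>(2)[OF D, of y1 y2] dist_triangle2[of y1 y2 x] by linarith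
  qed
  define K :: "(real^'n) set" where "K = cbox 0 1"
  define FK where "FK = {D \<in> Fs. closure D \<inter> K \<noteq> {}}"
  \<comment> \<open>Points chosen in the closures of distinct inclusions keep distance at least
    \<delta>, and a bounded uniformly discrete set is finite.\<close>
  have "finite FK"
  proof -
    have "\<forall>D\<in>FK. \<exists>y. y \<in> closure D \<inter> K" by (auto simp: FK_def)
    then obtain p where p: "\<And>D. D \<in> FK \<Longrightarrow> p D \<in> closure D \<inter> K" by metis
    have cl: "dist x y \<ge> \<delta>" if h: "D1 \<in> FK" "D2 \<in> FK" "D1 \<noteq> D2" "x \<in> closure D1" "y \<in> closure D2" for D1 D2 x y
    proof (rule ccontr)
      assume "\<not> dist x y \<ge> \<delta>"
      then have e: "(\<delta> - dist x y) / 2 > 0" by simp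
      obtain x' where "x' \<in> D1" "dist x' x < (\<delta> - dist x y) / 2"
        using h(4) e unfolding closure_approachable by blast
      moreover obtain y' where "y' \<in> D2" "dist y' y < (\<delta> - dist x y) / 2"
        using h(5) e unfolding closure_approachable by blast
      ultimately have "dist x' y' < \<delta>"
        using dist_triangle[of x' y' x] dist_triangle2[of x y' y] by (simp add: field_simps)
      then show False
        using \<delta>(2)[of D1 D2 x' y'] h \<open>x' \<in> D1\<close> \<open>y' \<in> D2\<close> by (auto simp: FK_def)
    qed
    have pd: "dist (p D1) (p D2) \<ge> \<delta>" if "D1 \<in> FK" "D2 \<in> FK" "D1 \<noteq> D2" for D1 D2
      using cl[OF that] p that by blast
    have "inj_on p FK"
      by (rule inj_onI) (use pd \<delta>(1) in force)
    moreover have "uniform_discrete (p ` FK)"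
      unfolding uniform_discrete_def using \<delta>(1) pd by (intro exI[of _ \<delta>]) force
    moreover have "bounded (p ` FK)"
      by (rule bounded_subset[of K]) (use p in \<open>auto simp: K_def\<close>)
    ultimately show ?thesis
      using uniform_discrete_finite_iff finite_imageD by blast
  qed
  then have "bounded (\<Union>FK)" by (rule bounded_Union) (auto simp: FK_def intro: bdd)
  then obtain B where B: "\<And>x. x \<in> \<Union>FK \<Longrightarrow> norm x \<le> B" unfolding bounded_iff by blast
  show ?thesis
  proof
    fix D x y assume D: "D \<in> Fs" and x: "x \<in> D" and y: "y \<in> D"
    define z :: "real^'n" where "z = (\<chi> i. - of_int \<lfloor>x $ i\<rfloor>)"
    let ?S = "(\<lambda>v. z + v) ` D"
    have S: "connected ?S" by (intro connected_continuous_image continuous_intros conn D)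
    have Sw: "?S \<subseteq> - \<omega>"
    proof clarify
      fix v assume v: "v \<in> D" "z + v \<in> \<omega>"
      have zi: "\<forall>i. z $ i \<in> \<int>" by (simp add: z_def)
      have "v \<in> - \<omega>" using cover v D closure_subset by blast
      then show False
        using per zi v(2) unfolding int_periodic_set_def by (metis ComplD add.commute)
    qed
    obtain D' where D': "D' \<in> Fs" "z + x \<in> closure D'"
      using Sw cover x by blast
    have "z + x \<in> K"
      by (auto simp: K_def z_def mem_box_cart) linarith
    then have D'K: "D' \<in> FK" using D' by (auto simp: FK_def)
    let ?B = "\<Union>D''\<in>Fs - {D'}. nb D''"
    have SB: "?S \<subseteq> nb D' \<union> ?B"
    proof
      fix v assume "v \<in> ?S"
      then obtain D'' where "D'' \<in> Fs" "v \<in> closure D''" using Sw cover by blast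
      then show "v \<in> nb D' \<union> ?B" using nb_closure[of D''] by blast
    qed
    have "nb D' \<inter> ?S = {} \<or> ?B \<inter> ?S = {}"
    proof (rule connectedD[OF S nb_open])
      show "open ?B" by (auto intro: nb_open)
      show "nb D' \<inter> ?B \<inter> ?S = {}" using nb_disj D'(1) by blast
      show "?S \<subseteq> nb D' \<union> ?B" by (rule SB)
    qed
    moreover have "z + x \<in> nb D' \<inter> ?S" using D'(2) nb_closure x by blast
    ultimately have "?B \<inter> ?S = {}" by blast
    then have sub: "?S \<subseteq> nb D'" using SB by blast
    \<comment> \<open>Replacing a point of the translate by one of \<open>D'\<close> costs \<delta>
      / 2 at either end, and two points of \<open>D'\<close> are at most 2 B apart.\<close>
    obtain y1 where y1: "y1 \<in> D'" "dist y1 (z + x) < \<delta> / 2"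
      using sub x by (auto simp: nb_def)
    obtain y2 where y2: "y2 \<in> D'" "dist y2 (z + y) < \<delta> / 2"
      using sub y by (auto simp: nb_def)
    have "norm y1 \<le> B" "norm y2 \<le> B" using B y1 y2 D'K by auto
    then have "dist y1 y2 \<le> 2 * B" using norm_triangle_ineq4[of y1 y2] by (simp add: dist_norm)
    moreover have "dist x y = dist (z + x) (z + y)" by simp
    ultimately show "dist x y \<le> 2 * B + \<delta>"
      using dist_triangle3[of "z + x" "z + y" y1] dist_triangle[of y1 "z + y" y2] y1(2) y2(2) by linarith
  qed
qed

text \<open>Inside a chart the frontier lies on the graph of a Lipschitz function over a hyperplane.
  The hyperplane is a null set of the ambient space, and the graph map is Lipschitz on it, so its
  image is null; being null is a local property.\<close>

lemma lipschitz_domain_negligible_frontier: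
  fixes D :: "(real^'n::finite) set"
  assumes "lipschitz_domain D"
  shows "negligible (frontier D)"
proof (rule locally_negligible_alt[THEN iffD2], rule ballI)
  fix p assume p: "p \<in> frontier D"
  note charts = assms[unfolded lipschitz_domain_def, THEN conjunct2, THEN conjunct2, THEN conjunct2, THEN conjunct2]
  from bspec[OF charts p] obtain e :: "real^'n" and r h L and g :: "real^'n \<Rightarrow> real" where
    chart: "norm e = 1 \<and> r > 0 \<and> h > 0 \<and>
        L-lipschitz_on {y. y \<bullet> e = 0} g \<and>
        (\<forall>y. y \<bullet> e = 0 \<and> norm y < r \<longrightarrow> \<bar>g y\<bar> < h) \<and>
        (\<forall>x. norm ((x - p) - ((x - p) \<bullet> e) *\<^sub>R e) < r \<and> \<bar>(x - p) \<bullet> e\<bar> < h \<longrightarrow>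
              (x \<in> D \<longleftrightarrow> (x - p) \<bullet> e > g ((x - p) - ((x - p) \<bullet> e) *\<^sub>R e)))"
    by (elim exE) (rule that)
  note e = conjunct1[OF chart] and c1 = conjunct2[OF chart]
  note rh = conjunct1[OF c1] conjunct1[OF conjunct2[OF c1]] and c2 = conjunct2[OF conjunct2[OF c1]]
  note g = conjunct1[OF c2] and D = conjunct2[OF conjunct2[OF c2]]
  define \<pi> where "\<pi> x = (x - p) - ((x - p) \<bullet> e) *\<^sub>R e" for x
  define t where "t x = (x - p) \<bullet> e" for x
  have ee: "e \<bullet> e = 1" using e by (simp add: norm_eq_1)
  have \<pi>e: "\<pi> x \<bullet> e = 0" for x by (simp add: \<pi>_def inner_diff_left ee)
  define C where "C = {x. norm (\<pi> x) < r \<and> \<bar>t x\<bar> < h}"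
  have cont: "continuous_on UNIV \<pi>" "continuous_on UNIV t"
    unfolding \<pi>_def t_def by (intro continuous_intros)+
  have oC: "open C"
    unfolding C_def by (intro open_Collect_conj open_Collect_less continuous_intros cont)
  have pC: "p \<in> C" using rh by (simp add: C_def \<pi>_def t_def)
  have cg: "continuous_on UNIV (\<lambda>x. g (\<pi> x))"
    by (rule continuous_on_compose2[OF lipschitz_on_continuous_on[OF g] cont(1)]) (auto simp: \<pi>e)
  \<comment> \<open>Strictly above the graph a point is interior to \<open>D\<close>, strictly below
    it is outside the closure.\<close>
  have graph: "t x = g (\<pi> x)" if x: "x \<in> C" "x \<in> frontier D" for x
  proof (rule ccontr)
    assume ne: "t x \<noteq> g (\<pi> x)"
    have DC: "y \<in> D \<longleftrightarrow> t y > g (\<pi> y)" if "y \<in> C" for y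
      using D that by (simp add: C_def \<pi>_def t_def)
    show False
    proof (cases "t x > g (\<pi> x)")
      case True
      have "open (C \<inter> {y. g (\<pi> y) < t y})"
        by (intro open_Int oC open_Collect_less cg cont)
      moreover have "C \<inter> {y. g (\<pi> y) < t y} \<subseteq> D" using DC by blast
      ultimately have "x \<in> interior D" using True x(1) by (intro interiorI) auto
      then show False using x(2) by (simp add: frontier_def)
    next
      case False
      have "open (C \<inter> {y. t y < g (\<pi> y)})"
        by (intro open_Int oC open_Collect_less cg cont)
      moreover have "D \<inter> (C \<inter> {y. t y < g (\<pi> y)}) = {}" using DC by force
      moreover have "x \<in> C \<inter> {y. t y < g (\<pi> y)}" using False ne x(1) by auto
      ultimately have "x \<notin> closure D"
        using open_Int_closure_eq_empty by blast
      then show False using x(2) by (simp add: frontier_def)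
    qed
  qed
  let ?H = "{y. y \<bullet> e = 0}"
  let ?\<Phi> = "\<lambda>y. p + y + g y *\<^sub>R e"
  have "negligible (?\<Phi> ` ?H)"
  proof (rule negligible_locally_Lipschitz_image)
    have "e \<noteq> 0" using e by auto
    then show "negligible ?H"
      using negligible_hyperplane[of e 0] by (simp add: inner_commute)
    fix x assume x: "x \<in> ?H"
    have "norm (?\<Phi> y - ?\<Phi> x) \<le> (1 + L) * norm (y - x)" if "y \<in> ?H" for y
    proof -
      have "?\<Phi> y - ?\<Phi> x = (y - x) + (g y - g x) *\<^sub>R e" by (simp add: algebra_simps)
      also have "norm \<dots> \<le> norm (y - x) + \<bar>g y - g x\<bar>"
        using norm_triangle_ineq[of "y - x" "(g y - g x) *\<^sub>R e"] e by simp
      also have "\<bar>g y - g x\<bar> \<le> L * norm (y - x)"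
        using lipschitz_onD[OF g that x] by (simp add: dist_norm)
      finally show ?thesis by (simp add: algebra_simps)
    qed
    then show "\<exists>T B. open T \<and> x \<in> T \<and> (\<forall>y \<in> ?H \<inter> T. norm (?\<Phi> y - ?\<Phi> x) \<le> B * norm (y - x))"
      by (intro exI[of _ UNIV] exI[of _ "1 + L"]) auto
  qed simp
  moreover have "frontier D \<inter> C \<subseteq> ?\<Phi> ` ?H"
  proof clarify
    fix x assume "x \<in> frontier D" "x \<in> C"
    then have "x = ?\<Phi> (\<pi> x)" using graph[of x] by (simp add: \<pi>_def t_def)
    then show "x \<in> ?\<Phi> ` ?H" using \<pi>e by blast
  qed
  ultimately have "negligible (frontier D \<inter> C)" by (rule negligible_subset)
  moreover have "openin (top_of_set (frontier D)) (frontier D \<inter> C)"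
    using oC by (rule openin_open_Int)
  ultimately show "\<exists>U. openin (top_of_set (frontier D)) U \<and> p \<in> U \<and> negligible U"
    using p pC by blast
qed

subsection \<open>A cutoff function that is constant on every inclusion\<close>

lemma conv_eq_const:
  assumes r: "test_fun UNIV \<rho>" "\<And>x. norm x \<ge> \<epsilon> \<Longrightarrow> \<rho> x = 0"
    and g: "\<And>y. norm (x - y) < \<epsilon> \<Longrightarrow> g y = c"
  shows "conv \<rho> g x = c * (LINT x|lborel. \<rho> x)"
proof -
  have [measurable]: "\<rho> \<in> borel_measurable borel" using r(1) by (rule test_fun_borel)
  have "\<rho> (x - y) * g y = c * \<rho> (x - y)" for y
    using r(2)[of "x - y"] g[of y] by (cases "norm (x - y) < \<epsilon>") auto
  then have "conv \<rho> g x = (LINT y|lborel. c * \<rho> (x - y))" by (simp only: conv_def)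
  also have "\<dots> = c * (LINT y|lborel. \<rho> (x - y))" by simp
  also have "(LINT y|lborel. \<rho> (x - y)) = (LINT y|lborel. \<rho> y)"
    by (rule lborel_integral_reflect(1)) measurable
  finally show ?thesis .
qed

lemma pd_locally_const:
  fixes f :: "real^'n::finite \<Rightarrow> real"
  assumes "open S" "x \<in> S" "\<And>y. y \<in> S \<Longrightarrow> f y = c"
  shows "pd i f x = 0"
proof -
  have "((\<lambda>x. c) has_derivative (\<lambda>h. 0)) (at x)" by simp
  then have "(f has_derivative (\<lambda>h. 0)) (at x)"
    by (rule has_derivative_transform_within_open[OF _ assms(1,2)]) (simp add: assms(3))
  from pd_eqI[OF this] show ?thesis .
qed

lemma integrable_indicator_compact:
  fixes K :: "'a::euclidean_space set"
  assumes "compact K"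
  shows "integrable lborel (indicator K :: 'a \<Rightarrow> real)"
  using borel_integrable_compact[OF assms, of "\<lambda>x. 1::real"] by simp

text \<open>Smoothing the indicator of a large ball gives a function that is constant near the
  origin, and its derivative there is the integral in question. The mean value zero later permits
  subtracting a constant in the gradient bound for the cutoff.\<close>

lemma integral_pd_eq_0:
  fixes \<rho> :: "real^'n::finite \<Rightarrow> real"
  assumes r: "test_fun UNIV \<rho>" "\<And>x. norm x \<ge> \<epsilon> \<Longrightarrow> \<rho> x = 0" and \<epsilon>: "\<epsilon> > 0"
  shows "(LINT x|lborel. pd i \<rho> x) = 0"
proof -
  let ?B = "cball (0::real^'n) (2 * \<epsilon>)"
  let ?g = "indicator ?B :: real^'n \<Rightarrow> real"
  have g: "integrable lborel ?g" by (intro integrable_indicator_compact) simp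
  have tp: "tsupport \<rho> \<subseteq> cball 0 \<epsilon>"
    by (rule compact_tsupport_subset) (auto intro: r(2))
  have pz: "pd i \<rho> x = 0" if "norm x > \<epsilon>" for x
    using tp that by (intro pd_outside_tsupport) auto
  have c: "conv \<rho> ?g x = 1 * (LINT x|lborel. \<rho> x)" if "x \<in> ball 0 \<epsilon>" for x
  proof (rule conv_eq_const[OF r])
    fix y :: "real^'n" assume "norm (x - y) < \<epsilon>"
    then have "norm y \<le> 2 * \<epsilon>" using that norm_triangle_ineq3[of y x] by (simp add: norm_minus_commute)
    then show "?g y = 1" by simp
  qed
  have "0 = pd i (conv \<rho> ?g) 0"
    by (rule pd_locally_const[symmetric, where S = "ball 0 \<epsilon>"]) (use c \<epsilon> in auto)
  also have "\<dots> = conv (pd i \<rho>) ?g 0" by (simp add: pd_conv[OF r(1) g])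
  also have "\<dots> = (LINT y|lborel. pd i \<rho> (0 - y))"
    unfolding conv_def
  proof (intro Bochner_Integration.integral_cong refl)
    fix y :: "real^'n"
    show "pd i \<rho> (0 - y) * ?g y = pd i \<rho> (0 - y)"
      using pz[of "0 - y"] \<epsilon> by (cases "norm y \<le> 2 * \<epsilon>") auto
  qed
  also have "\<dots> = (LINT y|lborel. pd i \<rho> y)"
    by (rule lborel_integral_reflect(1)) (rule test_fun_borel[OF test_fun_pd[OF r(1)]])
  finally show ?thesis by simp
qed

text \<open>Collapsing neighbourhoods to points may destroy continuity, but the jumps are of order 1
  / R because points move by a bounded distance. Mollifying at the fixed scale \<epsilon> therefore
  yields a gradient of order 1 / R. It also preserves constancy on an inclusion, since the collapsed
  function is constant on the whole \<epsilon>-neighbourhood.\<close>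

lemma cutoff_constant_on_inclusions:
  fixes Fs :: "(real^'n::finite) set set"
  assumes \<delta>: "\<delta> > 0" "\<And>D1 D2 x y. D1 \<in> Fs \<Longrightarrow> D2 \<in> Fs \<Longrightarrow> D1 \<noteq> D2 \<Longrightarrow> x \<in> D1 \<Longrightarrow> y \<in> D2 \<Longrightarrow> dist x y \<ge> \<delta>"
    and M: "\<And>D x y. D \<in> Fs \<Longrightarrow> x \<in> D \<Longrightarrow> y \<in> D \<Longrightarrow> dist x y \<le> M"
  obtains R0 L where "L \<ge> 0" "R0 > 0"
    "\<And>R. R \<ge> R0 \<Longrightarrow> \<exists>\<phi>. test_fun (cube R) \<phi> \<and> (\<forall>x\<in>cube (R / 2). \<phi> x = 1) \<and>
       (\<forall>D\<in>Fs. \<exists>c. \<forall>x\<in>D. \<phi> x = c) \<and> (\<forall>x i. \<bar>pd i \<phi> x\<bar> \<le> L / R)"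
proof -
  \<comment> \<open>Half the separation, so that the \<epsilon>-neighbourhoods of distinct
    inclusions are disjoint.\<close>
  define \<epsilon> where "\<epsilon> = \<delta> / 2"
  have \<epsilon>: "\<epsilon> > 0" using \<delta> by (simp add: \<epsilon>_def)
  define nb where "nb D = (\<Union>y\<in>D. ball y \<epsilon>)" for D :: "(real^'n) set"
  have nb_open: "open (nb D)" for D by (auto simp: nb_def)
  have nb_disj: "D1 = D2" if D: "D1 \<in> Fs" "D2 \<in> Fs" "x \<in> nb D1" "x \<in> nb D2" for D1 D2 x
  proof (rule ccontr)
    assume ne: "D1 \<noteq> D2"
    obtain y1 y2 where "y1 \<in> D1" "y2 \<in> D2" "dist y1 x < \<delta> / 2" "dist y2 x < \<delta> / 2"
      using D by (auto simp: nb_def \<epsilon>_def)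
    then show False using \<delta>(2)[OF D(1,2) ne, of y1 y2] dist_triangle2[of y1 y2 x] by linarith
  qed
  define q where "q D = (SOME y. y \<in> D)" for D :: "(real^'n) set"
  have q: "q D \<in> D" if "y \<in> D" for y D unfolding q_def using that by (rule someI)
  define p where "p x = (if \<exists>D\<in>Fs. x \<in> nb D then q (SOME D. D \<in> Fs \<and> x \<in> nb D) else x)" for x
  have p_in: "p x = q D" if "D \<in> Fs" "x \<in> nb D" for D x
  proof -
    have "(SOME D. D \<in> Fs \<and> x \<in> nb D) = D"
      using that nb_disj by (intro some_equality) blast+
    then show ?thesis using that by (auto simp: p_def)
  qed
  \<comment> \<open>Displacement bound: diameter of the inclusion plus distance to it. The absolute
    value guards against a negative \<open>M\<close>, which is possible for an empty family.\<close>
  define m where "m = \<bar>M\<bar> + \<epsilon>"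
  have m: "m > 0" using \<epsilon> by (simp add: m_def)
  have p_near: "norm (p x - x) \<le> m" for x
  proof (cases "\<exists>D\<in>Fs. x \<in> nb D")
    case True
    then obtain D y where D: "D \<in> Fs" "x \<in> nb D" "y \<in> D" "dist y x < \<epsilon>" by (auto simp: nb_def)
    have "dist (q D) y \<le> M" using M[OF D(1) q[OF D(3)] D(3)] .
    then have "dist (p x) x \<le> M + \<epsilon>"
      using D(4) dist_triangle[of "q D" x y] p_in[OF D(1,2)] by simp
    then show ?thesis by (simp add: m_def dist_norm)
  qed (use m in \<open>auto simp: p_def\<close>)
  obtain \<rho> :: "real^'n \<Rightarrow> real" where \<rho>: "test_fun UNIV \<rho>" "\<And>x. \<rho> x \<ge> 0" "\<And>x. norm x \<ge> \<epsilon> \<Longrightarrow> \<rho> x = 0" "(LINT x|lborel. \<rho> x) = 1"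
    by (rule bump_exists[OF \<epsilon>]) (rule that)
  define J where "J = (\<Sum>i\<in>UNIV. LINT x|lborel. \<bar>pd i \<rho> x\<bar>)"
  have J: "J \<ge> 0" by (auto simp: J_def intro!: sum_nonneg)
  define L where "L = 8 * (\<epsilon> + 2 * m) * J"
  \<comment> \<open>Forces \<open>m + \<epsilon> < R / 16\<close>, the margin on either side of the
    transition zone of the cutoff \<kappa> below.\<close>
  define R0 where "R0 = 16 * (m + \<epsilon>) + 1"
  have R0: "R0 > 0" using m \<epsilon> by (simp add: R0_def)
  have "\<exists>\<phi>. test_fun (cube R) \<phi> \<and> (\<forall>x\<in>cube (R / 2). \<phi> x = 1) \<and>
       (\<forall>D\<in>Fs. \<exists>c. \<forall>x\<in>D. \<phi> x = c) \<and> (\<forall>x i. \<bar>pd i \<phi> x\<bar> \<le> L / R)" if R: "R \<ge> R0" for R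
  proof -
    have R': "R > 0" "m + \<epsilon> < R / 16" using R R0 by (auto simp: R0_def)
    \<comment> \<open>\<kappa> is 1 up to sup norm 5 R / 16 and 0 from 7 R / 16 on, with slope 8 / R
      in between. The two cubes have sup norm radius R / 4 and R / 2, so a margin of R / 16 remains
      at both ends.\<close>
    define \<kappa> where "\<kappa> x = max 0 (min 1 (7 / 2 - 8 * infnorm x / R))" for x :: "real^'n"
    have \<kappa>01: "0 \<le> \<kappa> x" "\<kappa> x \<le> 1" for x by (auto simp: \<kappa>_def)
    have clamp: "\<bar>max 0 (min 1 s) - max 0 (min 1 t)\<bar> \<le> \<bar>s - t\<bar>" for s t :: real
      by (auto simp: max_def min_def)
    have \<kappa>lip: "\<bar>\<kappa> x - \<kappa> y\<bar> \<le> 8 / R * norm (x - y)" for x y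
    proof -
      have "\<bar>infnorm x - infnorm y\<bar> \<le> norm (x - y)"
        using absdiff_infnorm[of x y] infnorm_le_norm[of "x - y"] by linarith
      then have "8 / R * \<bar>infnorm x - infnorm y\<bar> \<le> 8 / R * norm (x - y)"
        using R' by (intro mult_left_mono) auto
      moreover have "8 / R * \<bar>infnorm x - infnorm y\<bar> = \<bar>8 / R * (infnorm x - infnorm y)\<bar>"
        unfolding abs_mult using R' by simp
      moreover have "8 / R * (infnorm x - infnorm y) = 8 * infnorm x / R - 8 * infnorm y / R"
        by (simp add: right_diff_distrib)
      moreover have "\<bar>\<kappa> x - \<kappa> y\<bar> \<le> \<bar>(7 / 2 - 8 * infnorm x / R) - (7 / 2 - 8 * infnorm y / R)\<bar>"
        unfolding \<kappa>_def by (rule clamp)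
      ultimately show ?thesis by linarith
    qed
    have \<kappa>c: "continuous_on UNIV \<kappa>"
      unfolding \<kappa>_def using R' by (intro continuous_intros continuous_on_infnorm) auto
    define g where "g x = \<kappa> (p x)" for x
    have g01: "0 \<le> g x" "g x \<le> 1" for x by (auto simp: g_def \<kappa>01)
    \<comment> \<open>\<open>g\<close> need not be continuous, but its superlevel sets are built
      from open sets: a union of neighbourhoods over any subfamily is open, hence Borel.\<close>
    have gm[measurable]: "g \<in> borel_measurable borel"
    proof (rule borel_measurableI_greater)
      fix a :: real
      have "{x \<in> space borel. a < g x} = ({x. a < \<kappa> x} - \<Union>(nb ` Fs)) \<union> \<Union>(nb ` {D \<in> Fs. a < \<kappa> (q D)})"
      proof (rule set_eqI)
        fix x
        show "x \<in> {x \<in> space borel. a < g x} \<longleftrightarrow>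
          x \<in> ({x. a < \<kappa> x} - \<Union>(nb ` Fs)) \<union> \<Union>(nb ` {D \<in> Fs. a < \<kappa> (q D)})"
        proof (cases "\<exists>D\<in>Fs. x \<in> nb D")
          case True
          then obtain D where D: "D \<in> Fs" "x \<in> nb D" by blast
          have "a < \<kappa> (q D)" if "x \<in> \<Union>(nb ` {D \<in> Fs. a < \<kappa> (q D)})"
          proof -
            from that obtain D' where D': "D' \<in> Fs" "x \<in> nb D'" "a < \<kappa> (q D')" by blast
            have "D' = D" by (rule nb_disj[OF D'(1) D(1) D'(2) D(2)])
            then show ?thesis using D'(3) by simp
          qed
          moreover have "x \<in> \<Union>(nb ` {D \<in> Fs. a < \<kappa> (q D)})" if "a < \<kappa> (q D)"
            using D that by blast
          moreover have "g x = \<kappa> (q D)" by (simp add: g_def p_in[OF D])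
          moreover have "x \<in> \<Union>(nb ` Fs)" using D by blast
          ultimately show ?thesis by (simp only: mem_Collect_eq Un_iff Diff_iff space_borel) blast
        next
          case False
          then have "g x = \<kappa> x" by (simp add: g_def p_def)
          then show ?thesis using False by auto
        qed
      qed
      moreover have "{x. a < \<kappa> x} \<in> sets borel"
        by (intro borel_open open_Collect_less continuous_on_const \<kappa>c)
      moreover have "\<Union>(nb ` S) \<in> sets borel" for S
        by (intro borel_open open_Union) (auto intro: nb_open)
      ultimately show "{x \<in> space borel. a < g x} \<in> sets borel"
        by (metis (no_types, lifting) sets.Un sets.Diff)
    qed
    define b where "b = 7 / 16 * R + m"
    define box where "box s = cbox (\<chi> i. - s) (\<chi> i::'n. s)" for s :: real
    have box: "x \<in> box s \<longleftrightarrow> (\<forall>i. \<bar>x $ i\<bar> \<le> s)" for x s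
    proof -
      have "(- s \<le> t \<and> t \<le> s) \<longleftrightarrow> \<bar>t\<bar> \<le> s" for t :: real by (auto simp: abs_if)
      then show ?thesis by (simp add: box_def mem_box_cart)
    qed
    have g0: "g x = 0" if x: "x \<notin> box b" for x
    proof -
      obtain i where "\<bar>x $ i\<bar> > b" using x by (auto simp: box not_le)
      then have "infnorm x > b" using component_le_infnorm_cart[of x i] by linarith
      moreover have "\<bar>infnorm (p x) - infnorm x\<bar> \<le> m"
        using absdiff_infnorm[of "p x" x] infnorm_le_norm[of "p x - x"] p_near[of x] by linarith
      ultimately have "infnorm (p x) > 7 / 16 * R" by (simp add: b_def)
      then have "8 * infnorm (p x) / R > 7 / 2" using R' by (simp add: field_simps)
      then show ?thesis by (simp add: g_def \<kappa>_def)
    qed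
    have gi: "integrable lborel g"
    proof (rule Bochner_Integration.integrable_bound)
      show "integrable lborel (indicator (box b) :: real^'n \<Rightarrow> real)"
        by (intro integrable_indicator_compact) (simp add: box_def compact_cbox)
      show "AE x in lborel. norm (g x) \<le> norm (indicator (box b) x :: real)"
        using g0 g01 by (intro AE_I2) (auto simp: indicator_def)
    qed measurable
    define \<phi> where "\<phi> = conv \<rho> g"
    \<comment> \<open>Lipschitz up to an additive error: 2 m accounts for the displacement of the
      two points.\<close>
    have gdiff: "\<bar>g x - g y\<bar> \<le> 8 / R * (norm (x - y) + 2 * m)" for x y
    proof -
      have "norm (p x - p y) \<le> norm (p x - x) + norm (x - y) + norm (p y - y)"
        using norm_triangle_ineq[of "(p x - x) + (x - y)" "y - p y"] norm_triangle_ineq[of "p x - x" "x - y"]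
        by (simp add: norm_minus_commute)
      also have "\<dots> \<le> norm (x - y) + 2 * m" using p_near[of x] p_near[of y] by linarith
      finally have "8 / R * norm (p x - p y) \<le> 8 / R * (norm (x - y) + 2 * m)"
        using R' by (intro mult_left_mono) auto
      then show ?thesis using \<kappa>lip[of "p x" "p y"] by (simp add: g_def)
    qed
    have "test_fun (cube R) \<phi>"
    proof (rule test_funI)
      show "smooth_fun \<phi>" unfolding \<phi>_def by (intro smooth_fun_conv \<rho> gi)
      show "compact (box (b + \<epsilon>))" by (simp add: box_def compact_cbox)
      show "box (b + \<epsilon>) \<subseteq> cube R"
      proof
        fix x assume "x \<in> box (b + \<epsilon>)"
        moreover have "b + \<epsilon> < R / 2" using R' by (simp add: b_def)
        ultimately show "x \<in> cube R" unfolding box cube_def mem_Collect_eq by (meson order.strict_trans1)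
      qed
      fix x assume "x \<notin> box (b + \<epsilon>)"
      then obtain i where i: "\<bar>x $ i\<bar> > b + \<epsilon>" by (auto simp: box not_le)
      show "\<phi> x = 0" unfolding \<phi>_def
      proof (rule conv_outside[OF \<rho>(3) g0])
        fix y assume "y \<in> box b"
        then have "\<bar>y $ i\<bar> \<le> b" by (simp add: box)
        then have "\<bar>(x - y) $ i\<bar> \<ge> \<epsilon>" using i by simp
        then show "norm (x - y) \<ge> \<epsilon>" using component_le_norm_cart[of "x - y" i] by linarith
      qed
    qed
    moreover have "\<phi> x = 1" if x: "x \<in> cube (R / 2)" for x
    proof -
      have "infnorm x \<le> R / 4"
        unfolding infnorm_cart using x by (intro cSup_least) (auto simp: cube_def intro: less_imp_le)
      have g1: "g y = 1" if "norm (x - y) < \<epsilon>" for y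
      proof -
        have "\<bar>infnorm (p y) - infnorm y\<bar> \<le> m"
          using absdiff_infnorm[of "p y" y] infnorm_le_norm[of "p y - y"] p_near[of y] by linarith
        moreover have "\<bar>infnorm x - infnorm y\<bar> \<le> \<epsilon>"
          using absdiff_infnorm[of x y] infnorm_le_norm[of "x - y"] that by linarith
        ultimately have "infnorm (p y) \<le> 5 / 16 * R"
          using \<open>infnorm x \<le> R / 4\<close> R' by linarith
        then have "8 * infnorm (p y) / R \<le> 5 / 2" using R' by (simp add: field_simps)
        then show ?thesis by (simp add: g_def \<kappa>_def)
      qed
      have "conv \<rho> g x = 1 * (LINT x|lborel. \<rho> x)"
        by (rule conv_eq_const[where \<epsilon> = \<epsilon>]) (use \<rho>(1,3) g1 in auto)
      then show ?thesis by (simp add: \<phi>_def \<rho>)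
    qed
    moreover have "\<exists>c. \<forall>x\<in>D. \<phi> x = c" if D: "D \<in> Fs" for D
    proof (intro exI ballI)
      fix x assume x: "x \<in> D"
      have "conv \<rho> g x = \<kappa> (q D) * (LINT x|lborel. \<rho> x)"
      proof (rule conv_eq_const[where \<epsilon> = \<epsilon>])
        show "test_fun UNIV \<rho>" by (rule \<rho>(1))
        show "\<rho> z = 0" if "\<epsilon> \<le> norm z" for z using that by (rule \<rho>(3))
        fix y assume "norm (x - y) < \<epsilon>"
        then have "y \<in> nb D" using x by (auto simp: nb_def dist_norm)
        then show "g y = \<kappa> (q D)" by (simp add: g_def p_in[OF D])
      qed
      then show "\<phi> x = \<kappa> (q D)" by (simp add: \<phi>_def \<rho>)
    qed
    moreover have "\<bar>pd i \<phi> x\<bar> \<le> L / R" for x i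
    proof -
      note tp = test_fun_pd[OF \<rho>(1), of i]
      have [measurable]: "pd i \<rho> \<in> borel_measurable borel" by (rule test_fun_borel[OF tp])
      have ts: "tsupport \<rho> \<subseteq> cball 0 \<epsilon>"
        by (rule compact_tsupport_subset) (auto intro: \<rho>(3))
      have ir: "integrable lborel (\<lambda>y. pd i \<rho> (x - y))"
        using lborel_integral_reflect(2)[of "pd i \<rho>" x] test_fun_integrable[OF tp] by simp
      have z: "(LINT y|lborel. pd i \<rho> (x - y)) = 0"
        using lborel_integral_reflect(1)[of "pd i \<rho>" x] integral_pd_eq_0[OF \<rho>(1,3) \<epsilon>, of i] by simp
      note ic = conv_integrable[OF tp gi, of x]
      have "pd i \<phi> x = (LINT y|lborel. pd i \<rho> (x - y) * g y)"
        by (simp add: \<phi>_def pd_conv[OF \<rho>(1) gi] conv_def)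
      \<comment> \<open>Subtracting \<open>g x\<close> costs nothing, as the derivative of \<rho>
        has integral zero. What remains is the oscillation of \<open>g\<close> over a ball of radius
        \<epsilon>, which is of order 1 / R.\<close>
      also have "\<dots> = (LINT y|lborel. pd i \<rho> (x - y) * g y - pd i \<rho> (x - y) * g x)"
        using ic ir z by simp
      finally have eq: "pd i \<phi> x = (LINT y|lborel. pd i \<rho> (x - y) * g y - pd i \<rho> (x - y) * g x)" .
      have "\<bar>pd i \<phi> x\<bar> \<le> (LINT y|lborel. (8 / R * (\<epsilon> + 2 * m)) * \<bar>pd i \<rho> (x - y)\<bar>)"
        unfolding eq
      proof (rule integral_abs_bound_integral)
        show "integrable lborel (\<lambda>y. pd i \<rho> (x - y) * g y - pd i \<rho> (x - y) * g x)"
          using ic ir by auto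
        show "integrable lborel (\<lambda>y. (8 / R * (\<epsilon> + 2 * m)) * \<bar>pd i \<rho> (x - y)\<bar>)"
          using ir by auto
        fix y
        show "\<bar>pd i \<rho> (x - y) * g y - pd i \<rho> (x - y) * g x\<bar> \<le> (8 / R * (\<epsilon> + 2 * m)) * \<bar>pd i \<rho> (x - y)\<bar>"
        proof (cases "norm (x - y) \<le> \<epsilon>")
          case True
          have "\<bar>g y - g x\<bar> \<le> 8 / R * (norm (y - x) + 2 * m)" by (rule gdiff)
          also have "\<dots> \<le> 8 / R * (\<epsilon> + 2 * m)"
            using True R' by (intro mult_left_mono) (auto simp: norm_minus_commute)
          finally have "\<bar>pd i \<rho> (x - y)\<bar> * \<bar>g y - g x\<bar> \<le> \<bar>pd i \<rho> (x - y)\<bar> * (8 / R * (\<epsilon> + 2 * m))"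
            by (intro mult_left_mono) auto
          moreover have "pd i \<rho> (x - y) * g y - pd i \<rho> (x - y) * g x = pd i \<rho> (x - y) * (g y - g x)"
            by (rule right_diff_distrib[symmetric])
          ultimately show ?thesis by (simp only: abs_mult mult.commute)
        next
          case False
          then have "pd i \<rho> (x - y) = 0" using ts by (intro pd_outside_tsupport) auto
          then show ?thesis by simp
        qed
      qed
      also have "\<dots> = (8 / R * (\<epsilon> + 2 * m)) * (LINT y|lborel. \<bar>pd i \<rho> y\<bar>)"
        using lborel_integral_reflect(1)[of "\<lambda>y. \<bar>pd i \<rho> y\<bar>" x] by simp
      also have "\<dots> \<le> (8 / R * (\<epsilon> + 2 * m)) * J"
        unfolding J_def using R' \<epsilon> m
        by (intro mult_left_mono member_le_sum) auto
      also have "\<dots> = L / R" by (simp add: L_def)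
      finally show ?thesis .
    qed
    ultimately show ?thesis by blast
  qed
  moreover have "L \<ge> 0" using J \<epsilon> m by (simp add: L_def)
  ultimately show ?thesis using that R0 by blast
qed

subsection \<open>Borel representatives\<close>

text \<open>The notions are stated for \<open>lebesgue\<close>, whereas Fubini and the translation
  arguments run on Borel functions and \<open>lborel\<close>. This lemma carries measurability,
  integrability and integrals across.\<close>

lemma lebesgue_AE_eq_borel:
  fixes F F' :: "'a::euclidean_space \<Rightarrow> real"
  assumes F': "F' \<in> borel_measurable borel" and eq: "AE x in lebesgue. F x = F' x"
  shows "F \<in> borel_measurable lebesgue" "integrable lebesgue F \<longleftrightarrow> integrable lborel F'"
    "integral\<^sup>L lebesgue F = integral\<^sup>L lborel F'"
proof -
  have m: "F' \<in> borel_measurable lebesgue" using F' by (simp add: measurable_completion)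
  have "AE x in lebesgue. F' x = F x" using eq by (auto elim: AE_mp)
  then show mF: "F \<in> borel_measurable lebesgue" by (rule borel_measurable_AE[OF m])
  have "integrable lebesgue F \<longleftrightarrow> integrable lebesgue F'"
    by (rule integrable_cong_AE[OF mF m eq])
  then show "integrable lebesgue F \<longleftrightarrow> integrable lborel F'"
    using F' by (simp add: integrable_completion)
  have "integral\<^sup>L lebesgue F = integral\<^sup>L lebesgue F'"
    by (rule integral_cong_AE[OF mF m eq])
  then show "integral\<^sup>L lebesgue F = integral\<^sup>L lborel F'"
    using F' by (simp add: integral_completion)
qed

lemma L2_on_component:
  fixes f :: "real^'n::finite \<Rightarrow> 'b::euclidean_space" and c :: "'b \<Rightarrow> real"
  assumes f: "L2_on \<Omega> f" and c: "linear c" "\<And>y. \<bar>c y\<bar> \<le> norm y"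
  obtains f' where "f' \<in> borel_measurable borel" "integrable lborel (\<lambda>x. (f' x)\<^sup>2)"
    "AE x in lebesgue. indicator \<Omega> x * c (f x) = f' x"
proof -
  have m: "(\<lambda>x. indicator \<Omega> x *\<^sub>R f x) \<in> borel_measurable lebesgue"
    and i: "integrable lebesgue (\<lambda>x. indicator \<Omega> x *\<^sub>R (norm (f x))\<^sup>2)"
    using f by (auto simp: L2_on_def set_borel_measurable_def set_integrable_def)
  have "c \<in> borel_measurable borel"
    using c(1) by (intro borel_measurable_continuous_onI linear_continuous_on linear_conv_bounded_linear[THEN iffD1])
  from measurable_compose[OF m this]
  have mc: "(\<lambda>x. indicator \<Omega> x * c (f x)) \<in> borel_measurable lebesgue"
    by (simp add: linear_cmul[OF c(1)])
  then obtain f' where f': "f' \<in> borel_measurable lborel" "AE x in lborel. indicator \<Omega> x * c (f x) = f' x"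
    using completion_ex_borel_measurable_real by blast
  then have ae: "AE x in lebesgue. indicator \<Omega> x * c (f x) = f' x" by (intro AE_completion)
  have isq: "integrable lebesgue (\<lambda>x. (indicator \<Omega> x * c (f x))\<^sup>2)"
  proof (rule Bochner_Integration.integrable_bound[OF i])
    show "(\<lambda>x. (indicator \<Omega> x * c (f x))\<^sup>2) \<in> borel_measurable lebesgue" using mc by measurable
    have "(c y)\<^sup>2 \<le> (norm y)\<^sup>2" for y using c(2)[of y] by (metis abs_le_square_iff abs_norm_cancel)
    then show "AE x in lebesgue. norm ((indicator \<Omega> x * c (f x))\<^sup>2) \<le> norm (indicator \<Omega> x *\<^sub>R (norm (f x))\<^sup>2)"
      by (intro AE_I2) (auto simp: indicator_def)
  qed
  have aesq: "AE x in lebesgue. (indicator \<Omega> x * c (f x))\<^sup>2 = (f' x)\<^sup>2"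
    using ae by eventually_elim simp
  have "(\<lambda>x. (f' x)\<^sup>2) \<in> borel_measurable borel" using f'(1) by measurable
  from lebesgue_AE_eq_borel(2)[OF this aesq] isq
  have int: "integrable lborel (\<lambda>x. (f' x)\<^sup>2)" by (rule iffD1)
  show ?thesis by (rule that[OF _ int ae]) (use f'(1) in simp)
qed

text \<open>The indicator of \<Omega> is absorbed into the representatives, which thus extend the
  function and its gradient by zero up to a null set. Integrals over \<Omega> become integrals over
  the whole space, and the weak derivative relation is retained for test functions supported in
  \<Omega>.\<close>

lemma H1_borel_representative:
  fixes u :: "real^'n::finite \<Rightarrow> real^'n"
  assumes u: "H1 \<Omega> u G"
  obtains U V where
    "\<And>\<alpha>. U \<alpha> \<in> borel_measurable borel" "\<And>\<alpha>. integrable lborel (\<lambda>x. (U \<alpha> x)\<^sup>2)"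
    "\<And>\<alpha> i. V \<alpha> i \<in> borel_measurable borel" "\<And>\<alpha> i. integrable lborel (\<lambda>x. (V \<alpha> i x)\<^sup>2)"
    "AE x in lebesgue. (\<forall>\<alpha>. indicator \<Omega> x * u x $ \<alpha> = U \<alpha> x) \<and> (\<forall>\<alpha> i. indicator \<Omega> x * G x $ \<alpha> $ i = V \<alpha> i x)"
    "\<And>\<phi> \<alpha> i. test_fun \<Omega> \<phi> \<Longrightarrow> (LINT x|lborel. U \<alpha> x * pd i \<phi> x) = - (LINT x|lborel. V \<alpha> i x * \<phi> x)"
proof -
  have l: "linear (\<lambda>y::real^'n. y $ \<alpha>)" "linear (\<lambda>y::real^'n^'n. y $ \<alpha> $ i)" for \<alpha> i
    by (auto intro!: linearI)
  have n: "\<bar>y $ \<alpha>\<bar> \<le> norm y" "\<bar>M $ \<alpha> $ i\<bar> \<le> norm M" for y :: "real^'n" and M :: "real^'n^'n" and \<alpha> i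
    using component_le_norm_cart[of y \<alpha>] order_trans[OF component_le_norm_cart[of "M $ \<alpha>" i] Finite_Cartesian_Product.norm_nth_le[of M \<alpha>]]
    by auto
  have Lu: "L2_on \<Omega> u" and LG: "L2_on \<Omega> G" using u by (auto simp: H1_def)
  define repr where "repr h W \<longleftrightarrow> W \<in> borel_measurable borel \<and> integrable lborel (\<lambda>x. (W x)\<^sup>2) \<and>
     (AE x in lebesgue. indicator \<Omega> x * h x = W x)" for h W :: "real^'n \<Rightarrow> real"
  define U where "U \<alpha> = (SOME W. repr (\<lambda>x. u x $ \<alpha>) W)" for \<alpha>
  define V where "V \<alpha> i = (SOME W. repr (\<lambda>x. G x $ \<alpha> $ i) W)" for \<alpha> i
  have "\<exists>W. repr (\<lambda>x. u x $ \<alpha>) W" for \<alpha>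
    unfolding repr_def by (rule L2_on_component[OF Lu l(1)[of \<alpha>] n(1)[where \<alpha> = \<alpha>]]) blast
  then have "repr (\<lambda>x. u x $ \<alpha>) (U \<alpha>)" for \<alpha> unfolding U_def by (rule someI_ex)
  then have U: "U \<alpha> \<in> borel_measurable borel" "integrable lborel (\<lambda>x. (U \<alpha> x)\<^sup>2)"
     "AE x in lebesgue. indicator \<Omega> x * u x $ \<alpha> = U \<alpha> x" for \<alpha>
    unfolding repr_def by blast+
  have "\<exists>W. repr (\<lambda>x. G x $ \<alpha> $ i) W" for \<alpha> i
    unfolding repr_def by (rule L2_on_component[OF LG l(2)[of \<alpha> i] n(2)[where \<alpha> = \<alpha> and i = i]]) blast
  then have "repr (\<lambda>x. G x $ \<alpha> $ i) (V \<alpha> i)" for \<alpha> i unfolding V_def by (rule someI_ex)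
  then have V: "V \<alpha> i \<in> borel_measurable borel" "integrable lborel (\<lambda>x. (V \<alpha> i x)\<^sup>2)"
     "AE x in lebesgue. indicator \<Omega> x * G x $ \<alpha> $ i = V \<alpha> i x" for \<alpha> i
    unfolding repr_def by blast+
  show ?thesis
  proof
    show "AE x in lebesgue. (\<forall>\<alpha>. indicator \<Omega> x * u x $ \<alpha> = U \<alpha> x) \<and> (\<forall>\<alpha> i. indicator \<Omega> x * G x $ \<alpha> $ i = V \<alpha> i x)"
      using U(3) V(3) by (simp add: AE_all_countable)
    fix \<phi> \<alpha> i assume t: "test_fun \<Omega> \<phi>"
    note [measurable] = U(1) V(1) test_fun_borel[OF t] test_fun_borel[OF test_fun_pd[OF t, of i]]
    have 1: "(LINT x:\<Omega>|lebesgue. u x $ \<alpha> * pd i \<phi> x) = (LINT x|lborel. U \<alpha> x * pd i \<phi> x)"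
      unfolding set_lebesgue_integral_def
    proof (rule lebesgue_AE_eq_borel(3))
      show "AE x in lebesgue. indicator \<Omega> x *\<^sub>R (u x $ \<alpha> * pd i \<phi> x) = U \<alpha> x * pd i \<phi> x"
        using U(3)[of \<alpha>] by eventually_elim (simp only: real_scaleR_def mult.assoc[symmetric])
    qed measurable
    have 2: "(LINT x:\<Omega>|lebesgue. G x $ \<alpha> $ i * \<phi> x) = (LINT x|lborel. V \<alpha> i x * \<phi> x)"
      unfolding set_lebesgue_integral_def
    proof (rule lebesgue_AE_eq_borel(3))
      show "AE x in lebesgue. indicator \<Omega> x *\<^sub>R (G x $ \<alpha> $ i * \<phi> x) = V \<alpha> i x * \<phi> x"
        using V(3)[of \<alpha> i] by eventually_elim (simp only: real_scaleR_def mult.assoc[symmetric])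
    qed measurable
    have "(LINT x:\<Omega>|lebesgue. u x $ \<alpha> * pd i \<phi> x) = - (LINT x:\<Omega>|lebesgue. G x $ \<alpha> $ i * \<phi> x)"
      using u t by (auto simp: H1_def weak_grad_def)
    then show "(LINT x|lborel. U \<alpha> x * pd i \<phi> x) = - (LINT x|lborel. V \<alpha> i x * \<phi> x)"
      by (simp add: 1 2)
  qed (use U V in auto)
qed

subsection \<open>Products with cutoff functions\<close>

text \<open>For smooth \<eta> of arbitrary support, \<open>\<zeta> \<eta>\<close> is a test function
  on \<Omega>. The product, extended by zero, therefore has a weak derivative on the whole space
  that can be tested with all smooth functions, as mollification requires.\<close>

lemma product_weak_derivative:
  fixes U :: "real^'n::finite \<Rightarrow> real"
  assumes U: "U \<in> borel_measurable borel" "integrable lborel (\<lambda>x. (U x)\<^sup>2)"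
    and V: "V \<in> borel_measurable borel" "integrable lborel (\<lambda>x. (V x)\<^sup>2)"
    and w: "\<And>\<phi>. test_fun \<Omega> \<phi> \<Longrightarrow> (LINT x|lborel. U x * pd i \<phi> x) = - (LINT x|lborel. V x * \<phi> x)"
    and z: "test_fun \<Omega> \<zeta>" and e: "smooth_fun \<eta>"
  shows "(LINT x|lborel. (\<zeta> x * U x) * pd i \<eta> x) = - (LINT x|lborel. (\<zeta> x * V x + pd i \<zeta> x * U x) * \<eta> x)"
proof -
  have t: "test_fun \<Omega> (\<lambda>x. \<zeta> x * \<eta> x)" "test_fun \<Omega> (\<lambda>x. pd i \<zeta> x * \<eta> x)" "test_fun \<Omega> (\<lambda>x. \<zeta> x * pd i \<eta> x)"
    by (intro test_fun_mult_smooth z e test_fun_pd smooth_fun_pd)+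
  have I: "integrable lborel (\<lambda>x. W x * \<phi> x)" if "test_fun \<Omega> \<phi>" "W \<in> borel_measurable borel" "integrable lborel (\<lambda>x. (W x)\<^sup>2)"
    for W \<phi> :: "real^'n \<Rightarrow> real"
    using that test_fun_borel[OF that(1)] test_fun_square_integrable[OF that(1)]
    by (intro integrable_mult_L2) auto
  have "pd i (\<lambda>x. \<zeta> x * \<eta> x) x = \<zeta> x * pd i \<eta> x + pd i \<zeta> x * \<eta> x" for x
    using z e by (intro pd_mult smooth_fun_differentiable) (auto simp: test_fun_def)
  then have "- (LINT x|lborel. V x * (\<zeta> x * \<eta> x)) = (LINT x|lborel. U x * (\<zeta> x * pd i \<eta> x) + U x * (pd i \<zeta> x * \<eta> x))"
    using w[OF t(1)] by (simp add: distrib_left)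
  also have "\<dots> = (LINT x|lborel. U x * (\<zeta> x * pd i \<eta> x)) + (LINT x|lborel. U x * (pd i \<zeta> x * \<eta> x))"
    using I[OF t(3) U] I[OF t(2) U] by simp
  finally have "(LINT x|lborel. U x * (\<zeta> x * pd i \<eta> x))
      = - ((LINT x|lborel. V x * (\<zeta> x * \<eta> x)) + (LINT x|lborel. U x * (pd i \<zeta> x * \<eta> x)))" by simp
  also have "\<dots> = - (LINT x|lborel. V x * (\<zeta> x * \<eta> x) + U x * (pd i \<zeta> x * \<eta> x))"
    using I[OF t(1) V] I[OF t(2) U] by simp
  finally show ?thesis by (simp add: mult_ac distrib_left distrib_right)
qed

lemma product_L2:
  assumes z: "test_fun \<Omega> \<zeta>" and U: "U \<in> borel_measurable borel" "integrable lborel (\<lambda>x. (U x)\<^sup>2)"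
  shows "(\<lambda>x. \<zeta> x * U x) \<in> borel_measurable borel" "integrable lborel (\<lambda>x. (\<zeta> x * U x)\<^sup>2)"
proof -
  have [measurable]: "\<zeta> \<in> borel_measurable borel" "U \<in> borel_measurable borel"
    using U test_fun_borel[OF z] by auto
  show "(\<lambda>x. \<zeta> x * U x) \<in> borel_measurable borel" by measurable
  have "test_fun \<Omega> (\<lambda>x. \<zeta> x * \<zeta> x)" using z by (intro test_fun_mult_smooth) (auto simp: test_fun_def)
  from integrable_test_fun_mult[OF this U(2)]
  show "integrable lborel (\<lambda>x. (\<zeta> x * U x)\<^sup>2)" by (simp add: power2_eq_square mult_ac)
qed

text \<open>These approximants serve twice: they witness membership of a product in
  \<open>H1_0\<close>, and they justify the exchange of directions in Korn's inequality.\<close>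

lemma product_approximation:
  fixes U :: "'n::finite \<Rightarrow> real^'n \<Rightarrow> real"
  assumes \<Omega>: "open \<Omega>" and z: "test_fun \<Omega> \<zeta>"
    and U: "\<And>\<alpha>. U \<alpha> \<in> borel_measurable borel" "\<And>\<alpha>. integrable lborel (\<lambda>x. (U \<alpha> x)\<^sup>2)"
    and V: "\<And>\<alpha> i. V \<alpha> i \<in> borel_measurable borel" "\<And>\<alpha> i. integrable lborel (\<lambda>x. (V \<alpha> i x)\<^sup>2)"
    and w: "\<And>\<phi> \<alpha> i. test_fun \<Omega> \<phi> \<Longrightarrow> (LINT x|lborel. U \<alpha> x * pd i \<phi> x) = - (LINT x|lborel. V \<alpha> i x * \<phi> x)"
  obtains \<psi> :: "'n \<Rightarrow> nat \<Rightarrow> real^'n \<Rightarrow> real" where "\<And>\<alpha> n. test_fun \<Omega> (\<psi> \<alpha> n)"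
    "\<And>\<alpha>. (\<lambda>n. LINT x|lborel. (\<psi> \<alpha> n x - \<zeta> x * U \<alpha> x)\<^sup>2) \<longlonglongrightarrow> 0"
    "\<And>\<alpha> i. (\<lambda>n. LINT x|lborel. (pd i (\<psi> \<alpha> n) x - (\<zeta> x * V \<alpha> i x + pd i \<zeta> x * U \<alpha> x))\<^sup>2) \<longlonglongrightarrow> 0"
proof -
  define approx where "approx \<alpha> \<psi> \<longleftrightarrow> (\<forall>n. test_fun \<Omega> (\<psi> n)) \<and>
    (\<lambda>n. LINT x|lborel. (\<psi> n x - \<zeta> x * U \<alpha> x)\<^sup>2) \<longlonglongrightarrow> 0 \<and>
    (\<forall>i. (\<lambda>n. LINT x|lborel. (pd i (\<psi> n) x - (\<zeta> x * V \<alpha> i x + pd i \<zeta> x * U \<alpha> x))\<^sup>2) \<longlonglongrightarrow> 0)"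
    for \<alpha> and \<psi> :: "nat \<Rightarrow> real^'n \<Rightarrow> real"
  define \<psi> where "\<psi> \<alpha> = (SOME \<psi>. approx \<alpha> \<psi>)" for \<alpha>
  have "\<exists>\<psi>. approx \<alpha> \<psi>" for \<alpha>
  proof -
    note PU = product_L2[OF z U(1) U(2), of \<alpha>] and PV = product_L2[OF z V(1) V(2), of \<alpha>]
      and PD = product_L2[OF test_fun_pd[OF z] U(1) U(2), of _ \<alpha>]
    have K: "compact (tsupport \<zeta>)" "tsupport \<zeta> \<subseteq> \<Omega>" using z by (auto simp: test_fun_def)
    obtain \<psi> :: "nat \<Rightarrow> real^'n \<Rightarrow> real" where "\<And>n. test_fun \<Omega> (\<psi> n)"
      "(\<lambda>n. LINT x|lborel. (\<psi> n x - \<zeta> x * U \<alpha> x)\<^sup>2) \<longlonglongrightarrow> 0"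
      "\<And>i. (\<lambda>n. LINT x|lborel. (pd i (\<psi> n) x - (\<zeta> x * V \<alpha> i x + pd i \<zeta> x * U \<alpha> x))\<^sup>2) \<longlonglongrightarrow> 0"
    proof (rule weak_derivative_approximation[OF \<Omega> K PU, where g = "\<lambda>i x. \<zeta> x * V \<alpha> i x + pd i \<zeta> x * U \<alpha> x"])
      show "\<zeta> x * U \<alpha> x = 0" if "x \<notin> tsupport \<zeta>" for x using tsupport_outside[OF that] by simp
      show "(\<lambda>x. \<zeta> x * V \<alpha> i x + pd i \<zeta> x * U \<alpha> x) \<in> borel_measurable borel" for i
        using PV(1) PD(1) by (intro borel_measurable_add)
      show "integrable lborel (\<lambda>x. (\<zeta> x * V \<alpha> i x + pd i \<zeta> x * U \<alpha> x)\<^sup>2)" for i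
        using PV PD by (intro integrable_add_square) auto
      show "\<zeta> x * V \<alpha> i x + pd i \<zeta> x * U \<alpha> x = 0" if "x \<notin> tsupport \<zeta>" for i x
        using tsupport_outside[OF that] pd_outside_tsupport[OF that] by simp
      show "(LINT x|lborel. \<zeta> x * U \<alpha> x * pd i \<eta> x) = - (LINT x|lborel. (\<zeta> x * V \<alpha> i x + pd i \<zeta> x * U \<alpha> x) * \<eta> x)"
        if "smooth_fun \<eta>" for i \<eta>
        by (rule product_weak_derivative[OF U(1) U(2) V(1) V(2) w z that])
    qed (rule that)
    then show ?thesis unfolding approx_def by blast
  qed
  then have "approx \<alpha> (\<psi> \<alpha>)" for \<alpha> unfolding \<psi>_def by (rule someI_ex)
  then have "\<And>\<alpha> n. test_fun \<Omega> (\<psi> \<alpha> n)"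
    "\<And>\<alpha>. (\<lambda>n. LINT x|lborel. (\<psi> \<alpha> n x - \<zeta> x * U \<alpha> x)\<^sup>2) \<longlonglongrightarrow> 0"
    "\<And>\<alpha> i. (\<lambda>n. LINT x|lborel. (pd i (\<psi> \<alpha> n) x - (\<zeta> x * V \<alpha> i x + pd i \<zeta> x * U \<alpha> x))\<^sup>2) \<longlonglongrightarrow> 0"
    unfolding approx_def by blast+
  then show ?thesis by (rule that)
qed

lemma norm_square_vec: "(norm (x :: real^'n::finite))\<^sup>2 = (\<Sum>i\<in>UNIV. (x $ i)\<^sup>2)"
  by (simp add: norm_vec_def L2_set_def sum_nonneg)

lemma norm_square_mat: "(norm (M :: real^'n::finite^'m::finite))\<^sup>2 = (\<Sum>\<alpha>\<in>UNIV. \<Sum>i\<in>UNIV. (M $ \<alpha> $ i)\<^sup>2)"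
  by (simp add: norm_vec_def L2_set_def sum_nonneg)

lemma borel_measurable_vecI:
  fixes f :: "'a \<Rightarrow> real^'n::finite"
  assumes "\<And>i. (\<lambda>x. f x $ i) \<in> borel_measurable M"
  shows "f \<in> borel_measurable M"
  unfolding borel_measurable_euclidean_space[of f]
  using assms by (auto simp: Basis_vec_def inner_axis)

lemma borel_measurable_matI:
  fixes f :: "'a \<Rightarrow> real^'n::finite^'m::finite"
  assumes "\<And>\<alpha> i. (\<lambda>x. f x $ \<alpha> $ i) \<in> borel_measurable M"
  shows "f \<in> borel_measurable M"
  unfolding borel_measurable_euclidean_space[of f]
  using assms by (auto simp: Basis_vec_def inner_axis)

lemma L2_on_from_components:
  fixes f :: "real^'n::finite \<Rightarrow> 'b::euclidean_space"
  assumes m: "(\<lambda>x. indicator \<Omega> x *\<^sub>R f x) \<in> borel_measurable lebesgue"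
    and eq: "AE x in lebesgue. indicator \<Omega> x * (norm (f x))\<^sup>2 = F x"
    and F: "F \<in> borel_measurable borel" "integrable lborel F"
  shows "L2_on \<Omega> f"
proof -
  have "integrable lebesgue (\<lambda>x. indicator \<Omega> x * (norm (f x))\<^sup>2)"
    using lebesgue_AE_eq_borel(2)[OF F(1) eq] F(2) by blast
  then show ?thesis using m by (simp add: L2_on_def set_borel_measurable_def set_integrable_def)
qed

lemma H1_0_product:
  fixes u :: "real^'n::finite \<Rightarrow> real^'n"
  assumes \<Omega>: "open \<Omega>" and u: "H1 \<Omega> u G" and z: "test_fun \<Omega> \<zeta>"
  shows "H1_0 \<Omega> (\<lambda>x. \<zeta> x *\<^sub>R u x) (\<lambda>x. \<chi> \<alpha> i. \<zeta> x * G x $ \<alpha> $ i + pd i \<zeta> x * u x $ \<alpha>)"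
    (is "H1_0 \<Omega> ?v ?G")
proof -
  obtain U V where U: "\<And>\<alpha>. U \<alpha> \<in> borel_measurable borel" "\<And>\<alpha>. integrable lborel (\<lambda>x. (U \<alpha> x)\<^sup>2)"
    and V: "\<And>\<alpha> i. V \<alpha> i \<in> borel_measurable borel" "\<And>\<alpha> i. integrable lborel (\<lambda>x. (V \<alpha> i x)\<^sup>2)"
    and ae: "AE x in lebesgue. (\<forall>\<alpha>. indicator \<Omega> x * u x $ \<alpha> = U \<alpha> x) \<and> (\<forall>\<alpha> i. indicator \<Omega> x * G x $ \<alpha> $ i = V \<alpha> i x)"
    and w: "\<And>\<phi> \<alpha> i. test_fun \<Omega> \<phi> \<Longrightarrow> (LINT x|lborel. U \<alpha> x * pd i \<phi> x) = - (LINT x|lborel. V \<alpha> i x * \<phi> x)"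
    by (rule H1_borel_representative[OF u]) (rule that)
  obtain \<psi> where \<psi>: "\<And>\<alpha> n. test_fun \<Omega> (\<psi> \<alpha> n)"
    "\<And>\<alpha>. (\<lambda>n. LINT x|lborel. (\<psi> \<alpha> n x - \<zeta> x * U \<alpha> x)\<^sup>2) \<longlonglongrightarrow> 0"
    "\<And>\<alpha> i. (\<lambda>n. LINT x|lborel. (pd i (\<psi> \<alpha> n) x - (\<zeta> x * V \<alpha> i x + pd i \<zeta> x * U \<alpha> x))\<^sup>2) \<longlonglongrightarrow> 0"
  proof (rule product_approximation[where U = U and V = V, OF \<Omega> z U V])
    show "(LINT x|lborel. U \<alpha> x * pd i \<phi> x) = - (LINT x|lborel. V \<alpha> i x * \<phi> x)" if "test_fun \<Omega> \<phi>" for \<phi> \<alpha> i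
      by (rule w[OF that])
  qed (rule that)
  define f where "f \<alpha> x = \<zeta> x * U \<alpha> x" for \<alpha> x
  define g where "g \<alpha> i x = \<zeta> x * V \<alpha> i x + pd i \<zeta> x * U \<alpha> x" for \<alpha> i x
  have f: "f \<alpha> \<in> borel_measurable borel" "integrable lborel (\<lambda>x. (f \<alpha> x)\<^sup>2)" for \<alpha>
    unfolding f_def using product_L2[OF z U(1) U(2)] by auto
  have g: "g \<alpha> i \<in> borel_measurable borel" "integrable lborel (\<lambda>x. (g \<alpha> i x)\<^sup>2)" for \<alpha> i
  proof -
    note P = product_L2[OF z V(1) V(2), of \<alpha> i] product_L2[OF test_fun_pd[OF z, of i] U(1) U(2), of \<alpha>]
    show "g \<alpha> i \<in> borel_measurable borel" unfolding g_def using P by (intro borel_measurable_add)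
    show "integrable lborel (\<lambda>x. (g \<alpha> i x)\<^sup>2)" unfolding g_def using P by (intro integrable_add_square) auto
  qed
  note [measurable] = f(1) g(1) test_fun_borel[OF \<psi>(1)] test_fun_borel[OF test_fun_pd[OF \<psi>(1)]]
  have aef: "AE x in lebesgue. (\<forall>\<alpha>. indicator \<Omega> x * ?v x $ \<alpha> = f \<alpha> x) \<and> (\<forall>\<alpha> i. indicator \<Omega> x * ?G x $ \<alpha> $ i = g \<alpha> i x)"
    using ae
  proof eventually_elim
    case (elim x)
    have "U \<alpha> x = indicator \<Omega> x * u x $ \<alpha>" "V \<alpha> i x = indicator \<Omega> x * G x $ \<alpha> $ i" for \<alpha> i
      using elim by auto
    then show ?case by (simp add: f_def g_def algebra_simps)
  qed
  \<comment> \<open>Everything vanishes off \<Omega>, so the L2 errors over \<Omega> are whole-space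
    integrals, for which convergence is known.\<close>
  have fz: "f \<alpha> x = 0 \<and> g \<alpha> i x = 0 \<and> \<psi> \<alpha> n x = 0 \<and> pd i (\<psi> \<alpha> n) x = 0" if "x \<notin> \<Omega>" for \<alpha> i x n
  proof -
    have "x \<notin> tsupport \<zeta>" "x \<notin> tsupport (\<psi> \<alpha> n)" using that z \<psi>(1)[of \<alpha> n] by (auto simp: test_fun_def)
    then show ?thesis
      by (simp add: f_def g_def tsupport_outside pd_outside_tsupport)
  qed
  have "L2_on \<Omega> ?v"
  proof (rule L2_on_from_components[where F = "\<lambda>x. \<Sum>\<alpha>\<in>UNIV. (f \<alpha> x)\<^sup>2"])
    show "(\<lambda>x. indicator \<Omega> x *\<^sub>R ?v x) \<in> borel_measurable lebesgue"
    proof (rule borel_measurable_vecI)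
      fix \<alpha>
      have "AE x in lebesgue. (indicator \<Omega> x *\<^sub>R ?v x) $ \<alpha> = f \<alpha> x"
        using aef by eventually_elim (simp add: mult.assoc)
      then show "(\<lambda>x. (indicator \<Omega> x *\<^sub>R ?v x) $ \<alpha>) \<in> borel_measurable lebesgue"
        by (rule lebesgue_AE_eq_borel(1)[OF f(1)])
    qed
    show "AE x in lebesgue. indicator \<Omega> x * (norm (?v x))\<^sup>2 = (\<Sum>\<alpha>\<in>UNIV. (f \<alpha> x)\<^sup>2)"
      using aef
    proof eventually_elim
      case (elim x)
      then have "f \<alpha> x = indicator \<Omega> x * ?v x $ \<alpha>" for \<alpha> by simp
      then show ?case
        unfolding norm_square_vec by (simp add: sum_distrib_left power_mult_distrib indicator_def)
    qed
    show "integrable lborel (\<lambda>x. \<Sum>\<alpha>\<in>UNIV. (f \<alpha> x)\<^sup>2)" using f(2) by simp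
  qed measurable
  moreover have "L2_on \<Omega> ?G"
  proof (rule L2_on_from_components[where F = "\<lambda>x. \<Sum>\<alpha>\<in>UNIV. \<Sum>i\<in>UNIV. (g \<alpha> i x)\<^sup>2"])
    show "(\<lambda>x. indicator \<Omega> x *\<^sub>R ?G x) \<in> borel_measurable lebesgue"
    proof (rule borel_measurable_matI)
      fix \<alpha> i
      have "AE x in lebesgue. (indicator \<Omega> x *\<^sub>R ?G x) $ \<alpha> $ i = g \<alpha> i x"
        using aef by eventually_elim (simp add: mult.assoc)
      then show "(\<lambda>x. (indicator \<Omega> x *\<^sub>R ?G x) $ \<alpha> $ i) \<in> borel_measurable lebesgue"
        by (rule lebesgue_AE_eq_borel(1)[OF g(1)])
    qed
    show "AE x in lebesgue. indicator \<Omega> x * (norm (?G x))\<^sup>2 = (\<Sum>\<alpha>\<in>UNIV. \<Sum>i\<in>UNIV. (g \<alpha> i x)\<^sup>2)"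
      using aef
    proof eventually_elim
      case (elim x)
      then have "g \<alpha> i x = indicator \<Omega> x * ?G x $ \<alpha> $ i" for \<alpha> i by simp
      then show ?case
        unfolding norm_square_mat by (simp add: sum_distrib_left power_mult_distrib indicator_def)
    qed
    show "integrable lborel (\<lambda>x. \<Sum>\<alpha>\<in>UNIV. \<Sum>i\<in>UNIV. (g \<alpha> i x)\<^sup>2)" using g(2) by simp
  qed measurable
  moreover have "weak_grad \<Omega> ?v ?G"
    unfolding weak_grad_def
  proof (intro allI impI)
    fix \<eta> \<alpha> i assume t: "test_fun \<Omega> \<eta>"
    then have s: "smooth_fun \<eta>" by (simp add: test_fun_def)
    note [measurable] = test_fun_borel[OF t] test_fun_borel[OF test_fun_pd[OF t, of i]]
    have 1: "(LINT x:\<Omega>|lebesgue. ?v x $ \<alpha> * pd i \<eta> x) = (LINT x|lborel. f \<alpha> x * pd i \<eta> x)"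
      unfolding set_lebesgue_integral_def
    proof (rule lebesgue_AE_eq_borel(3))
      show "AE x in lebesgue. indicator \<Omega> x *\<^sub>R (?v x $ \<alpha> * pd i \<eta> x) = f \<alpha> x * pd i \<eta> x"
        using aef
      proof eventually_elim
        case (elim x)
        then have fx: "f \<alpha> x = indicator \<Omega> x * ?v x $ \<alpha>" by simp
        show ?case unfolding fx by (simp only: real_scaleR_def mult.assoc)
      qed
    qed measurable
    have 2: "(LINT x:\<Omega>|lebesgue. ?G x $ \<alpha> $ i * \<eta> x) = (LINT x|lborel. g \<alpha> i x * \<eta> x)"
      unfolding set_lebesgue_integral_def
    proof (rule lebesgue_AE_eq_borel(3))
      show "AE x in lebesgue. indicator \<Omega> x *\<^sub>R (?G x $ \<alpha> $ i * \<eta> x) = g \<alpha> i x * \<eta> x"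
        using aef
      proof eventually_elim
        case (elim x)
        then have gx: "g \<alpha> i x = indicator \<Omega> x * ?G x $ \<alpha> $ i" by simp
        show ?case unfolding gx by (simp only: real_scaleR_def mult.assoc)
      qed
    qed measurable
    have "(LINT x|lborel. f \<alpha> x * pd i \<eta> x) = - (LINT x|lborel. g \<alpha> i x * \<eta> x)"
      unfolding f_def g_def by (rule product_weak_derivative[OF U(1) U(2) V(1) V(2) w z s])
    then show "(LINT x:\<Omega>|lebesgue. ?v x $ \<alpha> * pd i \<eta> x) = - (LINT x:\<Omega>|lebesgue. ?G x $ \<alpha> $ i * \<eta> x)"
      unfolding 1 2 .
  qed
  moreover have "(\<lambda>n. LINT x:\<Omega>|lebesgue. (norm ((\<chi> \<alpha>. \<psi> \<alpha> n x) - ?v x))\<^sup>2) \<longlonglongrightarrow> 0"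
  proof -
    have eq: "(LINT x:\<Omega>|lebesgue. (norm ((\<chi> \<alpha>. \<psi> \<alpha> n x) - ?v x))\<^sup>2) = (\<Sum>\<alpha>\<in>UNIV. LINT x|lborel. (\<psi> \<alpha> n x - f \<alpha> x)\<^sup>2)" for n
    proof -
      have "(LINT x:\<Omega>|lebesgue. (norm ((\<chi> \<alpha>. \<psi> \<alpha> n x) - ?v x))\<^sup>2) = (LINT x|lborel. (\<Sum>\<alpha>\<in>UNIV. (\<psi> \<alpha> n x - f \<alpha> x)\<^sup>2))"
        unfolding set_lebesgue_integral_def
      proof (rule lebesgue_AE_eq_borel(3))
        show "AE x in lebesgue. indicator \<Omega> x *\<^sub>R (norm ((\<chi> \<alpha>. \<psi> \<alpha> n x) - ?v x))\<^sup>2 = (\<Sum>\<alpha>\<in>UNIV. (\<psi> \<alpha> n x - f \<alpha> x)\<^sup>2)"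
          using aef
        proof eventually_elim
          case (elim x)
          then have fx: "f \<alpha> x = indicator \<Omega> x * ?v x $ \<alpha>" for \<alpha> by simp
          show ?case
          proof (cases "x \<in> \<Omega>")
            case True
            then show ?thesis unfolding norm_square_vec by (simp add: fx)
          next
            case False
            then show ?thesis using fz[OF False] by simp
          qed
        qed
      qed measurable
      also have "\<dots> = (\<Sum>\<alpha>\<in>UNIV. LINT x|lborel. (\<psi> \<alpha> n x - f \<alpha> x)\<^sup>2)"
        by (intro Bochner_Integration.integral_sum integrable_add_square(2) test_fun_square_integrable[OF \<psi>(1)] f(2)) measurable
      finally show ?thesis .
    qed
    have "(\<lambda>n. \<Sum>\<alpha>\<in>UNIV. LINT x|lborel. (\<psi> \<alpha> n x - f \<alpha> x)\<^sup>2) \<longlonglongrightarrow> (\<Sum>\<alpha>\<in>(UNIV :: 'n set). 0)"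
      unfolding f_def by (intro tendsto_sum \<psi>(2))
    then show ?thesis unfolding eq by simp
  qed
  moreover have "(\<lambda>n. LINT x:\<Omega>|lebesgue. (norm (cgrad (\<lambda>x. \<chi> \<alpha>. \<psi> \<alpha> n x) x - ?G x))\<^sup>2) \<longlonglongrightarrow> 0"
  proof -
    have eq: "(LINT x:\<Omega>|lebesgue. (norm (cgrad (\<lambda>x. \<chi> \<alpha>. \<psi> \<alpha> n x) x - ?G x))\<^sup>2)
        = (\<Sum>\<alpha>\<in>UNIV. \<Sum>i\<in>UNIV. LINT x|lborel. (pd i (\<psi> \<alpha> n) x - g \<alpha> i x)\<^sup>2)" for n
    proof -
      have "(LINT x:\<Omega>|lebesgue. (norm (cgrad (\<lambda>x. \<chi> \<alpha>. \<psi> \<alpha> n x) x - ?G x))\<^sup>2)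
          = (LINT x|lborel. (\<Sum>\<alpha>\<in>UNIV. \<Sum>i\<in>UNIV. (pd i (\<psi> \<alpha> n) x - g \<alpha> i x)\<^sup>2))"
        unfolding set_lebesgue_integral_def
      proof (rule lebesgue_AE_eq_borel(3))
        show "AE x in lebesgue. indicator \<Omega> x *\<^sub>R (norm (cgrad (\<lambda>x. \<chi> \<alpha>. \<psi> \<alpha> n x) x - ?G x))\<^sup>2
            = (\<Sum>\<alpha>\<in>UNIV. \<Sum>i\<in>UNIV. (pd i (\<psi> \<alpha> n) x - g \<alpha> i x)\<^sup>2)"
          using aef
        proof eventually_elim
          case (elim x)
          then have gx: "g \<alpha> i x = indicator \<Omega> x * ?G x $ \<alpha> $ i" for \<alpha> i by simp
          show ?case
          proof (cases "x \<in> \<Omega>")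
            case True
            then show ?thesis unfolding norm_square_mat by (simp add: gx cgrad_def)
          next
            case False
            then show ?thesis using fz[OF False] by simp
          qed
        qed
      qed measurable
      also have "\<dots> = (\<Sum>\<alpha>\<in>UNIV. LINT x|lborel. (\<Sum>i\<in>UNIV. (pd i (\<psi> \<alpha> n) x - g \<alpha> i x)\<^sup>2))"
        by (intro Bochner_Integration.integral_sum Bochner_Integration.integrable_sum integrable_add_square(2)
            test_fun_square_integrable[OF test_fun_pd[OF \<psi>(1)]] g(2)) measurable
      also have "\<dots> = (\<Sum>\<alpha>\<in>UNIV. \<Sum>i\<in>UNIV. LINT x|lborel. (pd i (\<psi> \<alpha> n) x - g \<alpha> i x)\<^sup>2)"
        by (intro sum.cong refl Bochner_Integration.integral_sum integrable_add_square(2)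
            test_fun_square_integrable[OF test_fun_pd[OF \<psi>(1)]] g(2)) measurable
      finally show ?thesis .
    qed
    have "(\<lambda>n. \<Sum>\<alpha>\<in>UNIV. \<Sum>i\<in>UNIV. LINT x|lborel. (pd i (\<psi> \<alpha> n) x - g \<alpha> i x)\<^sup>2) \<longlonglongrightarrow> (\<Sum>\<alpha>\<in>(UNIV :: 'n set). \<Sum>i\<in>(UNIV :: 'n set). 0)"
      unfolding g_def by (intro tendsto_sum \<psi>(3))
    then show ?thesis unfolding eq by simp
  qed
  moreover have "\<forall>n \<alpha>. test_fun \<Omega> (\<lambda>x. (\<chi> \<alpha>. \<psi> \<alpha> n x) $ \<alpha>)" using \<psi>(1) by simp
  ultimately show ?thesis
    unfolding H1_0_def H1_def by (intro conjI exI[of _ "\<lambda>n x. \<chi> \<alpha>. \<psi> \<alpha> n x"])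
qed

text \<open>All components have test functions as approximants, so directions may be exchanged
  between any two of them. Compact support of \<zeta> removes boundary terms, which is why the
  constant 2 does not depend on \<Omega>.\<close>

lemma Korn_product:
  fixes U :: "'n::finite \<Rightarrow> real^'n \<Rightarrow> real"
  assumes \<Omega>: "open \<Omega>" and z: "test_fun \<Omega> \<zeta>"
    and U: "\<And>\<alpha>. U \<alpha> \<in> borel_measurable borel" "\<And>\<alpha>. integrable lborel (\<lambda>x. (U \<alpha> x)\<^sup>2)"
    and V: "\<And>\<alpha> i. V \<alpha> i \<in> borel_measurable borel" "\<And>\<alpha> i. integrable lborel (\<lambda>x. (V \<alpha> i x)\<^sup>2)"
    and w: "\<And>\<phi> \<alpha> i. test_fun \<Omega> \<phi> \<Longrightarrow> (LINT x|lborel. U \<alpha> x * pd i \<phi> x) = - (LINT x|lborel. V \<alpha> i x * \<phi> x)"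
    and H: "\<And>\<alpha> i. H \<alpha> i = (\<lambda>x. \<zeta> x * V \<alpha> i x + pd i \<zeta> x * U \<alpha> x)"
  shows "\<And>\<alpha> i. H \<alpha> i \<in> borel_measurable borel" "\<And>\<alpha> i. integrable lborel (\<lambda>x. (H \<alpha> i x)\<^sup>2)"
    "(LINT x|lborel. (\<Sum>\<alpha>\<in>UNIV. \<Sum>i\<in>UNIV. (H \<alpha> i x)\<^sup>2))
     \<le> 2 * (LINT x|lborel. (\<Sum>\<alpha>\<in>UNIV. \<Sum>i\<in>UNIV. ((H \<alpha> i x + H i \<alpha> x) / 2)\<^sup>2))"
proof -
  obtain \<psi> where \<psi>: "\<And>\<alpha> n. test_fun \<Omega> (\<psi> \<alpha> n)"
    "\<And>\<alpha>. (\<lambda>n. LINT x|lborel. (\<psi> \<alpha> n x - \<zeta> x * U \<alpha> x)\<^sup>2) \<longlonglongrightarrow> 0"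
    "\<And>\<alpha> i. (\<lambda>n. LINT x|lborel. (pd i (\<psi> \<alpha> n) x - (\<zeta> x * V \<alpha> i x + pd i \<zeta> x * U \<alpha> x))\<^sup>2) \<longlonglongrightarrow> 0"
  proof (rule product_approximation[where U = U and V = V, OF \<Omega> z U V])
    show "(LINT x|lborel. U \<alpha> x * pd i \<phi> x) = - (LINT x|lborel. V \<alpha> i x * \<phi> x)" if "test_fun \<Omega> \<phi>" for \<phi> \<alpha> i
      by (rule w[OF that])
  qed (rule that)
  have m: "H \<alpha> i \<in> borel_measurable borel" for \<alpha> i
    unfolding H using product_L2(1)[OF z V(1) V(2)] product_L2(1)[OF test_fun_pd[OF z] U(1) U(2)]
    by (intro borel_measurable_add)
  have i: "integrable lborel (\<lambda>x. (H \<alpha> i x)\<^sup>2)" for \<alpha> i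
    unfolding H using product_L2[OF z V(1) V(2)] product_L2[OF test_fun_pd[OF z] U(1) U(2)]
    by (intro integrable_add_square) auto
  show "H \<alpha> i \<in> borel_measurable borel" "integrable lborel (\<lambda>x. (H \<alpha> i x)\<^sup>2)" for \<alpha> i by (rule m i)+
  have "(LINT x|lborel. H \<alpha> i x * H \<beta> j x) = (LINT x|lborel. H \<alpha> j x * H \<beta> i x)" for \<alpha> \<beta> i j
    by (rule weak_derivative_swap[where \<psi> = "\<psi> \<alpha>" and \<psi>' = "\<psi> \<beta>"])
      (use m i \<psi>(3) test_fun_UNIV[OF \<psi>(1)] in \<open>auto simp: H\<close>)
  then show "(LINT x|lborel. (\<Sum>\<alpha>\<in>UNIV. \<Sum>i\<in>UNIV. (H \<alpha> i x)\<^sup>2))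
     \<le> 2 * (LINT x|lborel. (\<Sum>\<alpha>\<in>UNIV. \<Sum>i\<in>UNIV. ((H \<alpha> i x + H i \<alpha> x) / 2)\<^sup>2))"
    using m i by (intro Korn_from_swap) auto
qed

subsection \<open>The energy identity\<close>

definition sym_mat :: "real^'n::finite^'n \<Rightarrow> real^'n^'n" where
  "sym_mat P = (1 / 2) *\<^sub>R (P + transpose P)"

lemma sym_mat_nth: "sym_mat P $ \<alpha> $ i = (P $ \<alpha> $ i + P $ i $ \<alpha>) / 2"
  by (simp add: sym_mat_def transpose_def)

lemma transpose_sym_mat: "transpose (sym_mat P) = sym_mat P"
  by (simp add: vec_eq_iff transpose_def sym_mat_nth add.commute)

lemma Aform_linear_right: "Aform a x P (c *\<^sub>R Q + d *\<^sub>R Q') = c * Aform a x P Q + d * Aform a x P Q'"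
  by (simp add: Aform_def sum_distrib_left sum.distrib[symmetric] algebra_simps)

lemma Aform_commute:
  assumes "\<And>i j \<alpha> \<beta>. a x i j \<alpha> \<beta> = a x j i \<beta> \<alpha>"
  shows "Aform a x P Q = Aform a x Q P"
proof -
  have "Aform a x P Q = (\<Sum>i\<in>UNIV. \<Sum>j\<in>UNIV. \<Sum>\<alpha>\<in>UNIV. \<Sum>\<beta>\<in>UNIV. a x j i \<beta> \<alpha> * Q $ \<alpha> $ i * P $ \<beta> $ j)"
    unfolding Aform_def
  proof (intro sum.cong refl)
    fix i j \<alpha> \<beta>
    show "a x i j \<alpha> \<beta> * P $ \<beta> $ j * Q $ \<alpha> $ i = a x j i \<beta> \<alpha> * Q $ \<alpha> $ i * P $ \<beta> $ j"
      by (subst assms) (simp add: mult_ac)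
  qed
  also have "\<dots> = (\<Sum>j\<in>UNIV. \<Sum>i\<in>UNIV. \<Sum>\<alpha>\<in>UNIV. \<Sum>\<beta>\<in>UNIV. a x j i \<beta> \<alpha> * Q $ \<alpha> $ i * P $ \<beta> $ j)"
    by (rule sum.swap)
  also have "\<dots> = (\<Sum>j\<in>UNIV. \<Sum>i\<in>UNIV. \<Sum>\<beta>\<in>UNIV. \<Sum>\<alpha>\<in>UNIV. a x j i \<beta> \<alpha> * Q $ \<alpha> $ i * P $ \<beta> $ j)"
    by (rule sum.cong[OF refl], rule sum.cong[OF refl], rule sum.swap)
  finally show ?thesis by (simp add: Aform_def)
qed

lemma Aform_transpose_right:
  assumes "\<And>i j \<alpha> \<beta>. a x i j \<alpha> \<beta> = a x \<alpha> j i \<beta>"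
  shows "Aform a x P (transpose Q) = Aform a x P Q"
proof -
  have "Aform a x P (transpose Q) = (\<Sum>i\<in>UNIV. \<Sum>j\<in>UNIV. \<Sum>\<alpha>\<in>UNIV. \<Sum>\<beta>\<in>UNIV. a x \<alpha> j i \<beta> * P $ \<beta> $ j * Q $ i $ \<alpha>)"
    unfolding Aform_def
  proof (intro sum.cong refl)
    fix i j \<alpha> \<beta>
    show "a x i j \<alpha> \<beta> * P $ \<beta> $ j * transpose Q $ \<alpha> $ i = a x \<alpha> j i \<beta> * P $ \<beta> $ j * Q $ i $ \<alpha>"
      by (subst assms) (simp add: transpose_def)
  qed
  also have "\<dots> = (\<Sum>j\<in>UNIV. \<Sum>i\<in>UNIV. \<Sum>\<alpha>\<in>UNIV. \<Sum>\<beta>\<in>UNIV. a x \<alpha> j i \<beta> * P $ \<beta> $ j * Q $ i $ \<alpha>)"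
    by (rule sum.swap)
  also have "\<dots> = (\<Sum>j\<in>UNIV. \<Sum>\<alpha>\<in>UNIV. \<Sum>i\<in>UNIV. \<Sum>\<beta>\<in>UNIV. a x \<alpha> j i \<beta> * P $ \<beta> $ j * Q $ i $ \<alpha>)"
    by (rule sum.cong[OF refl], rule sum.swap)
  also have "\<dots> = (\<Sum>\<alpha>\<in>UNIV. \<Sum>j\<in>UNIV. \<Sum>i\<in>UNIV. \<Sum>\<beta>\<in>UNIV. a x \<alpha> j i \<beta> * P $ \<beta> $ j * Q $ i $ \<alpha>)"
    by (rule sum.swap)
  finally show ?thesis by (simp add: Aform_def)
qed

text \<open>The symmetry under exchange of i and \<alpha> treats the second argument; the symmetry
  of the form swaps the arguments and reduces the first to the second. Ellipticity, available on
  symmetric matrices, thereby reaches full gradients through their symmetric parts.\<close>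

lemma Aform_sym_mat:
  assumes c: "\<And>i j \<alpha> \<beta>. a x i j \<alpha> \<beta> = a x j i \<beta> \<alpha>" and t: "\<And>i j \<alpha> \<beta>. a x i j \<alpha> \<beta> = a x \<alpha> j i \<beta>"
  shows "Aform a x (sym_mat P) (sym_mat Q) = Aform a x P Q"
proof -
  have r: "Aform a x P (sym_mat Q) = Aform a x P Q" for P Q
    using Aform_linear_right[of a x P "1 / 2" Q "1 / 2" "transpose Q"] Aform_transpose_right[where a = a and x = x and P = P and Q = Q, OF t]
    by (simp add: sym_mat_def scaleR_add_right)
  have "Aform a x (sym_mat P) (sym_mat Q) = Aform a x (sym_mat P) Q" by (rule r)
  also have "\<dots> = Aform a x Q (sym_mat P)" by (rule Aform_commute) (rule c)
  also have "\<dots> = Aform a x Q P" by (rule r)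
  also have "\<dots> = Aform a x P Q" by (rule Aform_commute) (rule c)
  finally show ?thesis .
qed

text \<open>Completing the square: with \<open>B = u \<otimes> \<nabla>\<phi>\<close>, the bilinear form at
  \<open>(\<nabla>u, \<nabla>(\<phi>\<^sup>2 u))\<close> equals the quadratic form at \<open>\<phi> \<nabla>u + B = \<nabla>(\<phi> u)\<close> minus the one at \<open>B\<close>.\<close>

lemma Aform_energy:
  assumes a: "admissible_coeff \<kappa>1 \<kappa>2 a"
  shows "\<kappa>1 * (norm (sym_mat (\<phi> *\<^sub>R P + B)))\<^sup>2
    \<le> Aform a x P (\<phi>\<^sup>2 *\<^sub>R P + (2 * \<phi>) *\<^sub>R B) + \<kappa>2 * (norm (sym_mat B))\<^sup>2"
proof -
  have c: "\<And>i j \<alpha> \<beta>. a x i j \<alpha> \<beta> = a x j i \<beta> \<alpha>" and t: "\<And>i j \<alpha> \<beta>. a x i j \<alpha> \<beta> = a x \<alpha> j i \<beta>"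
    using a unfolding admissible_coeff_def by blast+
  have q: "(\<Sum>i\<in>UNIV. \<Sum>j\<in>UNIV. \<Sum>\<alpha>\<in>UNIV. \<Sum>\<beta>\<in>UNIV. a x i j \<alpha> \<beta> * \<xi> $ \<alpha> $ i * \<xi> $ \<beta> $ j) = Aform a x \<xi> \<xi>" for \<xi>
    unfolding Aform_def by (intro sum.cong refl) (simp add: mult_ac)
  have ell: "\<kappa>1 * (norm (sym_mat Q))\<^sup>2 \<le> Aform a x Q Q" "Aform a x Q Q \<le> \<kappa>2 * (norm (sym_mat Q))\<^sup>2" for Q
  proof -
    have "\<kappa>1 * (norm \<xi>)\<^sup>2 \<le> Aform a x \<xi> \<xi> \<and> Aform a x \<xi> \<xi> \<le> \<kappa>2 * (norm \<xi>)\<^sup>2" if "transpose \<xi> = \<xi>" for \<xi>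
      using a[unfolded admissible_coeff_def, THEN conjunct2, THEN conjunct2, THEN conjunct2, THEN conjunct2,
          THEN spec[of _ x], THEN spec[of _ \<xi>], THEN mp, OF that]
      unfolding q .
    from this[OF transpose_sym_mat[of Q]]
    show "\<kappa>1 * (norm (sym_mat Q))\<^sup>2 \<le> Aform a x Q Q" "Aform a x Q Q \<le> \<kappa>2 * (norm (sym_mat Q))\<^sup>2"
      using Aform_sym_mat[where a = a and x = x, OF c t] by simp_all
  qed
  have R: "Aform a x Z (\<phi> *\<^sub>R P + B) = \<phi> * Aform a x Z P + Aform a x Z B" for Z
    using Aform_linear_right[of a x Z \<phi> P 1 B] by simp
  have "Aform a x (\<phi> *\<^sub>R P + B) (\<phi> *\<^sub>R P + B) = \<phi> * Aform a x (\<phi> *\<^sub>R P + B) P + Aform a x (\<phi> *\<^sub>R P + B) B"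
    by (rule R)
  also have "Aform a x (\<phi> *\<^sub>R P + B) P = \<phi> * Aform a x P P + Aform a x P B"
    using R[of P] Aform_commute[where a = a and x = x and P = "\<phi> *\<^sub>R P + B" and Q = P, OF c] by simp
  also have "Aform a x (\<phi> *\<^sub>R P + B) B = \<phi> * Aform a x P B + Aform a x B B"
    using R[of B] Aform_commute[where a = a and x = x and P = "\<phi> *\<^sub>R P + B" and Q = B, OF c]
      Aform_commute[where a = a and x = x and P = B and Q = P, OF c] by simp
  also have "\<phi> * (\<phi> * Aform a x P P + Aform a x P B) + (\<phi> * Aform a x P B + Aform a x B B)
      = Aform a x P (\<phi>\<^sup>2 *\<^sub>R P + (2 * \<phi>) *\<^sub>R B) + Aform a x B B"
    unfolding Aform_linear_right by (simp add: power2_eq_square algebra_simps)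
  finally show ?thesis using ell(1)[of "\<phi> *\<^sub>R P + B"] ell(2)[of B] by linarith
qed

text \<open>Convexity of the square splits each symmetrized entry between its two orderings; the
  index left free in the double sum contributes the dimension.\<close>

lemma norm_sym_mat_outer_le:
  fixes u d :: "real^'n::finite"
  assumes d: "\<And>i. \<bar>d $ i\<bar> \<le> c"
  shows "(norm (sym_mat (\<chi> \<alpha> i. d $ i * u $ \<alpha>)))\<^sup>2 \<le> real CARD('n) * c\<^sup>2 * (norm u)\<^sup>2"
proof -
  have "((d $ i * u $ \<alpha> + d $ \<alpha> * u $ i) / 2)\<^sup>2 \<le> c\<^sup>2 * ((u $ \<alpha>)\<^sup>2 / 2 + (u $ i)\<^sup>2 / 2)" for \<alpha> i
  proof -
    have sq: "(d $ j * u $ k)\<^sup>2 \<le> c\<^sup>2 * (u $ k)\<^sup>2" for j k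
    proof -
      have "(d $ j)\<^sup>2 \<le> c\<^sup>2"
        using d[of j] by (metis abs_ge_zero order_trans abs_le_square_iff abs_of_nonneg)
      then show ?thesis by (simp add: power_mult_distrib mult_right_mono)
    qed
    have "((s + t) / 2)\<^sup>2 \<le> (s\<^sup>2 + t\<^sup>2) / 2" for s t :: real
      using zero_le_power2[of "s - t"] by (simp add: power2_eq_square field_simps)
    then have "((d $ i * u $ \<alpha> + d $ \<alpha> * u $ i) / 2)\<^sup>2 \<le> ((d $ i * u $ \<alpha>)\<^sup>2 + (d $ \<alpha> * u $ i)\<^sup>2) / 2" .
    also have "\<dots> \<le> (c\<^sup>2 * (u $ \<alpha>)\<^sup>2 + c\<^sup>2 * (u $ i)\<^sup>2) / 2"
      by (intro divide_right_mono add_mono sq) auto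
    finally show ?thesis by (simp add: field_simps)
  qed
  then have "(norm (sym_mat (\<chi> \<alpha> i. d $ i * u $ \<alpha>)))\<^sup>2
      \<le> (\<Sum>\<alpha>\<in>UNIV. \<Sum>i\<in>UNIV. c\<^sup>2 * ((u $ \<alpha>)\<^sup>2 / 2 + (u $ i)\<^sup>2 / 2))"
    unfolding norm_square_mat by (intro sum_mono) (simp add: sym_mat_nth)
  also have "\<dots> = c\<^sup>2 * ((\<Sum>\<alpha>\<in>(UNIV :: 'n set). \<Sum>i\<in>(UNIV :: 'n set). (u $ \<alpha>)\<^sup>2 / 2) + (\<Sum>\<alpha>\<in>(UNIV :: 'n set). \<Sum>i\<in>(UNIV :: 'n set). (u $ i)\<^sup>2 / 2))"
    by (simp only: sum_distrib_left[symmetric] sum.distrib)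
  also have "\<dots> = real CARD('n) * c\<^sup>2 * (norm u)\<^sup>2"
    by (simp add: norm_square_vec sum_distrib_left[symmetric] sum_divide_distrib[symmetric])
  finally show ?thesis .
qed

section \<open>The Caccioppoli inequality and the final estimate\<close>

lemma open_cube: "open (cube R :: (real^'n::finite) set)"
proof -
  have o: "open {x :: real^'n. \<bar>x $ i\<bar> < R / 2}" for i
    by (intro open_Collect_less continuous_intros)
  have "cube R = (\<Inter>i. {x :: real^'n. \<bar>x $ i\<bar> < R / 2})" by (auto simp: cube_def)
  also have "open \<dots>" using o by (intro open_INT) auto
  finally show ?thesis .
qed

text \<open>Integrating the pointwise energy inequality removes the equation's term and bounds the
  symmetric gradient of \<open>\<phi> u\<close> over the whole space. The factor 2 in the constant
  is Korn's; the dimension comes from the norm of the outer product of \<open>u\<close> with the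
  gradient of \<phi>.\<close>

lemma Caccioppoli:
  fixes u :: "real^'n::finite \<Rightarrow> real^'n"
  assumes a: "admissible_coeff \<kappa>1 \<kappa>2 a" and \<kappa>: "0 < \<kappa>1" "\<kappa>1 \<le> \<kappa>2"
    and \<Omega>: "open \<Omega>" and \<omega>: "open \<omega>" and F: "\<And>D. D \<in> Fs \<Longrightarrow> open D"
    and cover: "negligible (- \<omega> - \<Union>Fs)"
    and sol: "weak_sol_Linf a \<omega> (\<Union>Fs) \<Omega> u G"
    and \<phi>: "test_fun \<Omega> \<phi>" "\<And>x. x \<in> S \<Longrightarrow> \<phi> x = 1" "\<And>x i. \<bar>pd i \<phi> x\<bar> \<le> c"
    and \<phi>F: "\<And>D. D \<in> Fs \<Longrightarrow> \<exists>k. \<forall>x\<in>D. \<phi> x = k"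
    and S: "open S" "S \<subseteq> \<Omega>"
  shows "(LINT x:S|lebesgue. (norm (G x))\<^sup>2)
     \<le> 2 * \<kappa>2 * real CARD('n) * c\<^sup>2 / \<kappa>1 * (LINT x:\<Omega>|lebesgue. (norm (u x))\<^sup>2)"
proof -
  have u: "H1 \<Omega> u G" and rig: "sym_grad_zero_on (\<Omega> \<inter> \<Union>Fs) G"
    and weak: "\<And>v Gv. H1_0 \<Omega> v Gv \<Longrightarrow> sym_grad_zero_on (\<Omega> \<inter> \<Union>Fs) Gv \<Longrightarrow>
        (LINT x:(\<Omega> \<inter> \<omega>)|lebesgue. Aform a x (G x) (Gv x)) = 0"
    using sol unfolding weak_sol_Linf_def by blast+
  obtain U V where U: "\<And>\<alpha>. U \<alpha> \<in> borel_measurable borel" "\<And>\<alpha>. integrable lborel (\<lambda>x. (U \<alpha> x)\<^sup>2)"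
    and V: "\<And>\<alpha> i. V \<alpha> i \<in> borel_measurable borel" "\<And>\<alpha> i. integrable lborel (\<lambda>x. (V \<alpha> i x)\<^sup>2)"
    and ae: "AE x in lebesgue. (\<forall>\<alpha>. indicator \<Omega> x * u x $ \<alpha> = U \<alpha> x) \<and> (\<forall>\<alpha> i. indicator \<Omega> x * G x $ \<alpha> $ i = V \<alpha> i x)"
    and w: "\<And>\<phi> \<alpha> i. test_fun \<Omega> \<phi> \<Longrightarrow> (LINT x|lborel. U \<alpha> x * pd i \<phi> x) = - (LINT x|lborel. V \<alpha> i x * \<phi> x)"
    by (rule H1_borel_representative[OF u]) (rule that)
  define um where "um x = (\<chi> \<alpha>. U \<alpha> x)" for x
  define Gm where "Gm x = (\<chi> \<alpha> i. V \<alpha> i x)" for x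
  define B where "B x = (\<chi> \<alpha> i. pd i \<phi> x * U \<alpha> x)" for x
  define H where "H \<alpha> i x = \<phi> x * V \<alpha> i x + pd i \<phi> x * U \<alpha> x" for \<alpha> i x
  define Hm where "Hm x = \<phi> x *\<^sub>R Gm x + B x" for x
  define W where "W x = (\<phi> x)\<^sup>2 *\<^sub>R Gm x + (2 * \<phi> x) *\<^sub>R B x" for x
  have Hm_nth: "Hm x $ \<alpha> $ i = H \<alpha> i x" for x \<alpha> i
    by (simp add: Hm_def H_def Gm_def B_def)
  have aeG: "AE x in lebesgue. x \<in> \<Omega> \<longrightarrow> u x = um x \<and> G x = Gm x"
    using ae by eventually_elim (auto simp: um_def Gm_def vec_eq_iff)
  have ae0: "AE x in lebesgue. x \<notin> \<Omega> \<longrightarrow> um x = 0 \<and> Gm x = 0"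
    using ae by eventually_elim (auto simp: um_def Gm_def vec_eq_iff)
  have \<phi>2: "test_fun \<Omega> (\<lambda>x. \<phi> x * \<phi> x)" using \<phi>(1) by (intro test_fun_mult_smooth) (auto simp: test_fun_def)
  have s\<phi>: "smooth_fun \<phi>" using \<phi>(1) by (simp add: test_fun_def)
  have pd\<phi>2: "pd i (\<lambda>x. \<phi> x * \<phi> x) x = 2 * \<phi> x * pd i \<phi> x" for i x
    using pd_mult[of \<phi> x \<phi> i] smooth_fun_differentiable[OF s\<phi>] by simp
  let ?Gv = "\<lambda>x. \<chi> \<alpha> i. (\<phi> x * \<phi> x) * G x $ \<alpha> $ i + pd i (\<lambda>x. \<phi> x * \<phi> x) x * u x $ \<alpha>"
  have Gv: "AE x in lebesgue. x \<in> \<Omega> \<longrightarrow> ?Gv x = W x"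
    using aeG
    by eventually_elim (auto simp: W_def B_def Gm_def um_def vec_eq_iff pd\<phi>2 power2_eq_square)
  have pdF: "pd i \<phi> x = 0" if "x \<in> \<Union>Fs" for x i
  proof -
    obtain D where D: "D \<in> Fs" "x \<in> D" using \<open>x \<in> \<Union>Fs\<close> by blast
    obtain k where "\<forall>x\<in>D. \<phi> x = k" using \<phi>F[OF D(1)] by blast
    then show ?thesis by (intro pd_locally_const[OF F[OF D(1)] D(2)]) blast
  qed
  \<comment> \<open>On an inclusion the gradient of the cutoff vanishes, which leaves a scalar
    multiple of the antisymmetric matrix \<open>G x\<close>.\<close>
  have "sym_grad_zero_on (\<Omega> \<inter> \<Union>Fs) ?Gv"
    using rig unfolding sym_grad_zero_on_def
  proof eventually_elim
    case (elim x)
    show ?case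
    proof
      assume x: "x \<in> \<Omega> \<inter> \<Union>Fs"
      then have "G x + transpose (G x) = 0" using elim by blast
      then have "G x $ \<alpha> $ i + G x $ i $ \<alpha> = 0" for \<alpha> i by (simp add: vec_eq_iff transpose_def)
      then have "(\<phi> x * \<phi> x) * G x $ \<alpha> $ i + (\<phi> x * \<phi> x) * G x $ i $ \<alpha> = 0" for \<alpha> i
        by (simp add: distrib_left[symmetric])
      then show "?Gv x + transpose (?Gv x) = 0"
        using x by (simp add: vec_eq_iff transpose_def pd\<phi>2 pdF)
    qed
  qed
  then have zero: "(LINT x:(\<Omega> \<inter> \<omega>)|lebesgue. Aform a x (G x) (?Gv x)) = 0"
    by (rule weak[OF H1_0_product[OF \<Omega> u \<phi>2]])
  \<comment> \<open>The integrand of the equation, extended by zero off the soft part. Its integral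
    is 0, and the extension lets a single pointwise inequality hold almost everywhere in
    space.\<close>
  define T where "T x = indicator (\<Omega> \<inter> \<omega>) x * Aform a x (Gm x) (W x)" for x
  have [measurable]: "(\<lambda>x. a x i j \<alpha> \<beta>) \<in> borel_measurable lebesgue" for i j \<alpha> \<beta>
    using a unfolding admissible_coeff_def by blast
  have L: "f \<in> borel_measurable borel \<Longrightarrow> f \<in> borel_measurable lebesgue" for f :: "real^'n \<Rightarrow> real"
    by (simp add: measurable_completion)
  note PV = product_L2[OF \<phi>2 V(1) V(2)] and PD = product_L2[OF test_fun_pd[OF \<phi>2] U(1) U(2)]
  have Wn: "W x $ \<alpha> $ i = (\<phi> x * \<phi> x) * V \<alpha> i x + pd i (\<lambda>x. \<phi> x * \<phi> x) x * U \<alpha> x" for x \<alpha> i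
    by (simp add: W_def Gm_def B_def pd\<phi>2 power2_eq_square)
  have Wi: "(\<lambda>x. W x $ \<alpha> $ i) \<in> borel_measurable borel" "integrable lborel (\<lambda>x. (W x $ \<alpha> $ i)\<^sup>2)" for \<alpha> i
    unfolding Wn using PV PD by (auto intro!: borel_measurable_add integrable_add_square(1))
  have \<Omega>\<omega>: "\<Omega> \<inter> \<omega> \<in> sets borel" using \<Omega> \<omega> by auto
  obtain M where M: "\<And>x i j \<alpha> \<beta>. \<bar>a x i j \<alpha> \<beta>\<bar> \<le> M" using a unfolding admissible_coeff_def by blast
  have Tint: "integrable lebesgue T"
  proof -
    have "integrable lebesgue (\<lambda>x. indicator (\<Omega> \<inter> \<omega>) x * (a x i j \<alpha> \<beta> * V \<beta> j x * W x $ \<alpha> $ i))" for i j \<alpha> \<beta>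
    proof (rule Bochner_Integration.integrable_bound)
      have "integrable lborel (\<lambda>x. V \<beta> j x * W x $ \<alpha> $ i)"
        by (rule integrable_mult_L2) (use V Wi in auto)
      then have "integrable lborel (\<lambda>x. M * \<bar>V \<beta> j x * W x $ \<alpha> $ i\<bar>)" by simp
      then show "integrable lebesgue (\<lambda>x. M * \<bar>V \<beta> j x * W x $ \<alpha> $ i\<bar>)"
        by (subst integrable_completion) auto
      have [measurable]: "V \<beta> j \<in> borel_measurable lebesgue" "(\<lambda>x. W x $ \<alpha> $ i) \<in> borel_measurable lebesgue"
        "(indicator (\<Omega> \<inter> \<omega>) :: real^'n \<Rightarrow> real) \<in> borel_measurable lebesgue"
        using V(1) Wi(1) \<Omega>\<omega> by (auto intro!: L)
      show "(\<lambda>x. indicator (\<Omega> \<inter> \<omega>) x * (a x i j \<alpha> \<beta> * V \<beta> j x * W x $ \<alpha> $ i)) \<in> borel_measurable lebesgue"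
        by measurable
      have "\<bar>a x i j \<alpha> \<beta>\<bar> * \<bar>V \<beta> j x * W x $ \<alpha> $ i\<bar> \<le> \<bar>M\<bar> * \<bar>V \<beta> j x * W x $ \<alpha> $ i\<bar>" for x
        using M[of x i j \<alpha> \<beta>] by (intro mult_right_mono) auto
      then show "AE x in lebesgue. norm (indicator (\<Omega> \<inter> \<omega>) x * (a x i j \<alpha> \<beta> * V \<beta> j x * W x $ \<alpha> $ i))
          \<le> norm (M * \<bar>V \<beta> j x * W x $ \<alpha> $ i\<bar>)"
        by (intro AE_I2) (auto simp: indicator_def abs_mult mult.assoc)
    qed
    then have "integrable lebesgue (\<lambda>x. \<Sum>i\<in>UNIV. \<Sum>j\<in>UNIV. \<Sum>\<alpha>\<in>UNIV. \<Sum>\<beta>\<in>UNIV.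
        indicator (\<Omega> \<inter> \<omega>) x * (a x i j \<alpha> \<beta> * V \<beta> j x * W x $ \<alpha> $ i))"
      by (intro Bochner_Integration.integrable_sum)
    then show ?thesis
      unfolding T_def Aform_def by (simp add: Gm_def sum_distrib_left)
  qed
  have T0: "(LINT x|lebesgue. T x) = 0"
  proof -
    have Tae: "AE x in lebesgue. T x = indicator (\<Omega> \<inter> \<omega>) x *\<^sub>R Aform a x (G x) (?Gv x)"
      using aeG Gv
    proof eventually_elim
      case (elim x)
      then show ?case by (cases "x \<in> \<Omega>") (simp_all add: T_def)
    qed
    have "(LINT x|lebesgue. T x) = (LINT x|lebesgue. indicator (\<Omega> \<inter> \<omega>) x *\<^sub>R Aform a x (G x) (?Gv x))"
      by (rule integral_cong_AE[OF borel_measurable_integrable[OF Tint]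
            borel_measurable_AE[OF borel_measurable_integrable[OF Tint] Tae] Tae])
    then show ?thesis using zero by (simp add: set_lebesgue_integral_def)
  qed
  let ?S = "\<lambda>x. \<Sum>\<alpha>\<in>UNIV. \<Sum>i\<in>UNIV. ((H \<alpha> i x + H i \<alpha> x) / 2)\<^sup>2"
  let ?N = "\<lambda>x. \<Sum>\<alpha>\<in>UNIV. (U \<alpha> x)\<^sup>2"
  have Hfun: "H \<alpha> i = (\<lambda>x. \<phi> x * V \<alpha> i x + pd i \<phi> x * U \<alpha> x)" for \<alpha> i by (simp add: H_def fun_eq_iff)
  note korn = Korn_product[where H = H and U = U and V = V, OF \<Omega> \<phi>(1) U V w Hfun]
  have symS: "(norm (sym_mat (Hm x)))\<^sup>2 = ?S x" for x
    by (simp add: norm_square_mat sym_mat_nth Hm_nth)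
  have Sint: "integrable lborel ?S"
    unfolding power_divide using korn(1,2) by (intro Bochner_Integration.integrable_sum integrable_divide integrable_add_square(1)) auto
  have Nint: "integrable lborel ?N" using U(2) by simp
  \<comment> \<open>Off \<Omega>, and on the inclusions, the symmetric gradient of
    \<open>\<phi> u\<close> and \<open>T\<close> both vanish, so only the nonnegative last term is
    left; on the soft part this is the completed square. The points that remain lie on boundaries of
    inclusions and form a null set.\<close>
  have pointwise: "AE x in lebesgue. \<kappa>1 * ?S x \<le> T x + \<kappa>2 * (real CARD('n) * c\<^sup>2 * ?N x)"
  proof -
    have "AE x in lebesgue. x \<in> \<omega> \<or> x \<in> \<Union>Fs"
    proof (rule AE_I')
      show "- \<omega> - \<Union>Fs \<in> null_sets lebesgue" using cover by (simp add: negligible_iff_null_sets)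
    qed auto
    then show ?thesis using aeG ae0 rig[unfolded sym_grad_zero_on_def]
    proof eventually_elim
      case (elim x)
      have nn: "0 \<le> \<kappa>2 * (real CARD('n) * c\<^sup>2 * ?N x)"
        using \<kappa> by (intro mult_nonneg_nonneg sum_nonneg) auto
      consider "x \<notin> \<Omega>" | "x \<in> \<Omega>" "x \<in> \<omega>" | "x \<in> \<Omega>" "x \<notin> \<omega>" "x \<in> \<Union>Fs" using elim(1) by blast
      then show ?case
      proof cases
        case 1
        then have "U \<alpha> x = 0" "V \<alpha> i x = 0" for \<alpha> i
          using elim(3) by (auto simp: um_def Gm_def vec_eq_iff)
        then show ?thesis using 1 nn by (simp add: H_def T_def)
      next
        case 2
        have "\<kappa>1 * ?S x \<le> T x + \<kappa>2 * (norm (sym_mat (B x)))\<^sup>2"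
          using Aform_energy[OF a, of "\<phi> x" "Gm x" "B x" x] 2 by (simp add: symS[symmetric] Hm_def T_def W_def)
        also have "(norm (sym_mat (B x)))\<^sup>2 \<le> real CARD('n) * c\<^sup>2 * (norm (um x))\<^sup>2"
          using norm_sym_mat_outer_le[of "\<chi> i. pd i \<phi> x" c "um x"] \<phi>(3) by (simp add: B_def um_def)
        also have "(norm (um x))\<^sup>2 = ?N x" by (simp add: norm_square_vec um_def)
        finally show ?thesis using \<kappa> by (simp add: mult_left_mono)
      next
        case 3
        have "G x + transpose (G x) = 0" "G x = Gm x" using elim(2,4) 3 by auto
        then have "V \<alpha> i x + V i \<alpha> x = 0" for \<alpha> i by (simp add: Gm_def vec_eq_iff transpose_def)
        then have "H \<alpha> i x + H i \<alpha> x = 0" for \<alpha> i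
          by (simp add: H_def pdF[OF 3(3)] distrib_left[symmetric])
        then show ?thesis using 3 nn by (simp add: T_def)
      qed
    qed
  qed
  have Sle: "integrable lebesgue (\<lambda>x. \<kappa>1 * ?S x)" "integrable lebesgue (\<lambda>x. T x + \<kappa>2 * (real CARD('n) * c\<^sup>2 * ?N x))"
  proof -
    have "integrable lebesgue ?S"
      by (rule integrable_completion[THEN iffD2, OF _ Sint]) (use borel_measurable_integrable[OF Sint] in simp)
    then show "integrable lebesgue (\<lambda>x. \<kappa>1 * ?S x)" by simp
    have "integrable lebesgue ?N"
      by (rule integrable_completion[THEN iffD2, OF _ Nint]) (use borel_measurable_integrable[OF Nint] in simp)
    then show "integrable lebesgue (\<lambda>x. T x + \<kappa>2 * (real CARD('n) * c\<^sup>2 * ?N x))" using Tint by simp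
  qed
  have "\<kappa>1 * (LINT x|lborel. ?S x) \<le> \<kappa>2 * (real CARD('n) * c\<^sup>2 * (LINT x|lborel. ?N x))"
  proof -
    have 1: "integral\<^sup>L lebesgue ?S = integral\<^sup>L lborel ?S" "integral\<^sup>L lebesgue ?N = integral\<^sup>L lborel ?N"
      using borel_measurable_integrable[OF Sint] borel_measurable_integrable[OF Nint] by (simp_all only: integral_completion)
    have "integrable lebesgue (\<lambda>x. \<kappa>2 * (real CARD('n) * c\<^sup>2 * ?N x))"
      using Bochner_Integration.integrable_diff[OF Sle(2) Tint] by simp
    then have "(LINT x|lebesgue. T x + \<kappa>2 * (real CARD('n) * c\<^sup>2 * ?N x))
        = (LINT x|lebesgue. \<kappa>2 * (real CARD('n) * c\<^sup>2 * ?N x))"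
      using Tint T0 by simp
    then show ?thesis
      using integral_mono_AE[OF Sle pointwise] by (simp only: integral_mult_right_zero 1)
  qed
  then have Sbound: "(LINT x|lborel. ?S x) \<le> \<kappa>2 * real CARD('n) * c\<^sup>2 / \<kappa>1 * (LINT x|lborel. ?N x)"
    using \<kappa> by (simp add: field_simps)
  have Neq: "(LINT x:\<Omega>|lebesgue. (norm (u x))\<^sup>2) = (LINT x|lborel. ?N x)"
    unfolding set_lebesgue_integral_def
  proof (rule lebesgue_AE_eq_borel(3))
    show "?N \<in> borel_measurable borel" using borel_measurable_integrable[OF Nint] by simp
    show "AE x in lebesgue. indicator \<Omega> x *\<^sub>R (norm (u x))\<^sup>2 = ?N x"
      using aeG ae0
    proof eventually_elim
      case (elim x)
      have "?N x = (norm (um x))\<^sup>2" by (simp add: norm_square_vec um_def)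
      then show ?case using elim by (cases "x \<in> \<Omega>") simp_all
    qed
  qed
  let ?H2 = "\<lambda>x. \<Sum>\<alpha>\<in>UNIV. \<Sum>i\<in>UNIV. (H \<alpha> i x)\<^sup>2"
  have H2int: "integrable lborel ?H2" using korn(2) by (intro Bochner_Integration.integrable_sum)
  have "(LINT x:S|lebesgue. (norm (G x))\<^sup>2) \<le> (LINT x|lborel. ?H2 x)"
  proof -
    have SH: "(LINT x:S|lebesgue. (norm (G x))\<^sup>2) = (LINT x|lborel. indicator S x * ?H2 x)"
      unfolding set_lebesgue_integral_def
    proof (rule lebesgue_AE_eq_borel(3))
      show "(\<lambda>x. indicator S x * ?H2 x) \<in> borel_measurable borel"
        using borel_measurable_integrable[OF H2int] S(1) by (intro borel_measurable_times) auto
      show "AE x in lebesgue. indicator S x *\<^sub>R (norm (G x))\<^sup>2 = indicator S x * ?H2 x"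
        using aeG
      proof eventually_elim
        case (elim x)
        show ?case
        proof (cases "x \<in> S")
          case True
          \<comment> \<open>On the open set \<open>S\<close> the cutoff is identically 1, so there
            the gradient of \<open>\<phi> u\<close> is that of \<open>u\<close>.\<close>
          have "pd i \<phi> x = 0" for i by (rule pd_locally_const[OF S(1) True \<phi>(2)])
          then have "?H2 x = (norm (Gm x))\<^sup>2"
            using \<phi>(2)[OF True] by (simp add: norm_square_mat Gm_def H_def)
          then show ?thesis using elim True S(2) by auto
        qed simp
      qed
    qed
    also have "\<dots> \<le> (LINT x|lborel. ?H2 x)"
    proof (rule integral_mono)
      show "integrable lborel (\<lambda>x. indicator S x * ?H2 x)"
        using integrable_mult_indicator[of S lborel ?H2] H2int S(1) by simp
      show "indicator S x * ?H2 x \<le> ?H2 x" for x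
        by (auto simp: indicator_def intro!: sum_nonneg)
    qed (rule H2int)
    finally show ?thesis .
  qed
  also have "\<dots> \<le> 2 * (LINT x|lborel. ?S x)" by (rule korn(3))
  also have "\<dots> \<le> 2 * (\<kappa>2 * real CARD('n) * c\<^sup>2 / \<kappa>1 * (LINT x|lborel. ?N x))"
    using Sbound by simp
  finally show ?thesis by (simp add: Neq)
qed

theorem theorem3p4:
  fixes \<omega> :: "(real^'n::finite) set" and Fs :: "(real^'n) set set"
    and \<kappa>1 \<kappa>2 l :: real
  assumes "CARD('n) \<ge> 2"
    and "open \<omega>" and "connected \<omega>" and "\<not> bounded \<omega>" and "int_periodic_set \<omega>"
    and "- \<omega> = \<Union> (closure ` Fs)"
    and "\<forall>D\<in>Fs. lipschitz_domain D \<and> connected (frontier D)"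
    and "\<forall>D1\<in>Fs. \<forall>D2\<in>Fs. D1 \<noteq> D2 \<longrightarrow> closure D1 \<inter> closure D2 = {}"
    and "\<exists>\<delta>>0. \<forall>D1\<in>Fs. \<forall>D2\<in>Fs. D1 \<noteq> D2 \<longrightarrow> setdist D1 D2 \<ge> \<delta>"
    and "0 < \<kappa>1" and "\<kappa>1 \<le> \<kappa>2" and "1 \<le> l"
  shows "\<exists>C. \<forall>a R u G. admissible_coeff \<kappa>1 \<kappa>2 a \<and> R \<ge> 32 \<and>
            weak_sol_Linf a \<omega> (\<Union>Fs) (cube R) u G \<longrightarrow>
            (LINT x:cube (R/2)|lebesgue. (norm (G x))\<^sup>2)
              \<le> C / R\<^sup>2 * (LINT x:cube R|lebesgue. (norm (u x))\<^sup>2)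
                + C / R powr (2 * l) * (LINT x:cube R|lebesgue. (norm (G x))\<^sup>2)"
proof -
  have dom: "open D \<and> bounded D \<and> connected D \<and> D \<noteq> {} \<and> negligible (frontier D)" if "D \<in> Fs" for D
  proof -
    have D: "lipschitz_domain D" using assms(7) that by blast
    from D[unfolded lipschitz_domain_def] lipschitz_domain_negligible_frontier[OF D]
    show ?thesis by (elim conjE) (intro conjI)
  qed
  obtain \<delta> where \<delta>: "\<delta> > 0" "\<And>D1 D2. D1 \<in> Fs \<Longrightarrow> D2 \<in> Fs \<Longrightarrow> D1 \<noteq> D2 \<Longrightarrow> setdist D1 D2 \<ge> \<delta>"
    using assms(9) by blast
  have sep: "dist x y \<ge> \<delta>" if "D1 \<in> Fs" "D2 \<in> Fs" "D1 \<noteq> D2" "x \<in> D1" "y \<in> D2" for D1 D2 x y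
    using \<delta>(2)[OF that(1-3)] setdist_le_dist[OF that(4,5)] by linarith
  obtain M where M: "\<And>D x y. D \<in> Fs \<Longrightarrow> x \<in> D \<Longrightarrow> y \<in> D \<Longrightarrow> dist x y \<le> M"
    by (rule separated_inclusions_diameter[OF assms(5,6) _ _ \<delta>(1) sep]) (use dom in auto)
  obtain R0 L where L: "L \<ge> 0" "R0 > 0" and cutoff: "\<And>R. R \<ge> R0 \<Longrightarrow> \<exists>\<phi>. test_fun (cube R) \<phi> \<and> (\<forall>x\<in>cube (R / 2). \<phi> x = 1) \<and>
       (\<forall>D\<in>Fs. \<exists>c. \<forall>x\<in>D. \<phi> x = c) \<and> (\<forall>x i. \<bar>pd i \<phi> x\<bar> \<le> L / R)"
  proof (rule cutoff_constant_on_inclusions[where Fs = Fs and M = M, OF \<delta>(1)])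
    show "dist x y \<ge> \<delta>" if "D1 \<in> Fs" "D2 \<in> Fs" "D1 \<noteq> D2" "x \<in> D1" "y \<in> D2" for D1 D2 x y
      by (rule sep[OF that])
    show "dist x y \<le> M" if "D \<in> Fs" "x \<in> D" "y \<in> D" for D x y
      by (rule M[OF that])
  qed (rule that)
  \<comment> \<open>Disjoint open sets form a countable family, so their null boundaries have a null
    union.\<close>
  have null: "negligible (- \<omega> - \<Union>Fs)"
  proof -
    have "countable Fs"
    proof (rule countable_disjoint_open_subsets)
      show "pairwise disjnt Fs"
        using assms(8) closure_subset unfolding pairwise_def disjnt_def by blast
    qed (use dom in auto)
    then have "negligible (\<Union>(frontier ` Fs))"
      using dom by (intro negligible_countable_Union) auto
    moreover have "- \<omega> - \<Union>Fs \<subseteq> \<Union>(frontier ` Fs)"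
      using assms(6) dom by (auto simp: frontier_def interior_open)
    ultimately show ?thesis by (rule negligible_subset)
  qed
  \<comment> \<open>\<open>C1\<close> is the Caccioppoli constant for a cutoff with partial
    derivatives at most L / R. The power of \<open>R0\<close> raises the factor of the second
    integral to at least 1 when R < R0. Both are fixed before the coefficients, \<open>R\<close> and
    \<open>u\<close>, as the claimed dependence of the constant demands.\<close>
  define C1 where "C1 = 2 * \<kappa>2 * real CARD('n) * L\<^sup>2 / \<kappa>1"
  define C where "C = C1 + R0 powr (2 * l)"
  have C1: "C1 \<ge> 0" using assms(10,11) by (simp add: C1_def)
  have C: "C \<ge> C1" "C \<ge> R0 powr (2 * l)" using C1 by (auto simp: C_def)
  show ?thesis
  proof (intro exI[of _ C] allI impI)
    fix a R u G
    assume h: "admissible_coeff \<kappa>1 \<kappa>2 a \<and> R \<ge> 32 \<and> weak_sol_Linf a \<omega> (\<Union>Fs) (cube R) u G"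
    then have a: "admissible_coeff \<kappa>1 \<kappa>2 a" and R: "R \<ge> 32" and sol: "weak_sol_Linf a \<omega> (\<Union>Fs) (cube R) u G"
      by auto
    let ?u = "LINT x:cube R|lebesgue. (norm (u x))\<^sup>2" and ?G = "LINT x:cube R|lebesgue. (norm (G x))\<^sup>2"
    have nn: "?u \<ge> 0" "?G \<ge> 0" by (auto simp: set_lebesgue_integral_def)
    have sub: "cube (R / 2) \<subseteq> (cube R :: (real^'n) set)" 
    proof
      fix x :: "real^'n" assume "x \<in> cube (R / 2)"
      then have x: "\<bar>x $ i\<bar> < R / 2 / 2" for i by (simp add: cube_def)
      have "\<bar>x $ i\<bar> < R / 2" for i using x[of i] R by linarith
      then show "x \<in> cube R" by (simp add: cube_def)
    qed
    show "(LINT x:cube (R/2)|lebesgue. (norm (G x))\<^sup>2) \<le> C / R\<^sup>2 * ?u + C / R powr (2 * l) * ?G"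
    proof (cases "R \<ge> R0")
      case True
      obtain \<phi> where \<phi>: "test_fun (cube R) \<phi> \<and> (\<forall>x\<in>cube (R / 2). \<phi> x = 1) \<and>
          (\<forall>D\<in>Fs. \<exists>c. \<forall>x\<in>D. \<phi> x = c) \<and> (\<forall>x i. \<bar>pd i \<phi> x\<bar> \<le> L / R)"
        using cutoff[OF True] by (elim exE) (rule that)
      note \<phi>2 = conjunct2[OF \<phi>] and \<phi>3 = conjunct2[OF conjunct2[OF \<phi>]]
      have "(LINT x:cube (R/2)|lebesgue. (norm (G x))\<^sup>2)
          \<le> 2 * \<kappa>2 * real CARD('n) * (L / R)\<^sup>2 / \<kappa>1 * ?u"
      proof (rule Caccioppoli[OF a assms(10,11) open_cube assms(2) _ null sol conjunct1[OF \<phi>]])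
        show "open D" if "D \<in> Fs" for D using dom[OF that] by blast
        show "\<phi> x = 1" if "x \<in> cube (R / 2)" for x by (rule bspec[OF conjunct1[OF \<phi>2] that])
        show "\<exists>k. \<forall>x\<in>D. \<phi> x = k" if "D \<in> Fs" for D by (rule bspec[OF conjunct1[OF \<phi>3] that])
        show "\<bar>pd i \<phi> x\<bar> \<le> L / R" for x i
          using conjunct2[OF \<phi>3] by (elim allE)
      qed (use sub open_cube in auto)
      also have "\<dots> = C1 / R\<^sup>2 * ?u" by (simp add: C1_def power_divide)
      also have "\<dots> \<le> C / R\<^sup>2 * ?u" using C(1) nn by (intro mult_right_mono divide_right_mono) auto
      also have "\<dots> \<le> C / R\<^sup>2 * ?u + C / R powr (2 * l) * ?G" using C C1 nn by simp
      finally show ?thesis .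
    next
      case False
      have "R powr (2 * l) \<le> R0 powr (2 * l)" using False R assms(12) by (intro powr_mono2) auto
      then have "1 \<le> C / R powr (2 * l)" using C(2) R by (simp add: le_divide_eq)
      from mult_right_mono[OF this nn(2)] have "?G \<le> C / R powr (2 * l) * ?G" by (simp only: mult_1_left)
      moreover have "(LINT x:cube (R/2)|lebesgue. (norm (G x))\<^sup>2) \<le> ?G"
        unfolding set_lebesgue_integral_def
      proof (rule integral_mono)
        have i: "set_integrable lebesgue (cube R) (\<lambda>x. (norm (G x))\<^sup>2)"
          using sol unfolding weak_sol_Linf_def H1_def L2_on_def by blast
        then show "integrable lebesgue (\<lambda>x. indicator (cube R) x *\<^sub>R (norm (G x))\<^sup>2)"
          by (simp add: set_integrable_def)
        have "cube (R / 2) \<in> sets (lebesgue :: (real^'n) measure)"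
          by (intro sets_completionI_sets) (simp add: borel_open open_cube)
        from set_integrable_subset[OF i this sub]
        show "integrable lebesgue (\<lambda>x. indicator (cube (R / 2)) x *\<^sub>R (norm (G x))\<^sup>2)"
          by (simp add: set_integrable_def)
        show "indicator (cube (R / 2)) x *\<^sub>R (norm (G x))\<^sup>2 \<le> indicator (cube R) x *\<^sub>R (norm (G x))\<^sup>2" for x
          using sub by (auto simp: indicator_def)
      qed
      moreover have "0 \<le> C / R\<^sup>2 * ?u" using C C1 nn by simp
      ultimately show ?thesis by linarith
    qed
  qed
qed

end
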